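(* Suppose that either (1) $d\ge2$ and $p=1$, or (2) $p>1$. Consider discrete paths $\mathbf v^{(n)}\in V_n(a,b)$ such that either $\gamma_{\mathbf v^{(n)}}\in\operatorname{argmin}G_n$ for all large $n$, or $l_{\mathbf v^{(n)}}\in\operatorname{argmin}L_n$ for all large $n$. Then, for all realizations $\{X_i\}$ in an event of probability $1$, every subsequence of $\{\mathbf v^{(n)}\}$ has a further subsequence which converges in the Hausdorff metric to $S_\gamma$ for some $\gamma\in\operatorname{argmin}F$. Moreover, if $F$ has a unique (up to reparametrization) minimizer $\gamma$, then the whole sequence converges: $\lim_{n\to\infty}d_{haus}(\mathbf v^{(n)},S_\gamma)=0$.
   Context: Let $d\ge1$ and let $D\subset\mathbb R^d$ be the closure of a nonempty open, bounded, convex set; $|\cdot|$ is the Euclidean norm. The function $f:D\times\mathbb R^d\to[0,\infty)$ satisfies, for some $p\ge1$: (A0) $f$ is continuous on $D\times\mathbb R^d$ and $C^1$ on $D\times(\mathbb R^d\setminus\{0\})$; (A1) $f(x,v)$ is convex in $v$; (A2) $f(x,\lambda v)=\lambda^pf(x,v)$ for $\lambda>0$; (A3) there are $m_1,m_2>0$ with $m_1|v|^p\le f(x,v)\le m_2|v|^p$ for all $x\in D$, $v\in\mathbb R^d$. Fix $a,b\in D$. For $u,v\in D$, $\Omega(u,v)$ is the set of Lipschitz paths $\gamma:[0,1]\to D$ with $\gamma(0)=u$, $\gamma(1)=v$; $F(\gamma)=\int_0^1f(\gamma(t),\dot\gamma(t))\,dt$ and $d_f(u,v)=\inf_{\gamma\in\Omega(u,v)}F(\gamma)$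 (the infimum is attained). $\operatorname{argmin}F$ refers to minimization over $\Omega(a,b)$. Let $X_1,X_2,\dots$ be i.i.d. points in $D$ whose law has Lebesgue density $\rho$ satisfying $c_0\le\rho(x)\le c_0^{-1}$ for all $x\in D$ and some $c_0>0$. Put $\mathcal X_n=\{X_1,\dots,X_n\}$. Let $\epsilon_n>0$ satisfy $\lim_n\epsilon_n=0$ and $\limsup_{n\to\infty}\frac{(\log n)^{1/d}}{n^{1/d}}\frac1{\epsilon_n}=0$. The graph $\mathcal G_n(a,b)$ has vertex set $\mathcal X_n\cup\{a,b\}$, with an edge between $u,v$ iff $0<|u-v|<\epsilon_n$. $V_n(a,b)$ is the set of paths $\mathbf v=(v_0,\dots,v_m)$ ($m\ge1$ steps, $m$ arbitrary) of vertices with $v_0=a$, $v_m=b$ and an edge between $v_i$ and $v_{i+1}$ for $0\le i<m$; almost surely $V_n(a,b)\neq\emptyset$ for all large $n$. For $u,v\in D$ let $l_{u,v}(t)=(1-t)u+tv$. A Lipschitz path $\gamma$ is quasinormal if $f(\gamma(t),\dot\gamma(t))$ equals a constant for a.e. $t\in[0,1]$. It is known that for all $u,v\in D$ there is a quasinormal path in $\Omega(u,v)$ attaining $d_f(u,v)$; for each pair fix one such path and denote it $\gamma_{u,v}$. For $\mathbf v=(v_0,\dots,v_m)\in V_n(a,b)$ define $l_{\mathbf v},\gamma_{\mathbf v}\in\Omega(a,b)$ by $l_{\mathbf v}(t)=l_{v_i,v_{i+1}}(mt-i)$ and $\gamma_{\mathbf v}(t)=\gamma_{v_i,v_{i+1}}(mt-i)$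 for $i/m\le t\le(i+1)/m$. $L_n$ is the restriction of $F$ to $\Omega_n^l(a,b)=\{l_{\mathbf v}:\mathbf v\in V_n(a,b)\}$ and $G_n$ is the restriction of $F$ to $\Omega_n^\gamma(a,b)=\{\gamma_{\mathbf v}:\mathbf v\in V_n(a,b)\}$. For $\gamma\in\Omega(a,b)$, $S_\gamma=\{\gamma(t):0\le t\le1\}$. For compact $A,B\subset D$, $d_{haus}(A,B)=\max\{\sup_{x\in A}\inf_{y\in B}|x-y|,\ \sup_{y\in B}\inf_{x\in A}|x-y|\}$. A discrete path $\mathbf v=(v_0,\dots,v_m)$ is identified with the finite set $\{v_0,\dots,v_m\}$ in Hausdorff statements. "$F$ has a unique (up to reparametrization) minimizer $\gamma$" means that $\gamma\in\operatorname{argmin}F$ and every element of $\operatorname{argmin}F$ is obtained from $\gamma$ by reparametrization, i.e. is of the form $\gamma\circ s$ with $s:[0,1]\to[0,1]$ nondecreasing, Lipschitz, $s(0)=0$, $s(1)=1$. *)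

theory Defs
  imports "HOL-Probability.Probability"
begin

text \<open>On a set \<open>S\<close> that is not open, the derivative is the one taken within \<open>S\<close>. Here \<open>S\<close> will
  be \<open>D \<times> (- {0})\<close> with \<open>D\<close> the closure of an open convex set, so this derivative is unique.\<close>

definition C1_on :: "'b::real_normed_vector set \<Rightarrow> ('b \<Rightarrow> 'c::real_normed_vector) \<Rightarrow> bool" where
  "C1_on S g \<longleftrightarrow>
     (\<exists>g' :: 'b \<Rightarrow> 'b \<Rightarrow>\<^sub>L 'c. continuous_on S g' \<and>
        (\<forall>z\<in>S. (g has_derivative blinfun_apply (g' z)) (at z within S)))"

text \<open>Paths are total functions on the reals of which only the restriction to \<open>{0..1}\<close> matters;
  all notions below depend on that restriction only.\<close>

definition lipschitz_paths :: "'a::euclidean_space set \<Rightarrow> 'a \<Rightarrow> 'a \<Rightarrow> (real \<Rightarrow> 'a) set" where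
  "lipschitz_paths D u v =
     {\<gamma>. (\<exists>C. C-lipschitz_on {0..1} \<gamma>) \<and> path_image \<gamma> \<subseteq> D \<and> pathstart \<gamma> = u \<and> pathfinish \<gamma> = v}"

text \<open>A Lipschitz path is differentiable almost everywhere; the unspecified value of
  \<^const>\<open>vector_derivative\<close> elsewhere does not affect the integral.\<close>

definition velocity :: "(real \<Rightarrow> 'a::euclidean_space) \<Rightarrow> real \<Rightarrow> 'a" where
  "velocity \<gamma> t = vector_derivative \<gamma> (at t within {0..1})"

definition path_cost :: "('a::euclidean_space \<Rightarrow> 'a \<Rightarrow> real) \<Rightarrow> (real \<Rightarrow> 'a) \<Rightarrow> real" where
  "path_cost f \<gamma> = (LINT t:{0..1}|lebesgue. f (\<gamma> t) (velocity \<gamma> t))"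

definition argmin_on :: "('b \<Rightarrow> real) \<Rightarrow> 'b set \<Rightarrow> 'b set" where
  "argmin_on F S = {x. is_arg_min F (\<lambda>y. y \<in> S) x}"

definition cost_dist ::
  "('a::euclidean_space \<Rightarrow> 'a \<Rightarrow> real) \<Rightarrow> 'a set \<Rightarrow> 'a \<Rightarrow> 'a \<Rightarrow> real" where
  "cost_dist f D u v = (INF \<gamma>\<in>lipschitz_paths D u v. path_cost f \<gamma>)"

definition quasinormal :: "('a::euclidean_space \<Rightarrow> 'a \<Rightarrow> real) \<Rightarrow> (real \<Rightarrow> 'a) \<Rightarrow> bool" where
  "quasinormal f \<gamma> \<longleftrightarrow> (\<exists>C. C-lipschitz_on {0..1} \<gamma>) \<and>
     (\<exists>c. AE t in lebesgue. t \<in> {0..1} \<longrightarrow> f (\<gamma> t) (velocity \<gamma> t) = c)"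

definition reparametrization_of :: "(real \<Rightarrow> 'a) \<Rightarrow> (real \<Rightarrow> 'a) \<Rightarrow> bool" where
  "reparametrization_of \<eta> \<gamma> \<longleftrightarrow>
     (\<exists>s :: real \<Rightarrow> real. mono_on {0..1} s \<and> (\<exists>C. C-lipschitz_on {0..1} s) \<and>
        s ` {0..1} \<subseteq> {0..1} \<and> s 0 = 0 \<and> s 1 = 1 \<and> (\<forall>t\<in>{0..1}. \<eta> t = \<gamma> (s t)))"

text \<open>The vertices of the random geometric graph at stage \<open>n\<close>; the sample is indexed from \<open>1\<close>.\<close>

definition graph_vertices :: "(nat \<Rightarrow> 'w \<Rightarrow> 'a) \<Rightarrow> 'a \<Rightarrow> 'a \<Rightarrow> nat \<Rightarrow> 'w \<Rightarrow> 'a set" where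
  "graph_vertices X a b n \<omega> = (\<lambda>i. X i \<omega>) ` {1..n} \<union> {a, b}"

text \<open>A discrete path \<open>(v\<^sub>0, \<dots>, v\<^sub>m)\<close> is a list of length \<open>m + 1\<close> with \<open>m \<ge> 1\<close>;
  vertices may be revisited.\<close>

definition discrete_paths ::
  "'a::euclidean_space set \<Rightarrow> real \<Rightarrow> 'a \<Rightarrow> 'a \<Rightarrow> 'a list set" where
  "discrete_paths V \<epsilon> a b =
     {vs. 2 \<le> length vs \<and> set vs \<subseteq> V \<and> hd vs = a \<and> last vs = b \<and>
        (\<forall>i < length vs - 1. 0 < norm (vs ! i - vs ! Suc i) \<and> norm (vs ! i - vs ! Suc i) < \<epsilon>)}"

definition random_paths ::
  "(nat \<Rightarrow> 'w \<Rightarrow> 'a::euclidean_space) \<Rightarrow> (nat \<Rightarrow> real) \<Rightarrow> 'a \<Rightarrow> 'a \<Rightarrow> nat \<Rightarrow> 'w \<Rightarrow> 'a list set" where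
  "random_paths X \<epsilon> a b n \<omega> = discrete_paths (graph_vertices X a b n \<omega>) (\<epsilon> n) a b"

text \<open>Concatenation, at uniform time steps \<open>1/m\<close>, of the segments \<open>h v\<^sub>i v\<^sub>i\<^sub>+\<^sub>1\<close>. The index \<open>i\<close>
  picks one of the intervals \<open>[i/m, (i+1)/m]\<close> containing \<open>t\<close>; at a common end point of two
  intervals both choices give the same value, see \<open>concat_path_eq\<close>.\<close>

definition concat_path :: "('a \<Rightarrow> 'a \<Rightarrow> real \<Rightarrow> 'a) \<Rightarrow> 'a list \<Rightarrow> real \<Rightarrow> 'a" where
  "concat_path h vs t =
     (let m = length vs - 1; i = min (nat \<lfloor>real m * t\<rfloor>) (m - 1)
      in h (vs ! i) (vs ! Suc i) (real m * t - real i))"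

lemma concat_path_eq:
  assumes h: "\<And>i. Suc i < length vs \<Longrightarrow>
      h (vs ! i) (vs ! Suc i) 0 = vs ! i \<and> h (vs ! i) (vs ! Suc i) 1 = vs ! Suc i"
    and m: "m = length vs - 1" and i: "i < m"
    and t: "real i / real m \<le> t" "t \<le> real (Suc i) / real m"
  shows "concat_path h vs t = h (vs ! i) (vs ! Suc i) (real m * t - real i)"
proof -
  have lo: "real i \<le> real m * t" and up: "real m * t \<le> real (Suc i)"
    using t i by (simp_all add: field_simps)
  define j where "j = min (nat \<lfloor>real m * t\<rfloor>) (m - 1)"
  have cp: "concat_path h vs t = h (vs ! j) (vs ! Suc j) (real m * t - real j)"
    by (simp add: concat_path_def Let_def m j_def)
  show ?thesis
  proof (cases "real m * t = real (Suc i)")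
    case False
    then have "nat \<lfloor>real m * t\<rfloor> = i"
      using lo up by linarith
    then have "j = i"
      using i by (simp add: j_def)
    then show ?thesis
      by (simp add: cp)
  next
    case True
    have *: "nat \<lfloor>real m * t\<rfloor> = Suc i"
      unfolding True by linarith
    show ?thesis
    proof (cases "Suc i = m")
      case True
      then have "j = i"
        using * by (simp add: j_def)
      then show ?thesis
        by (simp add: cp)
    next
      case False
      then have "j = Suc i" "Suc (Suc i) < length vs" "Suc i < length vs"
        using * i m by (auto simp: j_def)
      then show ?thesis
        using h[of i] h[of "Suc i"] True by (simp add: cp)
    qed
  qed
qed

definition hausdorff_dist :: "'a::euclidean_space set \<Rightarrow> 'a set \<Rightarrow> real" where
  "hausdorff_dist A B =
     max (SUP x\<in>A. INF y\<in>B. norm (x - y)) (SUP y\<in>B. INF x\<in>A. norm (x - y))"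

end

theory Submission
  imports Defs "HOL-Complex_Analysis.Great_Picard"
begin

text \<open>Both discrete minimization problems are controlled by one quantity, the energy
  \<open>m^(p-1) * (\<Sum>i<m. d_f(v_i, v_(i+1)))\<close> of a chain \<open>(v_0, \<dots>,
  v_m)\<close>. It is the cost of the concatenated geodesics, and it is at most the cost of the
  polygonal path. The theorem holds because the energies of discrete minimizers are asymptotically
  at most \<open>d_f(a,b)\<close>, and because chains with this property can only accumulate at
  minimizers.

  Upper estimate. Almost surely the sample is \<open>\<kappa> * \<epsilon> n\<close>-dense in
  \<open>D\<close> for every \<open>\<kappa> > 0\<close> and all large \<open>n\<close>
  (\<open>sample_eventually_dense\<close>): a ball of that radius is missed with probability at
  most \<open>1/n^3\<close>, there are only \<open>O(n)\<close> balls to consider, and the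
  Borel-Cantelli lemma applies. Then equally spaced points on a quasinormal geodesic from
  \<open>a\<close> to \<open>b\<close> can be moved to sample points. Quasinormality makes the
  pieces of the geodesic equally expensive, and the displacements cost only
  \<open>O(\<kappa>)\<close> altogether, because \<open>O(1 / \<epsilon> n)\<close> points are
  used (\<open>approximable_distinct_ends\<close>). So there are chains whose polygonal path costs
  at most \<open>d_f(a,b) + \<eta>\<close>.

  Lower estimate and compactness (\<open>discrete_paths_compactness\<close>). For fixed
  \<open>x\<close> the gauge \<open>f(x,v)^(1/p)\<close> is subadditive in \<open>v\<close>, and
  for \<open>u\<close>, \<open>v\<close> near \<open>x\<close> its value at \<open>v - u\<close>
  is at most \<open>(1 + \<eta>) * d_f(u,v)^(1/p)\<close> (\<open>gauge_le_step\<close>). If a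
  chain is parametrized in proportion to the accumulated \<open>d_f(v_i, v_(i+1))^(1/p)\<close>,
  it becomes uniformly Lipschitz, and the Arzela-Ascoli theorem yields a limit curve. Adding the
  gauge inequality along the chain bounds the increments of the limit, hence its velocity: where
  the limit is differentiable, the integrand of the cost is at most \<open>d_f(a,b)\<close>.
  Therefore the limit is a minimizer; the pointwise bound takes the place of a semicontinuity
  theorem for the cost. The vertices lie on the interpolated curve and leave gaps of size
  \<open>O(\<epsilon> n)\<close> on it, which gives Hausdorff convergence.

  Both estimates need that Lipschitz curves are differentiable almost everywhere, and that the mean
  velocity belongs to every closed convex set which contains almost all velocities
  (\<open>mean_velocity_in_convex\<close>). Their source is the comparison of a Lipschitz function
  with the integral of a Dini derivate (\<open>lipschitz_increment_le_integral\<close>).\<close>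

section \<open>Almost everywhere differentiability of Lipschitz curves\<close>

text \<open>The last point up to which \<open>W\<close> loses at most \<open>e\<close> per unit length
  can be moved further to the right unless it is \<open>t\<close>.\<close>

lemma le_of_right_increments:
  fixes W :: "real \<Rightarrow> real"
  assumes st: "s \<le> t" and cont: "continuous_on {s..t} W"
    and incr: "\<And>x e. \<lbrakk>s \<le> x; x < t; 0 < e\<rbrakk> \<Longrightarrow> \<exists>y. x < y \<and> y \<le> t \<and> W x - e * (y - x) \<le> W y"
  shows "W s \<le> W t"
proof -
  have main: "W s - e * (t - s) \<le> W t" if e: "0 < e" for e
  proof -
    define S where "S = {x\<in>{s..t}. W s - e * (x - s) \<le> W x}"
    have "closed S"
      unfolding S_def using cont
      by (intro continuous_on_closed_Collect_le continuous_intros) auto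
    moreover have "bounded S"
      by (rule bounded_subset[of "{s..t}"]) (auto simp: S_def)
    ultimately have "compact S"
      by (simp add: compact_eq_bounded_closed)
    moreover have "s \<in> S"
      using st by (simp add: S_def)
    ultimately obtain x where x: "x \<in> S" and max: "\<And>y. y \<in> S \<Longrightarrow> y \<le> x"
      using compact_attains_sup[of S] by blast
    have "x = t"
    proof (rule ccontr)
      assume "x \<noteq> t"
      then have "s \<le> x" "x < t"
        using x by (auto simp: S_def)
      from incr[OF this e] obtain y where y: "x < y" "y \<le> t" "W x - e * (y - x) \<le> W y"
        by blast
      then have "W s - e * (y - s) \<le> W y"
        using x by (auto simp: S_def algebra_simps)
      then have "y \<in> S"
        using y x by (auto simp: S_def)
      with max y show False
        by fastforce
    qed
    with x show ?thesis
      by (simp add: S_def)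
  qed
  show ?thesis
  proof (rule field_le_epsilon)
    fix e :: real assume e: "0 < e"
    have "e / (t - s + 1) * (t - s) \<le> e"
      using st e by (simp add: field_simps)
    moreover have "0 < e / (t - s + 1)"
      using st e by simp
    ultimately show "W s \<le> W t + e"
      using main[of "e / (t - s + 1)"] by linarith
  qed
qed

text \<open>Counting the levels \<open>k * \<eta>\<close> below \<open>y\<close> recovers
  \<open>y\<close> up to one level. For \<open>y\<close> the value of a bounded function, this
  replaces the function by finitely many of its level sets.\<close>

lemma layer_sum_bounds:
  fixes y \<eta> :: real
  assumes "0 \<le> y" "0 \<le> \<eta>"
  shows "min y (\<eta> * real K) \<le> \<eta> * (\<Sum>k<K. of_bool (real k * \<eta> < y))"
    and "\<eta> * (\<Sum>k<K. of_bool (real k * \<eta> < y)) \<le> y + \<eta>"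
proof -
  show "min y (\<eta> * real K) \<le> \<eta> * (\<Sum>k<K. of_bool (real k * \<eta> < y))"
    using assms by (induction K) (auto simp: algebra_simps min_def split: if_splits)
  have "\<eta> * (\<Sum>k<K. of_bool (real k * \<eta> < y)) \<le> min (\<eta> * real K) (y + \<eta>)"
    using assms by (induction K) (auto simp: algebra_simps min_def split: if_splits)
  then show "\<eta> * (\<Sum>k<K. of_bool (real k * \<eta> < y)) \<le> y + \<eta>"
    by simp
qed

lemma measure_Int_Icc_diff:
  fixes S :: "real set"
  assumes "open S" "s \<le> x" "x \<le> y"
  shows "measure lborel (S \<inter> {s..y}) - measure lborel (S \<inter> {s..x}) = measure lborel (S \<inter> {x<..y})"
proof -
  have fin: "S \<inter> A \<in> fmeasurable lborel" if "A \<in> fmeasurable lborel" for A :: "real set"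
    using that assms(1) by (simp add: fmeasurable_Int_fmeasurable Int_commute)
  have "S \<inter> {s..y} = (S \<inter> {s..x}) \<union> (S \<inter> {x<..y})"
    using assms by auto
  moreover have "S \<inter> {s..x} \<inter> (S \<inter> {x<..y}) = {}"
    by auto
  moreover have "{x<..y} \<in> fmeasurable lborel" "{s..x} \<in> fmeasurable lborel"
    by (auto simp: fmeasurable_def emeasure_lborel_Icc_eq emeasure_lborel_Ioc assms)
  ultimately show ?thesis
    using fin by (simp add: measure_Un_AE fmeasurable_def measure_Union)
qed

text \<open>The level sets of \<open>h + B\<close> are enlarged to open sets at a small cost in
  measure, and \<open>U\<close> is the primitive of the corresponding layer sum. An open set that
  contains \<open>x\<close> also contains an interval to the right of \<open>x\<close>, so
  \<open>U\<close> increases there at least at the rate \<open>h x + B\<close>, at every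
  \<open>x\<close> and not just at almost every one. Hence \<open>le_of_right_increments\<close>
  applies to \<open>U x - B * x - g x\<close>.\<close>

lemma lipschitz_increment_le_integral:
  fixes g h :: "real \<Rightarrow> real"
  assumes g: "C-lipschitz_on UNIV g" and h: "h \<in> borel_measurable borel"
    and B: "\<And>x. \<bar>h x\<bar> \<le> B" and st: "s \<le> t"
    and dini: "\<And>x e d. \<lbrakk>s \<le> x; x < t; 0 < e; 0 < d\<rbrakk> \<Longrightarrow>
        \<exists>y. x < y \<and> y < x + d \<and> g y - g x \<le> (h x + e) * (y - x)"
  shows "g t - g s \<le> (LINT x:{s..t}|lborel. h x)"
proof -
  have B0: "0 \<le> B"
    using B[of 0] by linarith
  have Icc: "{u..v} \<in> fmeasurable lborel" "measure lborel {u..v} \<le> max 0 (v - u)" for u v :: real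
    by (auto simp: fmeasurable_def emeasure_lborel_Icc_eq)
  have hint: "set_integrable lborel {s..t} h"
    unfolding set_integrable_def
    by (rule integrableI_bounded_set_indicator[where B=B])
      (use h B in \<open>auto simp: emeasure_lborel_Icc_eq\<close>)
  have main: "g t - g s \<le> (LINT x:{s..t}|lborel. h x) + \<eta> * (t - s + 2 * B + \<eta>)"
    if \<eta>: "0 < \<eta>" for \<eta>
  proof -
    define K where "K = nat \<lceil>2 * B / \<eta>\<rceil>"
    have K: "2 * B \<le> \<eta> * real K" "\<eta> * real K \<le> 2 * B + \<eta>"
    proof -
      have "0 \<le> 2 * B / \<eta>"
        using B0 \<eta> by simp
      then have "2 * B / \<eta> \<le> real K" "real K \<le> 2 * B / \<eta> + 1"
        unfolding K_def by linarith+
      then show "2 * B \<le> \<eta> * real K" "\<eta> * real K \<le> 2 * B + \<eta>"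
        using \<eta> by (simp_all add: field_simps)
    qed
    define A where "A k = {x\<in>{s..t}. real k * \<eta> < h x + B}" for k :: nat
    have A [measurable]: "A k \<in> sets borel" for k
    proof -
      have "A k = {s..t} \<inter> {x\<in>space borel. real k * \<eta> < h x + B}"
        by (auto simp: A_def)
      also have "\<dots> \<in> sets borel"
        by (intro sets.Int borel_measurable_less borel_measurable_add h borel_measurable_const) auto
      finally show ?thesis .
    qed
    have Afin: "A k \<in> fmeasurable lborel" for k
    proof -
      have sub: "A k \<subseteq> {s..t}"
        by (auto simp: A_def)
      show ?thesis
        using A[of k] by (intro fmeasurableI2[OF Icc(1)[of s t] sub]) simp
    qed
    have "\<exists>U. open U \<and> A k \<subseteq> U \<and> emeasure lborel (U - A k) < ennreal \<eta>" for k
      using outer_regular_lborel[OF A \<eta>] by blast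
    then obtain Q where Q: "\<And>k. open (Q k)" "\<And>k. A k \<subseteq> Q k"
        and Qe: "\<And>k. emeasure lborel (Q k - A k) < ennreal \<eta>"
      by metis
    define U where "U x = \<eta> * (\<Sum>k<K. measure lborel (Q k \<inter> {s..x}))" for x
    have Udiff: "U y - U x = \<eta> * (\<Sum>k<K. measure lborel (Q k \<inter> {x<..y}))"
      if "s \<le> x" "x \<le> y" for x y
      unfolding U_def using measure_Int_Icc_diff[OF Q(1) that]
      by (simp add: right_diff_distrib[symmetric] sum_subtractf[symmetric])
    have Ioc: "{x<..y} \<in> fmeasurable lborel" "measure lborel {x<..y} = y - x" if "x \<le> y" for x y :: real
      using that by (auto simp: fmeasurable_def)
    have "(\<eta> * real K)-lipschitz_on {s..t} U"
    proof (rule lipschitz_on_leI)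
      fix x y assume xy: "x \<in> {s..t}" "y \<in> {s..t}" "x \<le> y"
      have "measure lborel (Q k \<inter> {x<..y}) \<le> y - x" for k
        using measure_mono_fmeasurable[of "Q k \<inter> {x<..y}" "{x<..y}" lborel] Q(1)[of k] Ioc[OF xy(3)]
        by auto
      then have "(\<Sum>k<K. measure lborel (Q k \<inter> {x<..y})) \<le> real K * (y - x)"
        using sum_bounded_above[of "{..<K}" "\<lambda>k. measure lborel (Q k \<inter> {x<..y})" "y - x"] by simp
      then have "U y - U x \<le> \<eta> * real K * (y - x)"
        using Udiff[of x y] xy \<eta> by (simp add: mult_left_mono)
      moreover have "0 \<le> U y - U x"
        using Udiff[of x y] xy \<eta> by (simp add: sum_nonneg)
      ultimately show "dist (U x) (U y) \<le> \<eta> * real K * dist x y"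
        using xy by (simp add: dist_real_def)
    qed (use \<eta> in simp)
    then have contU: "continuous_on {s..t} U"
      by (rule lipschitz_on_continuous_on)
    have contg: "continuous_on {s..t} g"
      using lipschitz_on_continuous_on[OF g] continuous_on_subset by blast
    define W where "W x = U x - B * x - g x" for x
    have "W s \<le> W t"
    proof (rule le_of_right_increments[OF st])
      show "continuous_on {s..t} W"
        unfolding W_def using contU contg by (intro continuous_intros)
    next
      fix x e :: real assume x: "s \<le> x" "x < t" and e: "0 < e"
      have "\<exists>d>0. \<forall>k\<in>{k. k < K \<and> x \<in> Q k}. {x<..<x+d} \<subseteq> Q k"
      proof -
        have "\<exists>d>0. ball x d \<subseteq> (\<Inter>k\<in>{k. k < K \<and> x \<in> Q k}. Q k)"
          by (rule open_contains_ball_eq[THEN iffD1, rule_format]) (use Q(1) in auto)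
        then obtain d where "d > 0" "ball x d \<subseteq> (\<Inter>k\<in>{k. k < K \<and> x \<in> Q k}. Q k)"
          by blast
        then show ?thesis
          by (intro exI[of _ d]) (auto simp: subset_iff dist_real_def)
      qed
      then obtain d where d: "d > 0" "\<And>k. \<lbrakk>k < K; x \<in> Q k\<rbrakk> \<Longrightarrow> {x<..<x+d} \<subseteq> Q k"
        by blast
      obtain y where y: "x < y" "y < x + min d (t - x)" "g y - g x \<le> (h x + e) * (y - x)"
        using dini[OF x e, of "min d (t - x)"] d x by auto
      have "of_bool (real k * \<eta> < h x + B) * (y - x) \<le> measure lborel (Q k \<inter> {x<..y})" if "k < K" for k
      proof (cases "real k * \<eta> < h x + B")
        case True
        then have "x \<in> A k"
          using x by (auto simp: A_def)
        then have "{x<..y} \<subseteq> Q k"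
          using d(2)[OF that] Q(2) y by fastforce
        then have "Q k \<inter> {x<..y} = {x<..y}"
          by auto
        then show ?thesis
          using y by (simp add: True)
      qed simp
      then have "(\<Sum>k<K. of_bool (real k * \<eta> < h x + B)) * (y - x) \<le> (\<Sum>k<K. measure lborel (Q k \<inter> {x<..y}))"
        unfolding sum_distrib_right by (intro sum_mono) auto
      then have "\<eta> * ((\<Sum>k<K. of_bool (real k * \<eta> < h x + B)) * (y - x)) \<le> U y - U x"
        using Udiff[of x y] x y \<eta> by (simp add: mult_left_mono del: sum_of_bool_eq)
      moreover have hB: "0 \<le> h x + B" "h x + B \<le> 2 * B"
        using B[of x] by auto
      then have "h x + B \<le> \<eta> * (\<Sum>k<K. of_bool (real k * \<eta> < h x + B))"
        using layer_sum_bounds(1)[of "h x + B" \<eta> K] K \<eta> by linarith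
      then have "(h x + B) * (y - x) \<le> \<eta> * (\<Sum>k<K. of_bool (real k * \<eta> < h x + B)) * (y - x)"
        using y by (intro mult_right_mono) auto
      ultimately have "(h x + B) * (y - x) \<le> U y - U x"
        by (simp add: mult.assoc)
      then have "W x - e * (y - x) \<le> W y"
        using y by (simp add: W_def algebra_simps)
      then show "\<exists>y>x. y \<le> t \<and> W x - e * (y - x) \<le> W y"
        using y by (intro exI[of _ y]) auto
    qed
    moreover have "U s = 0"
    proof -
      have "measure lborel (Q k \<inter> {s..s}) = 0" for k
        by (cases "s \<in> Q k") auto
      then show ?thesis
        by (simp add: U_def)
    qed
    ultimately have "g t - g s \<le> U t - B * (t - s)"
      by (simp add: W_def algebra_simps)
    moreover have "U t \<le> (LINT x:{s..t}|lborel. h x + B + \<eta>) + \<eta> * (2 * B + \<eta>)"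
    proof -
      have "measure lborel (Q k \<inter> {s..t}) \<le> measure lborel (A k) + \<eta>" for k
      proof -
        have fm: "Q k - A k \<in> fmeasurable lborel"
          using Qe[of k] Q(1)[of k] by (auto simp: fmeasurable_def intro: less_trans)
        have "measure lborel (Q k - A k) \<le> \<eta>"
          using Qe[of k] \<eta> by (simp add: measure_def enn2real_leI)
        moreover have "measure lborel (Q k \<inter> {s..t}) \<le> measure lborel (A k \<union> (Q k - A k))"
          using Q[of k] by (intro measure_mono_fmeasurable fmeasurable.Un Afin fm) auto
        moreover have "measure lborel (A k \<union> (Q k - A k)) \<le> measure lborel (A k) + measure lborel (Q k - A k)"
          using Afin fm by (intro measure_Un_le) auto
        ultimately show ?thesis
          by linarith
      qed
      then have "(\<Sum>k<K. measure lborel (Q k \<inter> {s..t})) \<le> (\<Sum>k<K. measure lborel (A k) + \<eta>)"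
        by (intro sum_mono)
      then have "U t \<le> \<eta> * (\<Sum>k<K. measure lborel (A k)) + \<eta> * (\<eta> * real K)"
        using \<eta> unfolding U_def
        by (subst distrib_left[symmetric]) (intro mult_left_mono, auto simp: sum.distrib algebra_simps)
      also have "\<eta> * (\<eta> * real K) \<le> \<eta> * (2 * B + \<eta>)"
        using K \<eta> by (intro mult_left_mono) auto
      also have "\<eta> * (\<Sum>k<K. measure lborel (A k)) = (LINT x|lborel. \<eta> * (\<Sum>k<K. indicat_real (A k) x))"
        using Afin by (simp add: fmeasurable_def)
      also have "\<dots> \<le> (LINT x:{s..t}|lborel. h x + B + \<eta>)"
        unfolding set_lebesgue_integral_def
      proof (rule integral_mono)
        show "integrable lborel (\<lambda>x. \<eta> * (\<Sum>k<K. indicat_real (A k) x))"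
          using Afin by (auto simp: fmeasurable_def)
        show "integrable lborel (\<lambda>x. indicat_real {s..t} x *\<^sub>R (h x + B + \<eta>))"
          using hint unfolding set_integrable_def[symmetric]
          by (intro set_integral_add) (auto simp: set_integrable_def emeasure_lborel_Icc_eq)
        fix x
        show "\<eta> * (\<Sum>k<K. indicat_real (A k) x) \<le> indicat_real {s..t} x *\<^sub>R (h x + B + \<eta>)"
        proof (cases "x \<in> {s..t}")
          case True
          then have "(\<Sum>k<K. indicat_real (A k) x) = (\<Sum>k<K. of_bool (real k * \<eta> < h x + B))"
            by (intro sum.cong) (auto simp: A_def indicator_def)
          then show ?thesis
            using layer_sum_bounds(2)[of "h x + B" \<eta> K] B[of x] \<eta> True by simp
        next
          case False
          then have "x \<notin> A k" for k
            by (auto simp: A_def)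
          then show ?thesis
            using False by simp
        qed
      qed
      finally show ?thesis
        by simp
    qed
    moreover have "(LINT x:{s..t}|lborel. h x + B + \<eta>) = (LINT x:{s..t}|lborel. h x) + (B + \<eta>) * (t - s)"
    proof -
      have "set_integrable lborel {s..t} (\<lambda>x. B + \<eta>)"
        by (auto simp: set_integrable_def emeasure_lborel_Icc_eq)
      with hint have "(LINT x:{s..t}|lborel. h x + (B + \<eta>)) = (LINT x:{s..t}|lborel. h x) + (LINT x:{s..t}|lborel. B + \<eta>)"
        by (rule set_integral_add)
      then show ?thesis
        using st by (simp add: add.assoc mult.commute set_lebesgue_integral_def)
    qed
    ultimately show ?thesis
      by (simp add: algebra_simps)
  qed
  show ?thesis
  proof (rule field_le_epsilon)
    fix e :: real assume e: "0 < e"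
    define c where "c = t - s + 2 * B + 1"
    have c: "0 < c"
      using st B0 by (simp add: c_def)
    define \<eta> where "\<eta> = min 1 (e / c)"
    have \<eta>: "0 < \<eta>" "\<eta> \<le> 1" "\<eta> * c \<le> e"
      using e c by (auto simp: \<eta>_def min_def field_simps)
    have "\<eta> * (t - s + 2 * B + \<eta>) \<le> \<eta> * c"
      using \<eta> by (intro mult_left_mono) (auto simp: c_def)
    then show "g t - g s \<le> (LINT x:{s..t}|lborel. h x) + e"
      using main[OF \<eta>(1)] \<eta>(3) by linarith
  qed
qed

text \<open>Using only rational increments makes the lower right Dini derivate a countable supremum of
  countable infima of continuous functions, hence Borel; the lower bound extends to real
  increments by continuity of \<open>g\<close>.\<close>

lemma lower_right_dini_derivate:
  fixes g :: "real \<Rightarrow> real"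
  assumes g: "C-lipschitz_on UNIV g"
  obtains h :: "real \<Rightarrow> real" where "h \<in> borel_measurable borel" "\<And>x. \<bar>h x\<bar> \<le> C"
    "\<And>x e d. \<lbrakk>0 < e; 0 < d\<rbrakk> \<Longrightarrow> \<exists>k. 0 < k \<and> k < d \<and> (g (x + k) - g x) / k < h x + e"
    "\<And>x e. 0 < e \<Longrightarrow> \<exists>d>0. \<forall>k. 0 < k \<and> k < d \<longrightarrow> h x - e \<le> (g (x + k) - g x) / k"
proof -
  define R where "R n = \<rat> \<inter> {0<..<1 / real (Suc n)}" for n
  define q where "q x k = (g (x + k) - g x) / k" for x k
  define h where "h x = (SUP n. INF k\<in>R n. q x k)" for x
  have contg: "continuous_on UNIV g"
    using lipschitz_on_continuous_on[OF g] .
  have R_ne: "R n \<noteq> {}" for n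
    using Rats_dense_in_real[of 0 "1 / real (Suc n)"] by (auto simp: R_def)
  have R_count: "countable (R n)" for n
    unfolding R_def by (intro countable_Int1 countable_rat)
  have q_bound: "\<bar>q x k\<bar> \<le> C" if "0 < k" for x k
  proof -
    have "\<bar>g (x + k) - g x\<bar> \<le> C * k"
      using lipschitz_onD[OF g, of "x + k" x] that by (simp add: dist_real_def)
    then show ?thesis
      using that by (simp add: q_def abs_divide field_simps)
  qed
  have q_lo: "- C \<le> q x k" and q_up: "q x k \<le> C" if "0 < k" for x k
    using q_bound[OF that, of x] by auto
  have R_pos: "0 < k" if "k \<in> R n" for k n
    using that by (simp add: R_def)
  have bdd_q: "bdd_below (q x ` R n)" for x n
    by (rule bdd_belowI2[where m="- C"]) (use q_lo R_pos in auto)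
  have inf_lo: "- C \<le> (INF k\<in>R n. q x k)" for x n
    by (rule cINF_greatest) (use R_ne q_lo R_pos in auto)
  have inf_up: "(INF k\<in>R n. q x k) \<le> C" for x n
  proof -
    obtain k where k: "k \<in> R n"
      using R_ne by blast
    then show ?thesis
      using cINF_lower[OF bdd_q[of x n] k] q_up[OF R_pos[OF k], of x] by linarith
  qed
  have bdd_inf: "bdd_above (range (\<lambda>n. INF k\<in>R n. q x k))" for x
    by (rule bdd_aboveI2[where M=C]) (rule inf_up)
  have mono: "(INF k\<in>R n. q x k) \<le> (INF k\<in>R m. q x k)" if "n \<le> m" for n m x
  proof (rule cINF_superset_mono[OF R_ne bdd_q])
    have "1 / real (Suc m) \<le> 1 / real (Suc n)"
      using that by (intro divide_left_mono) auto
    then show "R m \<subseteq> R n"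
      by (auto simp: R_def)
  qed simp
  show thesis
  proof (rule that)
    show "h \<in> borel_measurable borel"
      unfolding h_def
    proof (rule borel_measurable_cSUP)
      show "(\<lambda>x. INF k\<in>R n. q x k) \<in> borel_measurable borel" for n
      proof (rule borel_measurable_cINF[OF R_count _ bdd_q])
        fix k assume "k \<in> R n"
        then have "k \<noteq> 0"
          using R_pos by force
        then have "continuous_on UNIV (\<lambda>x. q x k)"
          unfolding q_def
          by (intro continuous_intros continuous_on_compose2[OF contg]) auto
        then show "(\<lambda>x. q x k) \<in> borel_measurable borel"
          by (rule borel_measurable_continuous_onI)
      qed
    qed (use bdd_inf in auto)
  next
    fix x
    have "h x \<le> C"
      unfolding h_def by (rule cSUP_least) (use inf_up in auto)
    moreover have "- C \<le> h x"
      unfolding h_def using cSUP_upper[OF UNIV_I bdd_inf[of x], of 0] inf_lo[of x 0] by simp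
    ultimately show "\<bar>h x\<bar> \<le> C"
      by linarith
  next
    fix x e d :: real assume e: "0 < e" and d: "0 < d"
    obtain n where n: "1 / real (Suc n) < d"
      using reals_Archimedean[OF d] by (auto simp: inverse_eq_divide)
    have "(INF k\<in>R n. q x k) < h x + e"
      using cSUP_upper[OF UNIV_I bdd_inf[of x], of n] e by (simp add: h_def)
    then obtain k where "k \<in> R n" "q x k < h x + e"
      using cINF_less_iff[OF R_ne bdd_q] by blast
    then show "\<exists>k>0. k < d \<and> (g (x + k) - g x) / k < h x + e"
      using n by (intro exI[of _ k]) (auto simp: R_def q_def)
  next
    fix x e :: real assume e: "0 < e"
    have "h x - e < h x"
      using e by simp
    then obtain n where n: "h x - e < (INF k\<in>R n. q x k)"
      unfolding h_def[of x] using less_cSUP_iff[OF _ bdd_inf] by (metis UNIV_not_empty)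
    show "\<exists>d>0. \<forall>k. 0 < k \<and> k < d \<longrightarrow> h x - e \<le> (g (x + k) - g x) / k"
    proof (intro exI[of _ "1 / real (Suc n)"] conjI allI impI)
      fix k assume k: "0 < k \<and> k < 1 / real (Suc n)"
      show "h x - e \<le> (g (x + k) - g x) / k"
      proof (rule ccontr)
        assume "\<not> ?thesis"
        then have less: "q x k < h x - e"
          by (simp add: q_def)
        have "continuous_on {0<..} (q x)"
          unfolding q_def by (intro continuous_intros continuous_on_compose2[OF contg]) auto
        then have "continuous (at k) (q x)"
          using k by (simp add: continuous_on_eq_continuous_at)
        then have "\<forall>\<^sub>F y in at k. q x y < h x - e"
          using less unfolding continuous_at by (rule order_tendstoD)
        then obtain d where d: "0 < d" "\<And>y. \<lbrakk>y \<noteq> k; dist y k < d\<rbrakk> \<Longrightarrow> q x y < h x - e"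
          by (auto simp: eventually_at)
        have "k < min (k + d) (1 / real (Suc n))"
          using d k by auto
        then obtain y where y: "y \<in> \<rat>" "k < y" "y < min (k + d) (1 / real (Suc n))"
          using Rats_dense_in_real by blast
        then have "y \<in> R n"
          using k by (auto simp: R_def)
        then have "h x - e < q x y"
          using n cINF_lower[OF bdd_q[of x n], of y] by linarith
        moreover have "q x y < h x - e"
          using d(2)[of y] y by (simp add: dist_real_def)
        ultimately show False
          by simp
      qed
    qed simp
  qed
qed

text \<open>Over any interval the lower right derivate \<open>h\<close> integrates to at least the
  increment of \<open>g\<close> and the upper one, \<open>- H\<close>, to at most that increment.
  As \<open>h \<le> - H\<close> everywhere, they agree almost everywhere.\<close>

lemma lipschitz_right_derivative_AE:
  fixes g :: "real \<Rightarrow> real"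
  assumes g: "C-lipschitz_on UNIV g"
  shows "AE x in lborel. \<exists>l. ((\<lambda>k. (g (x + k) - g x) / k) \<longlongrightarrow> l) (at_right 0)"
proof -
  have g': "C-lipschitz_on UNIV (\<lambda>x. - g x)"
    using g by simp
  obtain h where h: "h \<in> borel_measurable borel" "\<And>x. \<bar>h x\<bar> \<le> C"
    and h1: "\<And>x e d. \<lbrakk>0 < e; 0 < d\<rbrakk> \<Longrightarrow> \<exists>k. 0 < k \<and> k < d \<and> (g (x + k) - g x) / k < h x + e"
    and h2: "\<And>x e. 0 < e \<Longrightarrow> \<exists>d>0. \<forall>k. 0 < k \<and> k < d \<longrightarrow> h x - e \<le> (g (x + k) - g x) / k"
    using lower_right_dini_derivate[OF g] by metis
  obtain H where H: "H \<in> borel_measurable borel" "\<And>x. \<bar>H x\<bar> \<le> C"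
    and H1: "\<And>x e d. \<lbrakk>0 < e; 0 < d\<rbrakk> \<Longrightarrow> \<exists>k. 0 < k \<and> k < d \<and> (- g (x + k) - - g x) / k < H x + e"
    and H2: "\<And>x e. 0 < e \<Longrightarrow> \<exists>d>0. \<forall>k. 0 < k \<and> k < d \<longrightarrow> H x - e \<le> (- g (x + k) - - g x) / k"
    using lower_right_dini_derivate[OF g'] by metis
  have incr: "\<exists>y. x < y \<and> y < x + d \<and> u y - u x \<le> (c + e) * (y - x)"
    if ex: "\<exists>k. 0 < k \<and> k < d \<and> (u (x + k) - u x) / k < c + e" for u :: "real \<Rightarrow> real" and x d c e
  proof -
    from ex obtain k where k: "0 < k \<and> k < d \<and> (u (x + k) - u x) / k < c + e" ..
    then have "u (x + k) - u x \<le> (c + e) * k"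
      using pos_divide_less_eq[of k "u (x + k) - u x" "c + e"] by linarith
    with k show ?thesis
      by (intro exI[of _ "x + k"]) simp
  qed
  have le0: "0 \<le> - H x - h x" for x
  proof (rule field_le_epsilon)
    fix e :: real assume e: "0 < e"
    obtain d where d: "0 < d" "\<And>k. 0 < k \<and> k < d \<Longrightarrow> h x - e / 2 \<le> (g (x + k) - g x) / k"
      using h2[OF half_gt_zero[OF e], of x] by blast
    obtain d' where d': "0 < d'" "\<And>k. 0 < k \<and> k < d' \<Longrightarrow> H x - e / 2 \<le> (- g (x + k) - - g x) / k"
      using H2[OF half_gt_zero[OF e], of x] by blast
    define k where "k = min d d' / 2"
    have k: "0 < k" "k < d" "k < d'"
      using d(1) d'(1) by (auto simp: k_def min_def)
    have "H x - e / 2 \<le> (- g (x + k) - - g x) / k"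
      using d'(2) k by blast
    moreover have "h x - e / 2 \<le> (g (x + k) - g x) / k"
      using d(2) k by blast
    moreover have "(- g (x + k) - - g x) / k = - ((g (x + k) - g x) / k)"
      by (simp add: diff_divide_distrib)
    ultimately show "0 \<le> - H x - h x + e"
      by linarith
  qed
  have "AE x in lborel. x \<in> {- real n..real n} \<longrightarrow> - H x - h x = 0" for n
  proof -
    let ?I = "{- real n..real n}"
    have int: "set_integrable lborel ?I u"
      if "u \<in> borel_measurable borel" "\<And>x. \<bar>u x\<bar> \<le> C" for u
      unfolding set_integrable_def
      by (rule integrableI_bounded_set_indicator[where B=C])
        (use that in \<open>auto simp: emeasure_lborel_Icc_eq\<close>)
    note ih = int[OF h] and iH = int[OF H]
    have "g (real n) - g (- real n) \<le> (LINT x:?I|lborel. h x)"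
      by (rule lipschitz_increment_le_integral[OF g h]) (simp, rule incr[OF h1], assumption+)
    moreover have "- g (real n) - - g (- real n) \<le> (LINT x:?I|lborel. H x)"
      by (rule lipschitz_increment_le_integral[OF g' H]) (simp, rule incr[where u="\<lambda>x. - g x", OF H1], assumption+)
    moreover have "set_integrable lborel ?I (\<lambda>x. - H x)"
      using iH by (simp add: set_integrable_def)
    then have i: "set_integrable lborel ?I (\<lambda>x. - H x - h x)"
      and eq: "(LINT x:?I|lborel. - H x - h x) = - (LINT x:?I|lborel. H x) - (LINT x:?I|lborel. h x)"
      using ih by (simp_all add: set_integral_diff set_integral_uminus iH)
    ultimately have "(LINT x:?I|lborel. - H x - h x) \<le> 0"
      by simp
    moreover have nn: "0 \<le> indicat_real ?I x *\<^sub>R (- H x - h x)" for x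
      using le0[of x] by simp
    ultimately have "(LINT x:?I|lborel. - H x - h x) = 0"
      unfolding set_lebesgue_integral_def by (intro antisym integral_nonneg) auto
    then have "AE x in lborel. indicat_real ?I x *\<^sub>R (- H x - h x) = 0"
      using integral_nonneg_eq_0_iff_AE[of lborel "\<lambda>x. indicat_real ?I x *\<^sub>R (- H x - h x)"] i nn
      by (simp add: set_integrable_def set_lebesgue_integral_def)
    then show ?thesis
      by eventually_elim (auto simp: indicator_def)
  qed
  then have "AE x in lborel. \<forall>n. x \<in> {- real n..real n} \<longrightarrow> - H x - h x = 0"
    by (subst AE_all_countable) auto
  then show ?thesis
  proof eventually_elim
    fix x assume *: "\<forall>n. x \<in> {- real n..real n} \<longrightarrow> - H x - h x = 0"
    obtain n where "\<bar>x\<bar> \<le> real n"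
      using real_arch_simple by blast
    then have "x \<in> {- real n..real n}"
      by (auto simp: abs_le_iff)
    with * have "- H x - h x = 0"
      by blast
    then have eq: "H x = - h x"
      by linarith
    have "((\<lambda>k. (g (x + k) - g x) / k) \<longlongrightarrow> h x) (at_right 0)"
    proof (rule tendstoI)
      fix e :: real assume e: "0 < e"
      obtain d where d: "0 < d" "\<And>k. 0 < k \<and> k < d \<Longrightarrow> h x - e / 2 \<le> (g (x + k) - g x) / k"
        using h2[OF half_gt_zero[OF e], of x] by blast
      obtain d' where d': "0 < d'" "\<And>k. 0 < k \<and> k < d' \<Longrightarrow> - h x - e / 2 \<le> (- g (x + k) - - g x) / k"
        using H2[OF half_gt_zero[OF e], of x] unfolding eq by blast
      have "dist ((g (x + k) - g x) / k) (h x) < e" if "0 < k" "k < min d d'" for k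
      proof -
        have "(- g (x + k) - - g x) / k = - ((g (x + k) - g x) / k)"
          by (simp add: diff_divide_distrib)
        then show ?thesis
          using d(2)[of k] d'(2)[of k] that e unfolding dist_real_def by linarith
      qed
      then show "\<forall>\<^sub>F k in at_right 0. dist ((g (x + k) - g x) / k) (h x) < e"
        using d(1) d'(1) unfolding eventually_at_right_field
        by (intro exI[of _ "min d d'"]) auto
    qed
    then show "\<exists>l. ((\<lambda>k. (g (x + k) - g x) / k) \<longlongrightarrow> l) (at_right 0)"
      by blast
  qed
qed

text \<open>A point where \<open>g y - q * y\<close> has a strict local minimum is determined by
  \<open>q\<close> and a rational interval on which it is the strict minimum.\<close>

lemma countable_strict_corners:
  fixes g :: "real \<Rightarrow> real"
  shows "countable {x. \<exists>q\<in>\<rat>. \<exists>d>0. \<forall>y. y \<noteq> x \<and> \<bar>y - x\<bar> < d \<longrightarrow> g x - q * x < g y - q * y}"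
    (is "countable ?S")
proof -
  define E where "E = (\<lambda>(q, c, e). {x. c < x \<and> x < e \<and> (\<forall>y. y \<noteq> x \<and> c < y \<and> y < e \<longrightarrow> g x - q * x < g y - q * y)})"
  have E: "countable (E i)" for i
  proof -
    obtain q c e where i: "i = (q, c, e)"
      by (cases i) auto
    have "x = y" if "x \<in> E i" "y \<in> E i" for x y
    proof (rule ccontr)
      assume "x \<noteq> y"
      then have "g x - q * x < g y - q * y" "g y - q * y < g x - q * x"
        using that by (auto simp: E_def i)
      then show False
        by simp
    qed
    then have "E i = {} \<or> (\<exists>x. E i = {x})"
      by blast
    then show ?thesis
      by auto
  qed
  have "?S \<subseteq> (\<Union>i\<in>\<rat> \<times> \<rat> \<times> \<rat>. E i)"
  proof
    fix x assume "x \<in> ?S"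
    then obtain q d where q: "q \<in> \<rat>" and d: "d > 0"
      and min: "\<And>y. \<lbrakk>y \<noteq> x; \<bar>y - x\<bar> < d\<rbrakk> \<Longrightarrow> g x - q * x < g y - q * y"
      by blast
    obtain c where c: "c \<in> \<rat>" "x - d < c" "c < x"
      using Rats_dense_in_real[of "x - d" x] d by auto
    obtain e where e: "e \<in> \<rat>" "x < e" "e < x + d"
      using Rats_dense_in_real[of x "x + d"] d by auto
    have "x \<in> E (q, c, e)"
      using c e min by (auto simp: E_def)
    then show "x \<in> (\<Union>i\<in>\<rat> \<times> \<rat> \<times> \<rat>. E i)"
      using q c(1) e(1) by blast
  qed
  moreover have "countable (\<Union>i\<in>\<rat> \<times> \<rat> \<times> \<rat>. E i)"
    using E countable_rat by (intro countable_UN countable_SIGMA) auto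
  ultimately show ?thesis
    using countable_subset by blast
qed

text \<open>A line whose slope lies strictly between the one-sided derivatives touches the graph from
  below.\<close>

lemma corner_of_one_sided_limits:
  fixes g :: "real \<Rightarrow> real"
  assumes r: "((\<lambda>k. (g (x + k) - g x) / k) \<longlongrightarrow> r) (at_right 0)"
    and l: "((\<lambda>k. (g (x + k) - g x) / k) \<longlongrightarrow> l) (at_left 0)"
    and lr: "l < r"
  shows "\<exists>q\<in>\<rat>. \<exists>d>0. \<forall>y. y \<noteq> x \<and> \<bar>y - x\<bar> < d \<longrightarrow> g x - q * x < g y - q * y"
proof -
  obtain q where q: "q \<in> \<rat>" "l < q" "q < r"
    using Rats_dense_in_real[OF lr] by blast
  obtain d where d: "d > 0" "\<And>k. \<lbrakk>0 < k; k < d\<rbrakk> \<Longrightarrow> q < (g (x + k) - g x) / k"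
    using order_tendstoD(1)[OF r q(3)] unfolding eventually_at_right_field by auto
  obtain e where e: "e < 0" "\<And>k. \<lbrakk>e < k; k < 0\<rbrakk> \<Longrightarrow> (g (x + k) - g x) / k < q"
    using order_tendstoD(2)[OF l q(2)] unfolding eventually_at_left_field by auto
  have "g x - q * x < g y - q * y" if y: "y \<noteq> x" "\<bar>y - x\<bar> < min d (- e)" for y
  proof (cases "x < y")
    case True
    then have "q < (g (x + (y - x)) - g x) / (y - x)"
      using y by (intro d(2)) auto
    then have "q * (y - x) < g y - g x"
      using True by (simp add: pos_less_divide_eq)
    then show ?thesis
      by (simp add: algebra_simps)
  next
    case False
    then have neg: "y - x < 0"
      using y by simp
    then have "(g (x + (y - x)) - g x) / (y - x) < q"
      using y by (intro e(2)) auto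
    then have "q * (y - x) < g y - g x"
      using neg by (simp add: neg_divide_less_eq)
    then show ?thesis
      by (simp add: algebra_simps)
  qed
  then show ?thesis
    using q(1) d(1) e(1) by (intro bexI[of _ q] exI[of _ "min d (- e)"]) auto
qed

lemma AE_lborel_imp_negligible:
  assumes "AE x in lborel. P (x :: 'a::euclidean_space)"
  shows "negligible {x. \<not> P x}"
proof -
  obtain N where N: "{x. \<not> P x} \<subseteq> N" "N \<in> null_sets lborel"
    using assms unfolding eventually_ae_filter by auto
  from N(2) have "negligible N"
    by (simp add: negligible_iff_null_sets null_sets_completionI)
  then show ?thesis
    using N(1) negligible_subset by blast
qed

lemma negligible_affine_image_real:
  fixes N :: "real set"
  assumes "negligible N"
  shows "negligible ((\<lambda>x. c * x + d) ` N)"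
proof (rule negligible_differentiable_image_negligible[OF _ assms])
  show "(\<lambda>x. c * x + d) differentiable_on N"
    unfolding differentiable_on_def
  proof
    fix x assume "x \<in> N"
    have "((\<lambda>x. c * x + d) has_real_derivative c) (at x within N)"
      by (auto intro!: derivative_eq_intros)
    then show "(\<lambda>x. c * x + d) differentiable at x within N"
      using has_field_derivative_imp_has_derivative differentiableI by blast
  qed
qed simp

text \<open>The one-sided derivatives exist almost everywhere, the left one by reflection, and they
  differ only at corners of \<open>g\<close> or \<open>- g\<close>, of which there are countably
  many.\<close>

lemma lipschitz_real_differentiable_AE:
  fixes g :: "real \<Rightarrow> real"
  assumes g: "C-lipschitz_on UNIV g"
  shows "negligible {x. \<not> g differentiable (at x)}"
proof -
  have g': "C-lipschitz_on UNIV (\<lambda>x. g (- x))"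
  proof (rule lipschitz_onI)
    show "dist (g (- x)) (g (- y)) \<le> C * dist x y" for x y
      using lipschitz_onD[OF g, of "- x" "- y"] by (simp add: dist_real_def abs_minus_commute)
  qed (use lipschitz_on_nonneg[OF g] in simp)
  define R where "R x \<longleftrightarrow> (\<exists>l. ((\<lambda>k. (g (x + k) - g x) / k) \<longlongrightarrow> l) (at_right 0))" for x
  define L where "L x \<longleftrightarrow> (\<exists>l. ((\<lambda>k. (g (x + k) - g x) / k) \<longlongrightarrow> l) (at_left 0))" for x
  have R: "negligible {x. \<not> R x}"
    unfolding R_def by (rule AE_lborel_imp_negligible[OF lipschitz_right_derivative_AE[OF g]])
  let ?P = "\<lambda>x. \<exists>l. ((\<lambda>k. (g (- (x + k)) - g (- x)) / k) \<longlongrightarrow> l) (at_right 0)"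
  have P: "negligible {x. \<not> ?P x}"
    by (rule AE_lborel_imp_negligible[OF lipschitz_right_derivative_AE[OF g']])
  have L: "negligible {x. \<not> L x}"
  proof (rule negligible_subset[OF negligible_affine_image_real[OF P, of "-1" 0]])
    show "{x. \<not> L x} \<subseteq> (\<lambda>x. - 1 * x + 0) ` {x. \<not> ?P x}"
    proof
      fix x assume x: "x \<in> {x. \<not> L x}"
      have "\<not> ?P (- x)"
      proof
        assume "?P (- x)"
        then obtain l where "((\<lambda>k. (g (- (- x + k)) - g (- (- x))) / k) \<longlongrightarrow> l) (at_right 0)"
          by blast
        then have "((\<lambda>k. - ((g (- (- x + k)) - g (- (- x))) / k)) \<longlongrightarrow> - l) (at_right 0)"
          by (rule tendsto_minus)
        then have "((\<lambda>k. (g (x + k) - g x) / k) \<longlongrightarrow> - l) (at_left 0)"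
          by (subst filterlim_at_left_to_right) (simp add: minus_divide_left minus_divide_right)
        then show False
          using x by (auto simp: L_def)
      qed
      then show "x \<in> (\<lambda>x. - 1 * x + 0) ` {x. \<not> ?P x}"
        by (intro image_eqI[of _ _ "- x"]) auto
    qed
  qed
  let ?S = "\<lambda>g :: real \<Rightarrow> real. {x. \<exists>q\<in>\<rat>. \<exists>d>0. \<forall>y. y \<noteq> x \<and> \<bar>y - x\<bar> < d \<longrightarrow> g x - q * x < g y - q * y}"
  have S: "negligible (?S u)" for u
    using countable_imp_null_set_lborel[OF countable_strict_corners[of u]]
    by (simp add: negligible_iff_null_sets null_sets_completionI)
  have "g differentiable (at x)" if x: "R x" "L x" "x \<notin> ?S g" "x \<notin> ?S (\<lambda>y. - g y)" for x
  proof -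
    obtain r where r: "((\<lambda>k. (g (x + k) - g x) / k) \<longlongrightarrow> r) (at_right 0)"
      using x(1) unfolding R_def by blast
    obtain l where l: "((\<lambda>k. (g (x + k) - g x) / k) \<longlongrightarrow> l) (at_left 0)"
      using x(2) unfolding L_def by blast
    have "\<not> l < r"
      using corner_of_one_sided_limits[OF r l] x(3) by blast
    moreover have "\<not> - l < - r"
    proof
      assume less: "- l < - r"
      have m: "(\<lambda>k. (- g (x + k) - - g x) / k) = (\<lambda>k. - ((g (x + k) - g x) / k))"
        by (simp add: fun_eq_iff diff_divide_distrib)
      have "((\<lambda>k. (- g (x + k) - - g x) / k) \<longlongrightarrow> - r) (at_right 0)"
           "((\<lambda>k. (- g (x + k) - - g x) / k) \<longlongrightarrow> - l) (at_left 0)"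
        unfolding m by (intro tendsto_minus r l)+
      from corner_of_one_sided_limits[where g="\<lambda>y. - g y", OF this less] x(4) show False
        by blast
    qed
    ultimately have "l = r"
      by simp
    with r l have "((\<lambda>k. (g (x + k) - g x) / k) \<longlongrightarrow> r) (at 0)"
      by (simp add: filterlim_at_split)
    then have "(g has_real_derivative r) (at x)"
      by (simp add: DERIV_def)
    then show ?thesis
      using real_differentiable_def by blast
  qed
  then have sub: "{x. \<not> g differentiable (at x)} \<subseteq> {x. \<not> R x} \<union> {x. \<not> L x} \<union> ?S g \<union> ?S (\<lambda>y. - g y)"
    by blast
  show ?thesis
    by (rule negligible_subset[OF _ sub]) (intro negligible_Un R L S)
qed

text \<open>Composition with this retraction extends curves on the unit interval to the line with the
  same Lipschitz constant.\<close>

definition clamp_unit :: "real \<Rightarrow> real" where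
  "clamp_unit t = max 0 (min 1 t)"

lemma clamp_unit_in: "clamp_unit t \<in> {0..1}"
  by (auto simp: clamp_unit_def)

lemma clamp_unit_eq: "t \<in> {0..1} \<Longrightarrow> clamp_unit t = t"
  by (auto simp: clamp_unit_def)

lemma lipschitz_on_clamp_unit:
  fixes g :: "real \<Rightarrow> 'a::metric_space"
  assumes "C-lipschitz_on {0..1} g"
  shows "C-lipschitz_on UNIV (\<lambda>t. g (clamp_unit t))"
proof (rule lipschitz_onI)
  fix x y :: real
  have "dist (g (clamp_unit x)) (g (clamp_unit y)) \<le> C * dist (clamp_unit x) (clamp_unit y)"
    by (rule lipschitz_onD[OF assms clamp_unit_in clamp_unit_in])
  also have "\<dots> \<le> C * dist x y"
    using lipschitz_on_nonneg[OF assms]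
    by (intro mult_left_mono) (auto simp: clamp_unit_def dist_real_def)
  finally show "dist (g (clamp_unit x)) (g (clamp_unit y)) \<le> C * dist x y" .
qed (rule lipschitz_on_nonneg[OF assms])

lemma lipschitz_path_differentiable_AE:
  fixes \<gamma> :: "real \<Rightarrow> 'a::euclidean_space"
  assumes "C-lipschitz_on {0..1} \<gamma>"
  obtains N where "negligible N"
    "\<And>t. \<lbrakk>0 < t; t < 1; t \<notin> N\<rbrakk> \<Longrightarrow> (\<gamma> has_vector_derivative velocity \<gamma> t) (at t)"
proof -
  let ?\<gamma> = "\<lambda>t. \<gamma> (clamp_unit t)"
  have lip: "C-lipschitz_on UNIV (\<lambda>t. ?\<gamma> t \<bullet> b)" if "b \<in> Basis" for b
  proof (rule lipschitz_onI)
    fix x y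
    have "dist (?\<gamma> x \<bullet> b) (?\<gamma> y \<bullet> b) = \<bar>(?\<gamma> x - ?\<gamma> y) \<bullet> b\<bar>"
      by (simp add: dist_real_def inner_diff_left)
    also have "\<dots> \<le> dist (?\<gamma> x) (?\<gamma> y)"
      using Basis_le_norm[OF that] by (simp add: dist_norm)
    also have "\<dots> \<le> C * dist x y"
      by (rule lipschitz_onD[OF lipschitz_on_clamp_unit[OF assms]]) auto
    finally show "dist (?\<gamma> x \<bullet> b) (?\<gamma> y \<bullet> b) \<le> C * dist x y" .
  qed (rule lipschitz_on_nonneg[OF assms])
  define N where "N = (\<Union>b\<in>Basis. {t. \<not> (\<lambda>t. ?\<gamma> t \<bullet> b) differentiable (at t)})"
  show thesis
  proof (rule that)
    show "negligible N"
      unfolding N_def by (intro negligible_Union) (auto intro: lipschitz_real_differentiable_AE lip)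
  next
    fix t assume t: "0 < t" "t < 1" "t \<notin> N"
    then have "?\<gamma> differentiable (at t)"
      by (subst differentiable_componentwise_within) (auto simp: N_def)
    then obtain D where "(?\<gamma> has_vector_derivative D) (at t)"
      using vector_derivative_works by blast
    then have "(\<gamma> has_vector_derivative D) (at t)"
      by (rule has_vector_derivative_transform_within_open[where S="{0<..<1}"])
        (use t clamp_unit_eq in auto)
    moreover from this have "velocity \<gamma> t = D"
      unfolding velocity_def at_within_Icc_at[OF t(1,2)] by (rule vector_derivative_at)
    ultimately show "(\<gamma> has_vector_derivative velocity \<gamma> t) (at t)"
      by simp
  qed
qed

text \<open>On the exceptional null set the Lipschitz constant serves as a bound for the difference
  quotients, which does not change the integral.\<close>

lemma increment_le_of_derivative_le:
  fixes g :: "real \<Rightarrow> real"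
  assumes g: "C-lipschitz_on {0..1} g" and N: "negligible N" and st: "0 \<le> s" "s \<le> t" "t \<le> 1"
    and der: "\<And>x. \<lbrakk>s < x; x < t; x \<notin> N\<rbrakk> \<Longrightarrow> \<exists>D\<le>\<beta>. (g has_real_derivative D) (at x)"
  shows "g t - g s \<le> \<beta> * (t - s)"
proof -
  let ?g = "\<lambda>t. g (clamp_unit t)"
  have lip: "C-lipschitz_on UNIV ?g"
    by (rule lipschitz_on_clamp_unit[OF g])
  have "N \<in> null_sets lebesgue"
    using N by (simp add: negligible_iff_null_sets)
  then obtain N' where N': "N \<subseteq> N'" "N' \<in> null_sets lborel"
    unfolding null_sets_completion_iff2 by auto
  define h where "h x = (if x \<in> N' \<union> {s} then C else \<beta>)" for x
  have [measurable]: "N' \<in> sets borel"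
    using N'(2) by auto
  have h: "h \<in> borel_measurable borel"
    unfolding h_def by measurable
  have "?g t - ?g s \<le> (LINT x:{s..t}|lborel. h x)"
  proof (rule lipschitz_increment_le_integral[OF lip h _ st(2)])
    show "\<bar>h x\<bar> \<le> max \<bar>C\<bar> \<bar>\<beta>\<bar>" for x
      by (auto simp: h_def)
  next
    fix x e d :: real assume x: "s \<le> x" "x < t" and e: "0 < e" and d: "0 < d"
    show "\<exists>y>x. y < x + d \<and> ?g y - ?g x \<le> (h x + e) * (y - x)"
    proof (cases "x \<in> N' \<union> {s}")
      case True
      have "?g (x + d / 2) - ?g x \<le> C * (d / 2)"
        using order_trans[OF abs_ge_self lipschitz_onD[OF lip, of "x + d / 2" x, unfolded dist_real_def]] d
        by simp
      also have "\<dots> \<le> (h x + e) * (x + d / 2 - x)"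
        using True e d by (simp add: h_def)
      finally show ?thesis
        using d by (intro exI[of _ "x + d / 2"]) auto
    next
      case False
      then obtain D where D: "D \<le> \<beta>" "(g has_real_derivative D) (at x)"
        using der[of x] x N' by (metis Un_iff insertCI order_le_less subsetD)
      have "((\<lambda>k. (g (x + k) - g x) / k) \<longlongrightarrow> D) (at_right 0)"
        using D(2) by (simp add: DERIV_def filterlim_at_split)
      moreover have "D < \<beta> + e"
        using D e by simp
      ultimately have "\<forall>\<^sub>F k in at_right 0. (g (x + k) - g x) / k < \<beta> + e"
        by (rule order_tendstoD)
      then obtain b where b: "b > 0" "\<And>k. \<lbrakk>0 < k; k < b\<rbrakk> \<Longrightarrow> (g (x + k) - g x) / k < \<beta> + e"
        unfolding eventually_at_right_field by auto
      define k where "k = min (min b d) (t - x) / 2"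
      have k_le: "0 < k" "2 * k \<le> b" "2 * k \<le> d" "2 * k \<le> t - x"
        using b(1) d x(2) by (auto simp: k_def)
      have "k < t - x"
        using k_le(1,4) by linarith
      then have k: "0 < k" "k < b" "k < d" "x + k < t"
        using k_le b(1) d by linarith+
      have "g (x + k) - g x \<le> (\<beta> + e) * k"
        using b(2)[of k] k by (simp add: pos_divide_less_eq)
      moreover have "clamp_unit (x + k) = x + k" "clamp_unit x = x"
        using k x st by (auto intro!: clamp_unit_eq)
      ultimately show ?thesis
        using k False by (intro exI[of _ "x + k"]) (auto simp: h_def)
    qed
  qed
  also have "(LINT x:{s..t}|lborel. h x) = (LINT x:{s..t}|lborel. \<beta>)"
  proof (rule set_lebesgue_integral_cong_AE)
    have "{s} \<in> null_sets lborel"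
      by (rule countable_imp_null_set_lborel) simp
    then have "N' \<union> {s} \<in> null_sets lborel"
      using N'(2) by (rule null_sets.Un[rotated])
    then have "AE x in lborel. x \<notin> N' \<union> {s}"
      by (rule AE_not_in)
    then show "AE x\<in>{s..t} in lborel. h x = \<beta>"
      by eventually_elim (auto simp: h_def)
  qed (use h in auto)
  also have "\<dots> = \<beta> * (t - s)"
    using st by (simp add: set_lebesgue_integral_def)
  finally show ?thesis
    using st by (simp add: clamp_unit_eq)
qed

text \<open>If a hyperplane separated the mean velocity from \<open>K\<close>, the increment of the
  corresponding coordinate of \<open>\<gamma>\<close> would violate
  \<open>increment_le_of_derivative_le\<close>.\<close>

lemma mean_velocity_in_convex:
  fixes \<gamma> :: "real \<Rightarrow> 'a::euclidean_space"
  assumes \<gamma>: "C-lipschitz_on {0..1} \<gamma>" and st: "0 \<le> s" "s < t" "t \<le> 1"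
    and K: "closed K" "convex K" and ae: "AE x in lebesgue. s < x \<and> x < t \<longrightarrow> velocity \<gamma> x \<in> K"
  shows "(\<gamma> t - \<gamma> s) /\<^sub>R (t - s) \<in> K"
proof (rule ccontr)
  assume "(\<gamma> t - \<gamma> s) /\<^sub>R (t - s) \<notin> K"
  then obtain a c where a: "a \<bullet> ((\<gamma> t - \<gamma> s) /\<^sub>R (t - s)) < c" "\<And>v. v \<in> K \<Longrightarrow> c < a \<bullet> v"
    using separating_hyperplane_closed_point[OF K(2,1)] by blast
  obtain N where N: "negligible N"
    "\<And>x. \<lbrakk>0 < x; x < 1; x \<notin> N\<rbrakk> \<Longrightarrow> (\<gamma> has_vector_derivative velocity \<gamma> x) (at x)"
    using lipschitz_path_differentiable_AE[OF \<gamma>] by blast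
  obtain N' where N'0: "{x \<in> space lebesgue. \<not> (s < x \<and> x < t \<longrightarrow> velocity \<gamma> x \<in> K)} \<subseteq> N'"
    and N': "N' \<in> null_sets lebesgue"
    using ae unfolding eventually_ae_filter by blast
  have lip: "(norm a * C)-lipschitz_on {0..1} (\<lambda>x. - (a \<bullet> \<gamma> x))"
  proof (rule lipschitz_onI)
    fix x y :: real assume "x \<in> {0..1}" "y \<in> {0..1}"
    then have "dist (\<gamma> x) (\<gamma> y) \<le> C * dist x y"
      by (rule lipschitz_onD[OF \<gamma>])
    moreover have "dist (- (a \<bullet> \<gamma> x)) (- (a \<bullet> \<gamma> y)) = \<bar>a \<bullet> (\<gamma> x - \<gamma> y)\<bar>"
      by (simp add: dist_real_def inner_diff_right abs_minus_commute)
    moreover have "\<bar>a \<bullet> (\<gamma> x - \<gamma> y)\<bar> \<le> norm a * dist (\<gamma> x) (\<gamma> y)"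
      using Cauchy_Schwarz_ineq2 by (simp add: dist_norm)
    ultimately show "dist (- (a \<bullet> \<gamma> x)) (- (a \<bullet> \<gamma> y)) \<le> norm a * C * dist x y"
      using mult_left_mono[of "dist (\<gamma> x) (\<gamma> y)" "C * dist x y" "norm a"] by (simp add: mult.assoc)
  qed (use lipschitz_on_nonneg[OF \<gamma>] in simp)
  have neg: "negligible (N \<union> N')"
    using N(1) N' by (simp add: negligible_iff_null_sets null_sets.Un)
  have "- (a \<bullet> \<gamma> t) - - (a \<bullet> \<gamma> s) \<le> - c * (t - s)"
  proof (rule increment_le_of_derivative_le[OF lip neg])
    fix x assume x: "s < x" "x < t" "x \<notin> N \<union> N'"
    then have "(\<gamma> has_vector_derivative velocity \<gamma> x) (at x)"
      using st by (intro N(2)) auto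
    then have "((\<lambda>x. - (a \<bullet> \<gamma> x)) has_real_derivative - (a \<bullet> velocity \<gamma> x)) (at x)"
      unfolding has_real_derivative_iff_has_vector_derivative
      by (intro has_vector_derivative_minus bounded_linear.has_vector_derivative[OF bounded_linear_inner_right])
    moreover have "c < a \<bullet> velocity \<gamma> x"
      using x N'0 by (intro a(2)) auto
    ultimately show "\<exists>D\<le>- c. ((\<lambda>x. - (a \<bullet> \<gamma> x)) has_real_derivative D) (at x)"
      by (intro exI[of _ "- (a \<bullet> velocity \<gamma> x)"]) auto
  qed (use st in auto)
  moreover have "a \<bullet> (\<gamma> t - \<gamma> s) < c * (t - s)"
    using a(1) st by (simp add: inverse_eq_divide pos_divide_less_eq)
  ultimately show False
    by (simp add: inner_diff_right)
qed

section \<open>The anisotropic cost and its gauge\<close>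

definition adjacent_sum :: "('b \<Rightarrow> 'b \<Rightarrow> real) \<Rightarrow> 'b list \<Rightarrow> real" where
  "adjacent_sum c vs = (\<Sum>i<length vs - 1. c (vs ! i) (vs ! Suc i))"

locale anisotropic_cost =
  fixes D :: "'a::euclidean_space set" and f :: "'a \<Rightarrow> 'a \<Rightarrow> real" and p m1 m2 :: real
  assumes compact_D: "compact D" and convex_D: "convex D"
    and p_ge_1: "1 \<le> p" and m1_pos: "0 < m1" and m2_pos: "0 < m2"
    and cont_f: "continuous_on (D \<times> UNIV) (\<lambda>(x, v). f x v)"
    and convex_f: "\<And>x. x \<in> D \<Longrightarrow> convex_on UNIV (f x)"
    and scale_f: "\<And>x v c. \<lbrakk>x \<in> D; 0 < c\<rbrakk> \<Longrightarrow> f x (c *\<^sub>R v) = c powr p * f x v"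
    and lower_f: "\<And>x v. x \<in> D \<Longrightarrow> m1 * norm v powr p \<le> f x v"
    and upper_f: "\<And>x v. x \<in> D \<Longrightarrow> f x v \<le> m2 * norm v powr p"
begin

lemma f_nonneg: "x \<in> D \<Longrightarrow> 0 \<le> f x v"
  using order_trans[OF _ lower_f] m1_pos by simp

lemma f_zero [simp]: "x \<in> D \<Longrightarrow> f x 0 = 0"
  using lower_f[of x 0] upper_f[of x 0] p_ge_1 by simp

lemma f_scale: "\<lbrakk>x \<in> D; 0 \<le> c\<rbrakk> \<Longrightarrow> f x (c *\<^sub>R v) = c powr p * f x v"
  using scale_f[of x c v] p_ge_1 by (cases "c = 0") auto

lemma continuous_on_f:
  assumes "continuous_on S u" "continuous_on S w" "u ` S \<subseteq> D"
  shows "continuous_on S (\<lambda>t. f (u t) (w t))"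
  using continuous_on_compose2[OF cont_f continuous_on_Pair[OF assms(1,2)]] assms(3) by auto

text \<open>By homogeneity it suffices to compare on the unit sphere, where \<open>f\<close> is
  uniformly continuous and at least \<open>m1\<close>.\<close>

lemma f_uniform_ratio:
  assumes e: "0 < e"
  obtains r where "0 < r" "\<And>x y v. \<lbrakk>x \<in> D; y \<in> D; dist x y < r\<rbrakk> \<Longrightarrow> f x v \<le> (1 + e) * f y v"
proof -
  let ?S = "D \<times> sphere 0 1 :: ('a \<times> 'a) set"
  have "continuous_on ?S (\<lambda>(x, v). f x v)"
    by (rule continuous_on_subset[OF cont_f]) auto
  moreover have "compact ?S"
    using compact_D by (simp add: compact_Times)
  ultimately have "uniformly_continuous_on ?S (\<lambda>(x, v). f x v)"
    by (rule compact_uniformly_continuous)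
  moreover have "0 < e * m1"
    using e m1_pos by simp
  ultimately obtain r where "r > 0 \<and> (\<forall>z\<in>?S. \<forall>z'\<in>?S. dist z' z < r \<longrightarrow>
       dist (case z' of (x, v) \<Rightarrow> f x v) (case z of (x, v) \<Rightarrow> f x v) < e * m1)"
    unfolding uniformly_continuous_on_def by meson
  then have r: "0 < r" and r': "\<And>x y u. \<lbrakk>x \<in> D; y \<in> D; norm u = 1; dist x y < r\<rbrakk> \<Longrightarrow> dist (f x u) (f y u) < e * m1"
    by (auto simp: dist_Pair_Pair)
  show thesis
  proof (rule that[OF r])
    fix x y v assume x: "x \<in> D" and y: "y \<in> D" and d: "dist x y < r"
    show "f x v \<le> (1 + e) * f y v"
    proof (cases "v = 0")
      case False
      define u where "u = v /\<^sub>R norm v"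
      have u: "norm u = 1" and v: "v = norm v *\<^sub>R u"
        using False by (auto simp: u_def)
      have "dist (f x u) (f y u) < e * m1"
        using r' x y u d by blast
      then have "f x u \<le> f y u + e * m1"
        by (simp add: dist_real_def)
      also have "e * m1 \<le> e * f y u"
        using lower_f[OF y, of u] u e by simp
      finally have "f x u \<le> (1 + e) * f y u"
        by (simp add: algebra_simps)
      then have "norm v powr p * f x u \<le> norm v powr p * ((1 + e) * f y u)"
        by (intro mult_left_mono) auto
      moreover have "f z v = norm v powr p * f z u" if "z \<in> D" for z
        by (subst v) (simp only: f_scale[OF that norm_ge_zero])
      ultimately show ?thesis
        using x y by (simp add: algebra_simps)
    qed (use x y in simp)
  qed
qed

text \<open>At each \<open>x\<close> this is the Minkowski gauge of the convex set \<open>{v. f x v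
  \<le> 1}\<close>. For every \<open>p\<close> it is homogeneous of degree 1, so that bounds on it
  add up along a chain.\<close>

definition gauge_at :: "'a \<Rightarrow> 'a \<Rightarrow> real" where
  "gauge_at x v = f x v powr (1 / p)"

lemma gauge_nonneg [simp]: "0 \<le> gauge_at x v"
  by (simp add: gauge_at_def)

lemma powr_root: "0 \<le> c \<Longrightarrow> (c powr (1 / p)) powr p = c" "0 \<le> c \<Longrightarrow> (c powr p) powr (1 / p) = c"
  using p_ge_1 by (auto simp: powr_powr)

lemma gauge_powr: "x \<in> D \<Longrightarrow> gauge_at x v powr p = f x v"
  by (simp add: gauge_at_def powr_root f_nonneg)

lemma gauge_scale: "\<lbrakk>x \<in> D; 0 \<le> c\<rbrakk> \<Longrightarrow> gauge_at x (c *\<^sub>R v) = c * gauge_at x v"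
  by (simp add: gauge_at_def f_scale powr_mult f_nonneg powr_root)

text \<open>The gauge lies between \<open>lo\<close> and \<open>hi\<close> times the norm, by the
  growth bounds on \<open>f\<close>.\<close>

definition lo :: real where "lo = m1 powr (1 / p)"

definition hi :: real where "hi = m2 powr (1 / p)"

lemma lo_pos: "0 < lo" and hi_pos: "0 < hi"
  using m1_pos m2_pos by (simp_all add: lo_def hi_def)

lemma gauge_le: "x \<in> D \<Longrightarrow> gauge_at x v \<le> hi * norm v"
proof -
  assume x: "x \<in> D"
  have "gauge_at x v \<le> (m2 * norm v powr p) powr (1 / p)"
    unfolding gauge_at_def using upper_f[OF x] f_nonneg[OF x] p_ge_1 by (intro powr_mono2) auto
  then show ?thesis
    using m2_pos by (simp add: powr_mult powr_root hi_def)
qed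

lemma gauge_zero_iff: "x \<in> D \<Longrightarrow> gauge_at x v = 0 \<longleftrightarrow> v = 0"
  using lower_f[of x v] m1_pos by (auto simp: gauge_at_def mult_le_0_iff)

text \<open>After division by \<open>gauge_at x u + gauge_at x v\<close>, the sum is a convex
  combination of two vectors of gauge 1.\<close>

lemma gauge_triangle:
  assumes x: "x \<in> D"
  shows "gauge_at x (u + v) \<le> gauge_at x u + gauge_at x v"
proof (cases "u = 0 \<or> v = 0")
  case True
  then show ?thesis
    by auto
next
  case False
  let ?a = "gauge_at x u" and ?b = "gauge_at x v"
  have pos: "0 < ?a" "0 < ?b"
    using False gauge_zero_iff[OF x] gauge_nonneg by (metis less_eq_real_def)+
  have unit: "f x (w /\<^sub>R gauge_at x w) = 1" if "0 < gauge_at x w" for w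
  proof -
    have "f x (w /\<^sub>R gauge_at x w) = inverse (gauge_at x w) powr p * gauge_at x w powr p"
      using that x gauge_powr[OF x, of w] by (simp add: scale_f)
    also have "\<dots> = (inverse (gauge_at x w) * gauge_at x w) powr p"
      using that by (subst powr_mult) auto
    finally show ?thesis
      using that by simp
  qed
  have "f x ((?a / (?a + ?b)) *\<^sub>R (u /\<^sub>R ?a) + (?b / (?a + ?b)) *\<^sub>R (v /\<^sub>R ?b))
      \<le> (?a / (?a + ?b)) * f x (u /\<^sub>R ?a) + (?b / (?a + ?b)) * f x (v /\<^sub>R ?b)"
    using pos by (intro convex_f[OF x, unfolded convex_on_def, THEN conjunct2, rule_format])
      (auto simp: add_divide_distrib[symmetric])
  also have "\<dots> = 1"
    using pos unit by (simp add: add_divide_distrib[symmetric])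
  also have "(?a / (?a + ?b)) *\<^sub>R (u /\<^sub>R ?a) + (?b / (?a + ?b)) *\<^sub>R (v /\<^sub>R ?b) = (u + v) /\<^sub>R (?a + ?b)"
  proof -
    have "?a / (?a + ?b) * inverse ?a = inverse (?a + ?b)" "?b / (?a + ?b) * inverse ?b = inverse (?a + ?b)"
      using pos by (simp_all add: field_simps)
    then show ?thesis
      by (simp only: scaleR_scaleR scaleR_add_right)
  qed
  finally have "f x ((u + v) /\<^sub>R (?a + ?b)) \<le> 1" .
  then have "gauge_at x ((u + v) /\<^sub>R (?a + ?b)) \<le> 1 powr (1 / p)"
    unfolding gauge_at_def using f_nonneg[OF x] p_ge_1 by (intro powr_mono2) auto
  moreover have "gauge_at x ((u + v) /\<^sub>R (?a + ?b)) = inverse (?a + ?b) * gauge_at x (u + v)"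
    using pos by (intro gauge_scale[OF x]) simp
  ultimately have "inverse (?a + ?b) * gauge_at x (u + v) \<le> 1"
    by simp
  then show ?thesis
    using pos by (simp add: field_simps)
qed

lemma gauge_sum:
  assumes x: "x \<in> D"
  shows "gauge_at x (\<Sum>i\<in>I. w i) \<le> (\<Sum>i\<in>I. gauge_at x (w i))"
proof (induction I rule: infinite_finite_induct)
  case (insert i I)
  then show ?case
    using gauge_triangle[OF x, of "w i" "sum w I"] by simp
qed (use x gauge_zero_iff[OF x, of 0] in auto)

lemma path_cost_nonneg:
  assumes "path_image \<gamma> \<subseteq> D"
  shows "0 \<le> path_cost f \<gamma>"
  unfolding path_cost_def set_lebesgue_integral_def
  by (rule Bochner_Integration.integral_nonneg)
    (use assms f_nonneg in \<open>auto simp: path_image_def indicator_def image_subset_iff\<close>)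

lemma cost_dist_le:
  assumes "\<gamma> \<in> lipschitz_paths D u v"
  shows "cost_dist f D u v \<le> path_cost f \<gamma>"
  unfolding cost_dist_def
  by (rule cINF_lower[OF _ assms])
    (auto intro!: bdd_belowI2[where m=0] path_cost_nonneg simp: lipschitz_paths_def)

lemma velocity_linepath:
  assumes "t \<in> {0..1}"
  shows "velocity (linepath u v) t = v - u"
  unfolding velocity_def using assms
  by (intro vector_derivative_within_cbox[where a=0 and b=1, unfolded cbox_interval])
    (auto intro: has_vector_derivative_linepath_within)

lemma linepath_lipschitz_path:
  assumes "u \<in> D" "v \<in> D"
  shows "linepath u v \<in> lipschitz_paths D u v"
proof -
  have "(norm (v - u))-lipschitz_on {0..1} (linepath u v)"
  proof (rule lipschitz_onI)
    fix x y :: real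
    have "linepath u v x - linepath u v y = (x - y) *\<^sub>R (v - u)"
      by (simp add: linepath_def algebra_simps)
    then show "dist (linepath u v x) (linepath u v y) \<le> norm (v - u) * dist x y"
      by (simp add: dist_norm)
  qed simp
  moreover have "path_image (linepath u v) \<subseteq> D"
    using assms convex_D by (simp add: closed_segment_subset)
  ultimately show ?thesis
    by (auto simp: lipschitz_paths_def)
qed

text \<open>For a nonnegative integrand, Henstock-Kurzweil integrability already gives the Lebesgue
  integral in the definition of the cost.\<close>

lemma path_cost_eq_of_has_integral:
  assumes "path_image \<gamma> \<subseteq> D"
    and "((\<lambda>t. f (\<gamma> t) (velocity \<gamma> t)) has_integral c) {0..1}"
  shows "path_cost f \<gamma> = c"
proof -
  have ai: "(\<lambda>t. f (\<gamma> t) (velocity \<gamma> t)) absolutely_integrable_on {0..1}"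
    using assms by (intro nonnegative_absolutely_integrable_1)
      (auto simp: path_image_def image_subset_iff intro!: f_nonneg)
  show "path_cost f \<gamma> = c"
    unfolding path_cost_def set_lebesgue_integral_eq_integral(2)[OF ai]
    using assms(2) by (rule integral_unique)
qed

lemma linepath_cost_has_integral:
  assumes "u \<in> D" "v \<in> D"
  shows "((\<lambda>t. f (linepath u v t) (velocity (linepath u v) t)) has_integral path_cost f (linepath u v)) {0..1}"
proof -
  have img: "path_image (linepath u v) \<subseteq> D"
    using assms convex_D by (simp add: closed_segment_subset)
  then have "continuous_on {0..1} (\<lambda>t. f (linepath u v t) (v - u))"
    by (intro continuous_on_f continuous_on_linepath continuous_on_const) (simp add: path_image_def)
  then have "(\<lambda>t. f (linepath u v t) (v - u)) integrable_on {0..1}"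
    by (rule integrable_continuous_real)
  then obtain c where "((\<lambda>t. f (linepath u v t) (v - u)) has_integral c) {0..1}"
    by (auto simp: integrable_on_def)
  then have "((\<lambda>t. f (linepath u v t) (velocity (linepath u v) t)) has_integral c) {0..1}"
    by (rule has_integral_eq[rotated]) (simp add: velocity_linepath)
  with path_cost_eq_of_has_integral[OF img this] show ?thesis
    by simp
qed

lemma linepath_cost_le:
  assumes "u \<in> D" "v \<in> D" and B: "\<And>x. x \<in> closed_segment u v \<Longrightarrow> f x (v - u) \<le> B"
  shows "path_cost f (linepath u v) \<le> B"
proof -
  have "((\<lambda>t. B) has_integral B) {0..1::real}"
    using has_integral_const_real[of B 0 1] by simp
  with linepath_cost_has_integral[OF assms(1,2)] show ?thesis
  proof (rule has_integral_le)
    fix t :: real assume t: "t \<in> {0..1}"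
    then have "linepath u v t \<in> closed_segment u v"
      by (simp add: linepath_in_path)
    then show "f (linepath u v t) (velocity (linepath u v) t) \<le> B"
      using B t by (simp add: velocity_linepath)
  qed
qed

text \<open>The unit interval has length 1, so an integrand that is constant almost everywhere equals
  its integral.\<close>

lemma quasinormal_constant:
  assumes \<gamma>: "\<gamma> \<in> lipschitz_paths D u v" and q: "quasinormal f \<gamma>"
  shows "AE t in lebesgue. t \<in> {0..1} \<longrightarrow> f (\<gamma> t) (velocity \<gamma> t) = path_cost f \<gamma>"
    and "((\<lambda>t. f (\<gamma> t) (velocity \<gamma> t)) has_integral path_cost f \<gamma>) {0..1}"
proof -
  have img: "path_image \<gamma> \<subseteq> D"
    using \<gamma> by (simp add: lipschitz_paths_def)
  obtain c where c: "AE t in lebesgue. t \<in> {0..1} \<longrightarrow> f (\<gamma> t) (velocity \<gamma> t) = c"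
    using q unfolding quasinormal_def by blast
  then obtain N where N: "N \<in> null_sets lebesgue"
    "{t \<in> space lebesgue. \<not> (t \<in> {0..1} \<longrightarrow> f (\<gamma> t) (velocity \<gamma> t) = c)} \<subseteq> N"
    unfolding eventually_ae_filter by (elim bexE)
  have const: "((\<lambda>t. c) has_integral c) {0..1::real}"
    using has_integral_const_real[of c 0 1] by simp
  have i: "((\<lambda>t. f (\<gamma> t) (velocity \<gamma> t)) has_integral c) {0..1}"
  proof (rule has_integral_spike[OF _ _ const])
    show "negligible N"
      using N(1) by (simp add: negligible_iff_null_sets)
  next
    fix t assume t: "t \<in> {0..1} - N"
    then have "t \<notin> {t \<in> space lebesgue. \<not> (t \<in> {0..1} \<longrightarrow> f (\<gamma> t) (velocity \<gamma> t) = c)}"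
      using N(2) by blast
    then show "f (\<gamma> t) (velocity \<gamma> t) = c"
      using t by simp
  qed
  with path_cost_eq_of_has_integral[OF img this] c
  show "AE t in lebesgue. t \<in> {0..1} \<longrightarrow> f (\<gamma> t) (velocity \<gamma> t) = path_cost f \<gamma>"
    and "((\<lambda>t. f (\<gamma> t) (velocity \<gamma> t)) has_integral path_cost f \<gamma>) {0..1}"
    by simp_all
qed

text \<open>Each piece is traversed \<open>m\<close> times faster, which multiplies the integrand by
  \<open>m powr p\<close> on an interval of length \<open>1 / m\<close>.\<close>

lemma path_cost_concat_path:
  fixes vs :: "'a list" and h
  defines "m \<equiv> length vs - 1"
  assumes m: "0 < m"
    and h: "\<And>i. i < m \<Longrightarrow> h (vs ! i) (vs ! Suc i) \<in> lipschitz_paths D (vs ! i) (vs ! Suc i)"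
    and int: "\<And>i. i < m \<Longrightarrow> ((\<lambda>t. f (h (vs ! i) (vs ! Suc i) t) (velocity (h (vs ! i) (vs ! Suc i)) t))
        has_integral path_cost f (h (vs ! i) (vs ! Suc i))) {0..1}"
  shows "path_cost f (concat_path h vs)
    = real m powr (p - 1) * adjacent_sum (\<lambda>u v. path_cost f (h u v)) vs"
proof -
  define \<sigma> where "\<sigma> = concat_path h vs"
  define G where "G t = f (\<sigma> t) (velocity \<sigma> t)" for t
  define H where "H i = h (vs ! i) (vs ! Suc i)" for i
  have ends: "h (vs ! i) (vs ! Suc i) 0 = vs ! i \<and> h (vs ! i) (vs ! Suc i) 1 = vs ! Suc i"
    if "Suc i < length vs" for i
    using h[of i] that by (auto simp: lipschitz_paths_def pathstart_def pathfinish_def m_def)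
  have \<sigma>: "\<sigma> t = H i (real m * t - real i)"
    if "i < m" "real i / real m \<le> t" "t \<le> real (Suc i) / real m" for i t
    unfolding \<sigma>_def H_def by (rule concat_path_eq[OF ends _ that]) (auto simp: m_def)
  have H_in: "H i \<tau> \<in> D" if "i < m" "0 \<le> \<tau>" "\<tau> \<le> 1" for i \<tau>
    using h[OF that(1)] that(2,3) by (auto simp: lipschitz_paths_def path_image_def H_def)
  have piece: "(G has_integral real m powr (p - 1) * path_cost f (H i))
      {real i / real m..real (Suc i) / real m}" if i: "i < m" for i
  proof -
    obtain C where "C-lipschitz_on {0..1} (H i)"
      using h[OF i] by (auto simp: lipschitz_paths_def H_def)
    then obtain N where N: "negligible N"
      "\<And>t. \<lbrakk>0 < t; t < 1; t \<notin> N\<rbrakk> \<Longrightarrow> (H i has_vector_derivative velocity (H i) t) (at t)"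
      using lipschitz_path_differentiable_AE[of C "H i"] by blast
    let ?g = "\<lambda>t. f (H i t) (velocity (H i) t)"
    have "((\<lambda>t. ?g (real m *\<^sub>R t + - real i)) has_integral (path_cost f (H i) /\<^sub>R real m ^ DIM(real)))
        (cbox ((0 - - real i) /\<^sub>R real m) ((1 - - real i) /\<^sub>R real m))"
      by (rule has_integral_affinity') (use int[OF i] m in \<open>auto simp: H_def\<close>)
    then have "((\<lambda>t. ?g (real m * t - real i)) has_integral (path_cost f (H i) / real m))
        {real i / real m..real (Suc i) / real m}"
      by (simp add: field_simps)
    then have "((\<lambda>t. real m powr p * ?g (real m * t - real i)) has_integral
        real m powr p * (path_cost f (H i) / real m)) {real i / real m..real (Suc i) / real m}"
      by (rule has_integral_mult_right)
    moreover have "real m powr p * (path_cost f (H i) / real m) = real m powr (p - 1) * path_cost f (H i)"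
      using m by (simp add: powr_diff)
    ultimately have int_i: "((\<lambda>t. real m powr p * ?g (real m * t - real i)) has_integral
        real m powr (p - 1) * path_cost f (H i)) {real i / real m..real (Suc i) / real m}"
      by simp
    let ?N = "(\<lambda>\<tau>. (1 / real m) * \<tau> + real i / real m) ` (N \<union> {0, 1})"
    show ?thesis
    proof (rule has_integral_spike[OF _ _ int_i])
      show "negligible ?N"
        using N(1) by (intro negligible_affine_image_real negligible_Un) auto
    next
      fix t assume t: "t \<in> {real i / real m..real (Suc i) / real m} - ?N"
      define \<tau> where "\<tau> = real m * t - real i"
      have t_eq: "t = (1 / real m) * \<tau> + real i / real m"
        using m by (simp add: \<tau>_def field_simps)
      then have "\<tau> \<notin> N \<union> {0, 1}"
        using t by blast
      moreover have "0 \<le> \<tau>" "\<tau> \<le> 1"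
        using t m by (auto simp: \<tau>_def field_simps)
      ultimately have \<tau>: "0 < \<tau>" "\<tau> < 1" "\<tau> \<notin> N"
        by auto
      have tin: "real i / real m < t" "t < real (Suc i) / real m"
        using \<tau> m by (auto simp: \<tau>_def field_simps)
      have "((\<lambda>t. H i (real m * t - real i)) has_vector_derivative real m *\<^sub>R velocity (H i) \<tau>) (at t)"
      proof -
        have "((\<lambda>t. real m * t - real i) has_vector_derivative real m) (at t)"
          by (auto intro!: derivative_eq_intros)
        from vector_diff_chain_at[OF this, of "H i"] N(2)[OF \<tau>] show ?thesis
          by (simp add: \<tau>_def o_def)
      qed
      then have "(\<sigma> has_vector_derivative real m *\<^sub>R velocity (H i) \<tau>) (at t)"
        by (rule has_vector_derivative_transform_within_open
            [where S="{real i / real m<..<real (Suc i) / real m}"])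
          (use tin \<sigma>[OF i] in auto)
      moreover have "0 < t" "t < 1"
      proof -
        have "0 \<le> real i / real m" "real (Suc i) / real m \<le> 1"
          using i m by auto
        then show "0 < t" "t < 1"
          using tin by linarith+
      qed
      ultimately have "velocity \<sigma> t = real m *\<^sub>R velocity (H i) \<tau>"
        unfolding velocity_def by (simp add: at_within_Icc_at vector_derivative_at)
      moreover have "\<sigma> t = H i \<tau>"
        using \<sigma>[OF i] tin by (simp add: \<tau>_def)
      ultimately show "G t = real m powr p * ?g (real m * t - real i)"
        using H_in[OF i] \<tau> by (simp add: G_def \<tau>_def f_scale)
    qed
  qed
  have "(G has_integral (\<Sum>i<k. real m powr (p - 1) * path_cost f (H i))) {0..real k / real m}"
    if "k \<le> m" for k
    using that
  proof (induction k)
    case (Suc k)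
    then have "(G has_integral ((\<Sum>i<k. real m powr (p - 1) * path_cost f (H i))
        + real m powr (p - 1) * path_cost f (H k))) {0..real (Suc k) / real m}"
      using m by (intro has_integral_combine[OF _ _ _ piece[of k]]) (auto simp: divide_right_mono)
    then show ?case
      by simp
  next
    case 0
    show ?case
      using has_integral_refl(1)[of G "0::real"] by simp
  qed
  from this[of m] have "(G has_integral (\<Sum>i<m. real m powr (p - 1) * path_cost f (H i))) {0..1}"
    using m by simp
  moreover have "path_image \<sigma> \<subseteq> D"
  proof -
    have "\<sigma> t \<in> D" if t: "0 \<le> t" "t \<le> 1" for t
    proof -
      define i where "i = min (nat \<lfloor>real m * t\<rfloor>) (m - 1)"
      have mt: "0 \<le> real m * t" "real m * t \<le> real m"
        using t m by (auto simp: mult_le_cancel_left1)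
      have i: "i < m" "real i \<le> real m * t" "real m * t \<le> real (Suc i)"
        using mt m unfolding i_def by linarith+
      then have "\<sigma> t = H i (real m * t - real i)"
        using m by (intro \<sigma>) (auto simp: field_simps)
      then show ?thesis
        using H_in[OF i(1)] i by simp
    qed
    then show ?thesis
      by (auto simp: path_image_def)
  qed
  ultimately have "path_cost f \<sigma> = (\<Sum>i<m. real m powr (p - 1) * path_cost f (H i))"
    unfolding G_def by (intro path_cost_eq_of_has_integral)
  then show ?thesis
    unfolding adjacent_sum_def m_def[symmetric] by (simp add: \<sigma>_def H_def sum_distrib_left)
qed

end

section \<open>Geodesics and the local size of their cost\<close>

text \<open>The power mean inequality, from the convexity of \<open>x powr p\<close>.\<close>

lemma sum_powr_le:
  fixes l :: "nat \<Rightarrow> real"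
  assumes m: "0 < m" and p: "1 \<le> p" and l: "\<And>i. i < m \<Longrightarrow> 0 < l i"
  shows "(\<Sum>i<m. l i) powr p \<le> real m powr (p - 1) * (\<Sum>i<m. l i powr p)"
proof -
  have "(\<lambda>x. x powr p) (\<Sum>i<m. (1 / real m) *\<^sub>R l i) \<le> (\<Sum>i<m. (1 / real m) * (l i powr p))"
    by (rule convex_on_sum[OF _ _ powr_convex[OF p]]) (use m l in auto)
  then have "((1 / real m) * (\<Sum>i<m. l i)) powr p \<le> (1 / real m) * (\<Sum>i<m. l i powr p)"
    by (simp add: sum_distrib_left)
  then have "real m powr p * ((1 / real m) * (\<Sum>i<m. l i)) powr p
      \<le> real m powr p * ((1 / real m) * (\<Sum>i<m. l i powr p))"
    by (rule mult_left_mono) simp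
  moreover have "real m powr p * ((1 / real m) * (\<Sum>i<m. l i)) powr p = (real m * ((1 / real m) * (\<Sum>i<m. l i))) powr p"
    by (rule powr_mult[symmetric])
  moreover have "real m * ((1 / real m) * (\<Sum>i<m. l i)) = (\<Sum>i<m. l i)"
    using m by simp
  ultimately have "(\<Sum>i<m. l i) powr p \<le> real m powr p * ((1 / real m) * (\<Sum>i<m. l i powr p))"
    by simp
  also have "\<dots> = real m powr (p - 1) * (\<Sum>i<m. l i powr p)"
    using m by (simp add: powr_diff)
  finally show ?thesis .
qed

context anisotropic_cost
begin

text \<open>Jensen's inequality in the form that is needed: a sublevel set of \<open>f x\<close> is
  closed and convex, and by the comparison of \<open>f x\<close> with \<open>f (\<gamma>
  \<tau>)\<close> it contains almost all velocities.\<close>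

lemma mean_velocity_cost_le:
  assumes \<gamma>: "C-lipschitz_on {0..1} \<gamma>"
    and ae: "AE t in lebesgue. t \<in> {0..1} \<longrightarrow> f (\<gamma> t) (velocity \<gamma> t) \<le> c"
    and st: "0 \<le> s" "s < t" "t \<le> 1" and x: "x \<in> D" and e: "0 \<le> e"
    and comp: "\<And>\<tau> v. \<lbrakk>s < \<tau>; \<tau> < t\<rbrakk> \<Longrightarrow> f x v \<le> (1 + e) * f (\<gamma> \<tau>) v"
  shows "f x ((\<gamma> t - \<gamma> s) /\<^sub>R (t - s)) \<le> (1 + e) * c"
proof -
  let ?K = "{v. f x v \<le> (1 + e) * c}"
  have "continuous_on UNIV (f x)"
    by (rule continuous_on_f) (use x in \<open>auto intro: continuous_intros\<close>)
  then have "closed ?K"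
    by (intro closed_Collect_le continuous_intros)
  moreover have "convex ?K"
  proof (rule convexI)
    fix v w and a b :: real
    assume vw: "v \<in> ?K" "w \<in> ?K" and ab: "0 \<le> a" "0 \<le> b" "a + b = 1"
    have "f x (a *\<^sub>R v + b *\<^sub>R w) \<le> a * f x v + b * f x w"
      using ab by (intro convex_f[OF x, unfolded convex_on_def, THEN conjunct2, rule_format]) auto
    also have "\<dots> \<le> a * ((1 + e) * c) + b * ((1 + e) * c)"
      using vw ab by (intro add_mono mult_left_mono) auto
    also have "\<dots> = (1 + e) * c"
      using ab(3) by (simp add: distrib_right[symmetric])
    finally show "a *\<^sub>R v + b *\<^sub>R w \<in> ?K"
      by simp
  qed
  moreover have "AE \<tau> in lebesgue. s < \<tau> \<and> \<tau> < t \<longrightarrow> velocity \<gamma> \<tau> \<in> ?K"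
    using ae
  proof eventually_elim
    fix \<tau> assume *: "\<tau> \<in> {0..1} \<longrightarrow> f (\<gamma> \<tau>) (velocity \<gamma> \<tau>) \<le> c"
    show "s < \<tau> \<and> \<tau> < t \<longrightarrow> velocity \<gamma> \<tau> \<in> ?K"
    proof
      assume \<tau>: "s < \<tau> \<and> \<tau> < t"
      then have "f x (velocity \<gamma> \<tau>) \<le> (1 + e) * f (\<gamma> \<tau>) (velocity \<gamma> \<tau>)"
        using comp by blast
      also have "\<dots> \<le> (1 + e) * c"
        using * \<tau> st e by (intro mult_left_mono) auto
      finally show "velocity \<gamma> \<tau> \<in> ?K"
        by simp
    qed
  qed
  ultimately have "(\<gamma> t - \<gamma> s) /\<^sub>R (t - s) \<in> ?K"
    by (rule mean_velocity_in_convex[OF \<gamma> st])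
  then show ?thesis
    by simp
qed

text \<open>If the integrand is not integrable, its integral is 0 by convention, and the bound is
  trivial.\<close>

lemma path_cost_le_of_velocity:
  assumes ae: "AE t in lebesgue. t \<in> {0..1} \<longrightarrow> f (\<gamma> t) (velocity \<gamma> t) \<le> c" and c: "0 \<le> c"
  shows "path_cost f \<gamma> \<le> c"
proof (cases "set_integrable lebesgue {0..1} (\<lambda>t. f (\<gamma> t) (velocity \<gamma> t))")
  case True
  have "set_integrable lebesgue {0..1::real} (\<lambda>t. c)"
    by (auto simp: set_integrable_def)
  moreover have "AE t in lebesgue. indicat_real {0..1} t *\<^sub>R f (\<gamma> t) (velocity \<gamma> t) \<le> indicat_real {0..1} t *\<^sub>R c"
    using ae by eventually_elim (auto simp: indicator_def)
  ultimately have "path_cost f \<gamma> \<le> (LINT t:{0..1::real}|lebesgue. c)"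
    using True unfolding path_cost_def set_lebesgue_integral_def set_integrable_def
    by (intro integral_mono_AE)
  then show ?thesis
    by (simp add: set_lebesgue_integral_def)
next
  case False
  then show ?thesis
    using c by (simp add: path_cost_def set_integrable_def set_lebesgue_integral_def not_integrable_integral_eq)
qed

end

locale geodesic_cost = anisotropic_cost D f p m1 m2
  for D :: "'a::euclidean_space set" and f p m1 m2 +
  fixes geo :: "'a \<Rightarrow> 'a \<Rightarrow> real \<Rightarrow> 'a"
  assumes geo: "\<And>u v. \<lbrakk>u \<in> D; v \<in> D\<rbrakk> \<Longrightarrow> geo u v \<in> lipschitz_paths D u v \<and> quasinormal f (geo u v) \<and>
        path_cost f (geo u v) = cost_dist f D u v"
begin

lemma geo_lipschitz:
  assumes "u \<in> D" "v \<in> D"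
  obtains C where "C-lipschitz_on {0..1} (geo u v)"
  using geo[OF assms] by (auto simp: lipschitz_paths_def)

lemma geo_in: "\<lbrakk>u \<in> D; v \<in> D; 0 \<le> t; t \<le> 1\<rbrakk> \<Longrightarrow> geo u v t \<in> D"
  using geo[of u v] by (auto simp: lipschitz_paths_def path_image_def)

lemma geo_ends: "\<lbrakk>u \<in> D; v \<in> D\<rbrakk> \<Longrightarrow> geo u v 0 = u \<and> geo u v 1 = v"
  using geo[of u v] by (auto simp: lipschitz_paths_def pathstart_def pathfinish_def)

lemma geo_cost_constant:
  assumes "u \<in> D" "v \<in> D"
  shows "AE t in lebesgue. t \<in> {0..1} \<longrightarrow> f (geo u v t) (velocity (geo u v) t) = cost_dist f D u v"
  using quasinormal_constant(1)[of "geo u v" u v] geo[OF assms] by simp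

lemma cost_dist_nonneg:
  assumes "u \<in> D" "v \<in> D"
  shows "0 \<le> cost_dist f D u v"
  using path_cost_nonneg[of "geo u v"] geo[OF assms] by (simp add: lipschitz_paths_def)

lemma cost_dist_le_linepath:
  assumes "u \<in> D" "v \<in> D"
  shows "cost_dist f D u v \<le> path_cost f (linepath u v)"
  by (rule cost_dist_le[OF linepath_lipschitz_path[OF assms]])

lemma linepath_cost_le_norm:
  assumes "u \<in> D" "v \<in> D"
  shows "path_cost f (linepath u v) \<le> m2 * norm (v - u) powr p"
proof (rule linepath_cost_le[OF assms])
  fix x assume "x \<in> closed_segment u v"
  then have "x \<in> D"
    using closed_segment_subset[OF assms convex_D] by blast
  then show "f x (v - u) \<le> m2 * norm (v - u) powr p"
    by (rule upper_f)
qed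

text \<open>The \<open>p\<close>-th root of the cost scales like a length, whatever the value of
  \<open>p\<close>.\<close>

definition step :: "'a \<Rightarrow> 'a \<Rightarrow> real" where
  "step u v = cost_dist f D u v powr (1 / p)"

lemma step_nonneg [simp]: "0 \<le> step u v"
  by (simp add: step_def)

lemma step_powr: "\<lbrakk>u \<in> D; v \<in> D\<rbrakk> \<Longrightarrow> step u v powr p = cost_dist f D u v"
  by (simp add: step_def powr_root cost_dist_nonneg)

lemma step_le_norm:
  assumes "u \<in> D" "v \<in> D"
  shows "step u v \<le> hi * norm (v - u)"
proof -
  have "step u v \<le> (m2 * norm (v - u) powr p) powr (1 / p)"
    unfolding step_def using p_ge_1 cost_dist_nonneg[OF assms]
      order_trans[OF cost_dist_le_linepath[OF assms] linepath_cost_le_norm[OF assms]]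
    by (intro powr_mono2) auto
  also have "\<dots> = hi * norm (v - u)"
    using m2_pos by (simp add: powr_mult powr_root hi_def)
  finally show ?thesis .
qed

lemma norm_le_of_cost:
  assumes "x \<in> D" "0 \<le> c" "f x v \<le> c"
  shows "lo * norm v \<le> c powr (1 / p)"
proof -
  have "lo * norm v = (m1 * norm v powr p) powr (1 / p)"
    using m1_pos by (simp add: powr_mult powr_root lo_def)
  also have "\<dots> \<le> c powr (1 / p)"
    using assms lower_f[of x v] m1_pos p_ge_1 by (intro powr_mono2) auto
  finally show ?thesis .
qed

text \<open>A geodesic is quasinormal, so its total cost bounds its speed at almost every time and not
  just on average.\<close>

lemma geo_distance_le:
  assumes uv: "u \<in> D" "v \<in> D" and t: "0 \<le> t" "t \<le> 1"
  shows "lo * norm (geo u v t - u) \<le> step u v"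
proof (cases "t = 0")
  case True
  then show ?thesis
    using geo_ends[OF uv] by simp
next
  case False
  then have t0: "0 < t"
    using t by simp
  obtain C where C: "C-lipschitz_on {0..1} (geo u v)"
    by (rule geo_lipschitz[OF uv])
  let ?K = "cball 0 (step u v / lo) :: 'a set"
  have "AE \<tau> in lebesgue. 0 < \<tau> \<and> \<tau> < t \<longrightarrow> velocity (geo u v) \<tau> \<in> ?K"
    using geo_cost_constant[OF uv]
  proof eventually_elim
    fix \<tau> assume *: "\<tau> \<in> {0..1} \<longrightarrow> f (geo u v \<tau>) (velocity (geo u v) \<tau>) = cost_dist f D u v"
    show "0 < \<tau> \<and> \<tau> < t \<longrightarrow> velocity (geo u v) \<tau> \<in> ?K"
    proof
      assume \<tau>: "0 < \<tau> \<and> \<tau> < t"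
      have "lo * norm (velocity (geo u v) \<tau>) \<le> step u v"
        unfolding step_def
        by (rule norm_le_of_cost[of "geo u v \<tau>"]) (use \<tau> t * uv in \<open>auto intro: geo_in cost_dist_nonneg\<close>)
      then show "velocity (geo u v) \<tau> \<in> ?K"
        using lo_pos by (simp add: field_simps)
    qed
  qed
  then have "(geo u v t - geo u v 0) /\<^sub>R (t - 0) \<in> ?K"
    by (intro mean_velocity_in_convex[OF C]) (use t t0 in auto)
  then have "norm (geo u v t - u) / t \<le> step u v / lo"
    using t0 geo_ends[OF uv] by (simp add: divide_inverse mult.commute)
  then have "lo * norm (geo u v t - u) \<le> t * step u v"
    using t0 lo_pos by (simp add: field_simps)
  also have "\<dots> \<le> step u v"
    using t by (simp add: mult_left_le_one_le)
  finally show ?thesis .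
qed

lemma norm_le_step:
  assumes "u \<in> D" "v \<in> D"
  shows "lo * norm (v - u) \<le> step u v"
  using geo_distance_le[OF assms, of 1] geo_ends[OF assms] by simp

text \<open>A geodesic between points near \<open>x\<close> stays near \<open>x\<close>, where
  \<open>f\<close> is comparable with \<open>f x\<close>; its mean velocity is \<open>v -
  u\<close>.\<close>

lemma gauge_le_step:
  assumes e: "0 < e"
  obtains r where "0 < r"
    "\<And>x u v. \<lbrakk>x \<in> D; u \<in> D; v \<in> D; dist u x < r; dist v x < r\<rbrakk> \<Longrightarrow> gauge_at x (v - u) \<le> (1 + e) * step u v"
proof -
  obtain R where R: "0 < R" and ratio: "\<And>x y v. \<lbrakk>x \<in> D; y \<in> D; dist x y < R\<rbrakk> \<Longrightarrow> f x v \<le> (1 + e) * f y v"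
    using f_uniform_ratio[OF e] by blast
  define L where "L = 1 + 2 * (hi / lo)"
  have L: "0 < L"
    using lo_pos hi_pos by (simp add: L_def add_pos_pos)
  show thesis
  proof (rule that)
    show "0 < R / L"
      using R L by simp
  next
    fix x u v assume x: "x \<in> D" and uv: "u \<in> D" "v \<in> D" and d: "dist u x < R / L" "dist v x < R / L"
    obtain C where C: "C-lipschitz_on {0..1} (geo u v)"
      by (rule geo_lipschitz[OF uv])
    have near: "dist x (geo u v \<tau>) < R" if "0 < \<tau>" "\<tau> < 1" for \<tau>
    proof -
      have "norm (v - u) \<le> dist v x + dist u x"
        using dist_triangle2[of v u x] by (simp add: dist_norm)
      then have "hi * norm (v - u) \<le> hi * (2 * (R / L))"
        using d hi_pos by (intro mult_left_mono) auto
      moreover have "lo * norm (geo u v \<tau> - u) \<le> hi * norm (v - u)"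
        using geo_distance_le[OF uv, of \<tau>] step_le_norm[OF uv] that by simp
      ultimately have "lo * norm (geo u v \<tau> - u) \<le> hi * (2 * (R / L))"
        by linarith
      then have "norm (geo u v \<tau> - u) * lo \<le> hi * (2 * (R / L))"
        by (subst mult.commute)
      then have "norm (geo u v \<tau> - u) \<le> hi * (2 * (R / L)) / lo"
        by (rule pos_le_divide_eq[OF lo_pos, THEN iffD2])
      also have "\<dots> = 2 * (hi / lo) * (R / L)"
        by (simp add: mult.commute)
      finally have "norm (geo u v \<tau> - u) \<le> 2 * (hi / lo) * (R / L)" .
      moreover have "dist x (geo u v \<tau>) \<le> dist u x + norm (geo u v \<tau> - u)"
        using dist_triangle[of x "geo u v \<tau>" u] by (simp add: dist_norm norm_minus_commute)
      ultimately have "dist x (geo u v \<tau>) < R / L + 2 * (hi / lo) * (R / L)"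
        using d by linarith
      also have "\<dots> = L * (R / L)"
        by (simp only: L_def distrib_right mult_1)
      also have "\<dots> = R"
        using L by simp
      finally show ?thesis .
    qed
    have "f x ((geo u v 1 - geo u v 0) /\<^sub>R (1 - 0)) \<le> (1 + e) * cost_dist f D u v"
    proof (rule mean_velocity_cost_le[OF C])
      show "AE t in lebesgue. t \<in> {0..1} \<longrightarrow> f (geo u v t) (velocity (geo u v) t) \<le> cost_dist f D u v"
        using geo_cost_constant[OF uv] by eventually_elim auto
    next
      fix \<tau> w :: _ assume "0 < (\<tau>::real)" "\<tau> < 1"
      then show "f x w \<le> (1 + e) * f (geo u v \<tau>) w"
        using near by (intro ratio x geo_in uv) auto
    qed (use x e in auto)
    then have "f x (v - u) \<le> (1 + e) * cost_dist f D u v"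
      using geo_ends[OF uv] by simp
    then have "gauge_at x (v - u) \<le> ((1 + e) * cost_dist f D u v) powr (1 / p)"
      unfolding gauge_at_def using f_nonneg[OF x] p_ge_1 by (intro powr_mono2) auto
    also have "\<dots> = (1 + e) powr (1 / p) * step u v"
      using e cost_dist_nonneg[OF uv] by (simp add: step_def powr_mult)
    also have "\<dots> \<le> (1 + e) powr 1 * step u v"
      using e p_ge_1 by (intro mult_right_mono powr_mono) auto
    finally show "gauge_at x (v - u) \<le> (1 + e) * step u v"
      using e by simp
  qed
qed

end

section \<open>Compactness of chains with almost optimal energy\<close>

text \<open>McShane's extension in each coordinate: the lower envelope of the cones with slope
  \<open>L\<close> over the given values.\<close>

lemma lipschitz_interpolation:
  fixes v :: "nat \<Rightarrow> 'a::euclidean_space" and s :: "nat \<Rightarrow> real"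
  assumes L: "0 \<le> L" and v: "\<And>i j. \<lbrakk>i \<le> m; j \<le> m\<rbrakk> \<Longrightarrow> norm (v i - v j) \<le> L * \<bar>s i - s j\<bar>"
  obtains g where "(real DIM('a) * L)-lipschitz_on UNIV g" "\<And>i. i \<le> m \<Longrightarrow> g (s i) = v i"
proof -
  define G where "G b t = Min ((\<lambda>i. v i \<bullet> b + L * \<bar>t - s i\<bar>) ` {..m})" for b t
  have G_le: "G b t \<le> v i \<bullet> b + L * \<bar>t - s i\<bar>" if "i \<le> m" for b t i
    unfolding G_def using that by (intro Min_le) auto
  have G_attained: "\<exists>i\<le>m. G b t = v i \<bullet> b + L * \<bar>t - s i\<bar>" for b t
  proof -
    have "G b t \<in> (\<lambda>i. v i \<bullet> b + L * \<bar>t - s i\<bar>) ` {..m}"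
      unfolding G_def by (intro Min_in) auto
    then show ?thesis
      by auto
  qed
  have G_node: "G b (s j) = v j \<bullet> b" if b: "b \<in> Basis" and j: "j \<le> m" for b j
  proof (rule antisym)
    show "G b (s j) \<le> v j \<bullet> b"
      using G_le[OF j, of b "s j"] by simp
    obtain i where i: "i \<le> m" "G b (s j) = v i \<bullet> b + L * \<bar>s j - s i\<bar>"
      using G_attained by blast
    have "(v j - v i) \<bullet> b \<le> norm (v j - v i)"
      using Basis_le_norm[OF b, of "v j - v i"] by simp
    then show "v j \<bullet> b \<le> G b (s j)"
      using v[OF j i(1)] i(2) by (simp add: inner_diff_left)
  qed
  have G_half: "G b t - G b t' \<le> L * \<bar>t - t'\<bar>" for b t t'
  proof -
    obtain i where i: "i \<le> m" "G b t' = v i \<bullet> b + L * \<bar>t' - s i\<bar>"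
      using G_attained by blast
    have "L * \<bar>t - s i\<bar> \<le> L * (\<bar>t - t'\<bar> + \<bar>t' - s i\<bar>)"
      using L by (intro mult_left_mono) auto
    then show ?thesis
      using G_le[OF i(1), of b t] i(2) by (simp add: distrib_left)
  qed
  then have G_lip: "\<bar>G b t - G b t'\<bar> \<le> L * \<bar>t - t'\<bar>" for b t t'
    using G_half[of b t t'] G_half[of b t' t] by (simp add: abs_le_iff abs_minus_commute)
  define g where "g t = (\<Sum>b\<in>Basis. G b t *\<^sub>R b)" for t
  show thesis
  proof (rule that)
    show "(real DIM('a) * L)-lipschitz_on UNIV g"
    proof (rule lipschitz_onI)
      fix t t'
      have "dist (g t) (g t') = norm (\<Sum>b\<in>Basis. (G b t - G b t') *\<^sub>R b)"
        by (simp add: g_def dist_norm sum_subtractf[symmetric] scaleR_diff_left)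
      also have "\<dots> \<le> (\<Sum>b\<in>Basis. norm ((G b t - G b t') *\<^sub>R (b :: 'a)))"
        by (rule norm_sum)
      also have "\<dots> \<le> (\<Sum>b\<in>(Basis :: 'a set). L * \<bar>t - t'\<bar>)"
        using G_lip by (intro sum_mono) simp
      finally show "dist (g t) (g t') \<le> real DIM('a) * L * dist t t'"
        by (simp add: dist_real_def mult.assoc)
    qed (use L in simp)
  next
    fix i assume "i \<le> m"
    then have "g (s i) = (\<Sum>b\<in>Basis. (v i \<bullet> b) *\<^sub>R b)"
      unfolding g_def by (intro sum.cong) (simp_all add: G_node)
    then show "g (s i) = v i"
      by (simp add: euclidean_representation)
  qed
qed

lemma hausdorff_dist_bound:
  assumes A: "A \<noteq> {}" and B: "B \<noteq> {}"
    and AB: "\<And>x. x \<in> A \<Longrightarrow> \<exists>y\<in>B. norm (x - y) \<le> c"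
    and BA: "\<And>y. y \<in> B \<Longrightarrow> \<exists>x\<in>A. norm (x - y) \<le> c"
  shows "\<bar>hausdorff_dist A B\<bar> \<le> c"
proof -
  have bdd: "bdd_below ((\<lambda>y. norm (h y)) ` C)" for C :: "'c set" and h :: "'c \<Rightarrow> 'a"
    by (rule bdd_belowI2[where m=0]) simp
  have 1: "(INF y\<in>B. norm (x - y)) \<le> c" if "x \<in> A" for x
    using AB[OF that] cINF_lower2[OF bdd, of _ B "\<lambda>y. x - y" c] by auto
  have 2: "(INF x\<in>A. norm (x - y)) \<le> c" if "y \<in> B" for y
    using BA[OF that] cINF_lower2[OF bdd, of _ A "\<lambda>x. x - y" c] by auto
  obtain x where x: "x \<in> A"
    using A by blast
  have "0 \<le> (INF y\<in>B. norm (x - y))"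
    by (rule cINF_greatest[OF B]) simp
  also have "\<dots> \<le> (SUP x\<in>A. INF y\<in>B. norm (x - y))"
  proof (rule cSUP_upper[OF x])
    show "bdd_above ((\<lambda>x. INF y\<in>B. norm (x - y)) ` A)"
      by (rule bdd_aboveI2[where M=c]) (rule 1)
  qed
  finally have "0 \<le> hausdorff_dist A B"
    by (simp add: hausdorff_dist_def)
  moreover have "(SUP x\<in>A. INF y\<in>B. norm (x - y)) \<le> c" "(SUP y\<in>B. INF x\<in>A. norm (x - y)) \<le> c"
    by (rule cSUP_least[OF A 1], assumption) (rule cSUP_least[OF B 2], assumption)
  then have "hausdorff_dist A B \<le> c"
    by (simp add: hausdorff_dist_def)
  ultimately show ?thesis
    by simp
qed

context anisotropic_cost
begin

lemma gauge_lipschitz: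
  assumes x: "x \<in> D"
  shows "(hi)-lipschitz_on UNIV (gauge_at x)"
proof (rule lipschitz_onI)
  have half: "gauge_at x u - gauge_at x v \<le> hi * norm (u - v)" for u v
    using gauge_triangle[OF x, of v "u - v"] gauge_le[OF x, of "u - v"] by simp
  show "dist (gauge_at x u) (gauge_at x v) \<le> hi * dist u v" for u v
    using half[of u v] half[of v u] by (simp add: dist_norm abs_le_iff norm_minus_commute)
qed (use hi_pos in simp)

end

context geodesic_cost
begin

text \<open>This is the cost of the concatenated geodesics, each of which takes the time \<open>1 /
  m\<close> for \<open>m\<close> edges.\<close>

definition energy :: "'a list \<Rightarrow> real" where
  "energy vs = real (length vs - 1) powr (p - 1) * adjacent_sum (cost_dist f D) vs"

definition total_step :: "'a list \<Rightarrow> real" where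
  "total_step vs = adjacent_sum step vs"

lemma step_pos: "\<lbrakk>u \<in> D; v \<in> D; 0 < norm (u - v)\<rbrakk> \<Longrightarrow> 0 < step u v"
  using norm_le_step[of u v] lo_pos
  by (metis less_le_trans mult_pos_pos norm_minus_commute)

text \<open>By the power mean inequality. So the total step of a chain with almost optimal energy is
  almost optimal.\<close>

lemma total_step_powr_le_energy:
  assumes vs: "vs \<in> discrete_paths V e a b" and V: "V \<subseteq> D"
  shows "total_step vs powr p \<le> energy vs"
proof -
  let ?m = "length vs - 1"
  have m: "0 < ?m"
    using vs by (auto simp: discrete_paths_def)
  have inD: "vs ! i \<in> D" if "i < length vs" for i
    using vs V nth_mem[OF that] by (auto simp: discrete_paths_def simp del: nth_mem)
  have pos: "0 < step (vs ! i) (vs ! Suc i)" if "i < ?m" for i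
    using vs that by (intro step_pos inD) (auto simp: discrete_paths_def)
  have "total_step vs powr p \<le> real ?m powr (p - 1) * (\<Sum>i<?m. step (vs ! i) (vs ! Suc i) powr p)"
    unfolding total_step_def adjacent_sum_def by (rule sum_powr_le[OF m p_ge_1 pos])
  also have "\<dots> = energy vs"
    unfolding energy_def adjacent_sum_def using inD by (intro arg_cong2[where f="(*)"] sum.cong) (auto intro!: step_powr)
  finally show ?thesis .
qed

text \<open>The interpolated curve strays at most this multiple of the edge length from the vertices.\<close>

definition width :: real where "width = real DIM('a) * (hi / lo)"

text \<open>The curve \<open>\<sigma>\<close> interpolates the chain \<open>vs\<close> with edges
  shorter than \<open>e\<close>, in proportion to the accumulated steps. The last condition
  compares displacement with time: as long as the curve stays in a region where the gauge at
  \<open>x\<close> is at most \<open>c\<close> times the step, \<open>\<sigma>\<close> moves,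
  measured by this gauge, at speed at most \<open>c\<close> times the total step, up to errors of
  the size of an edge.\<close>

definition tracks :: "'a list \<Rightarrow> real \<Rightarrow> (real \<Rightarrow> 'a) \<Rightarrow> bool" where
  "tracks vs e \<sigma> \<longleftrightarrow>
     (real DIM('a) * (total_step vs / lo))-lipschitz_on UNIV \<sigma> \<and> \<sigma> 0 = hd vs \<and> \<sigma> 1 = last vs \<and>
     (\<forall>t\<in>{0..1}. \<exists>v\<in>set vs. norm (\<sigma> t - v) \<le> width * e) \<and> (\<forall>v\<in>set vs. \<exists>t\<in>{0..1}. \<sigma> t = v) \<and>
     (\<forall>s t x c \<delta>. 0 \<le> s \<and> s \<le> t \<and> t \<le> 1 \<and> x \<in> D \<and> 0 \<le> c \<and>
        (\<forall>u\<in>D. \<forall>v\<in>D. dist u x < \<delta> \<and> dist v x < \<delta> \<longrightarrow> gauge_at x (v - u) \<le> c * step u v) \<and>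
        (\<forall>\<tau>\<in>{s..t}. dist (\<sigma> \<tau>) x < \<delta> - width * e) \<longrightarrow>
        gauge_at x (\<sigma> t - \<sigma> s) \<le> c * (total_step vs * (t - s) + hi * e) + 2 * (hi * (width * e)))"

text \<open>The vertex \<open>v i\<close> is placed at the time \<open>s i\<close> proportional to the
  steps made before it. The chain is then Lipschitz in time because steps dominate distances, and
  \<open>lipschitz_interpolation\<close> extends it to all times. Any time is within one edge of a
  vertex time, and between vertex times the triangle inequality for the gauge adds up the edges.\<close>

lemma tracks_exists:
  assumes vs: "vs \<in> discrete_paths V e a b" and V: "V \<subseteq> D"
  shows "\<exists>\<sigma>. tracks vs e \<sigma>"
proof -
  define m where "m = length vs - 1"
  define v where "v i = vs ! i" for i
  define S where "S = total_step vs"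
  have len: "length vs = Suc m" and m: "0 < m"
    using vs by (auto simp: discrete_paths_def m_def)
  have vD: "v i \<in> D" if "i \<le> m" for i
    using vs V that len nth_mem[of i vs] by (auto simp: discrete_paths_def v_def simp del: nth_mem)
  have edge: "0 < norm (v i - v (Suc i))" "norm (v i - v (Suc i)) < e" if "i < m" for i
    using vs that by (auto simp: discrete_paths_def v_def m_def)
  have v_ends: "v 0 = hd vs" "v m = last vs"
  proof -
    have "vs \<noteq> []"
      using len by auto
    from hd_conv_nth[OF this] last_conv_nth[OF this] show "v 0 = hd vs" "v m = last vs"
      using len by (simp_all add: v_def)
  qed
  have e: "0 < e"
    using edge[OF m] by linarith
  define l where "l i = step (v i) (v (Suc i))" for i
  define T where "T k = (\<Sum>i<k. l i)" for k
  have TS: "T m = S"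
    by (simp add: T_def S_def total_step_def adjacent_sum_def l_def v_def m_def)
  have l_pos: "0 < l i" if "i < m" for i
    unfolding l_def using that edge(1) by (intro step_pos vD) auto
  have l_le: "l i \<le> hi * e" if "i < m" for i
  proof -
    have "l i \<le> hi * norm (v (Suc i) - v i)"
      unfolding l_def using that by (intro step_le_norm vD) auto
    also have "\<dots> \<le> hi * e"
      using edge(2)[OF that] lo_pos hi_pos by (intro mult_left_mono) (auto simp: norm_minus_commute)
    finally show ?thesis .
  qed
  have T_diff: "T j - T i = (\<Sum>k\<in>{i..<j}. l k)" if "i \<le> j" for i j
    using sum_diff_nat_ivl[of 0 i j l] that by (simp add: T_def lessThan_atLeast0)
  have T_less: "T i < T j" if "i < j" "j \<le> m" for i j
  proof -
    have "0 < (\<Sum>k\<in>{i..<j}. l k)"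
      by (rule sum_pos) (use that l_pos in auto)
    then show ?thesis
      using T_diff[of i j] that by simp
  qed
  then have T_mono: "T i \<le> T j" if "i \<le> j" "j \<le> m" for i j
    using that by (metis le_neq_implies_less less_imp_le order_refl)
  have S_pos: "0 < S"
    using T_less[OF m order_refl] by (simp add: TS[symmetric] T_def)
  define s where "s i = T i / S" for i
  have Ss: "S * s i = T i" for i
    using S_pos by (simp add: s_def)
  have s_ends: "s 0 = 0" "s m = 1"
    using S_pos by (simp_all add: s_def TS T_def[of 0])
  have s_less: "s i < s j" if "i < j" "j \<le> m" for i j
    using T_less[OF that] S_pos by (simp add: s_def divide_strict_right_mono)
  have s_mono: "s i \<le> s j" if "i \<le> j" "j \<le> m" for i j
    using T_mono[OF that] S_pos by (simp add: s_def divide_right_mono)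
  have s_range: "0 \<le> s i" "s i \<le> 1" if "i \<le> m" for i
    using s_mono[of 0 i] s_mono[of i m] that s_ends by auto
  have v_diff: "v j - v i = (\<Sum>k\<in>{i..<j}. v (Suc k) - v k)" if "i \<le> j" for i j
    using sum_Suc_diff'[OF that, of v] by simp
  have v_dist_le: "lo * norm (v j - v i) \<le> S * (s j - s i)" if "i \<le> j" "j \<le> m" for i j
  proof -
    have "lo * norm (v j - v i) \<le> (\<Sum>k\<in>{i..<j}. lo * norm (v (Suc k) - v k))"
      unfolding v_diff[OF that(1)] sum_distrib_left[symmetric] using lo_pos hi_pos
      by (intro mult_left_mono norm_sum) auto
    also have "\<dots> \<le> (\<Sum>k\<in>{i..<j}. l k)"
      unfolding l_def using that by (intro sum_mono norm_le_step vD) auto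
    also have "\<dots> = S * (s j - s i)"
      using T_diff[OF that(1)] by (simp add: right_diff_distrib Ss)
    finally show ?thesis .
  qed
  have lip_nodes: "norm (v i - v j) \<le> S / lo * \<bar>s i - s j\<bar>" if "i \<le> m" "j \<le> m" for i j
  proof -
    have *: "norm (v j - v i) \<le> S / lo * \<bar>s j - s i\<bar>" if "i \<le> j" "j \<le> m" for i j
      using v_dist_le[OF that] s_mono[OF that] lo_pos hi_pos by (simp add: field_simps)
    show ?thesis
      using *[of i j] *[of j i] that by (metis abs_minus_commute le_cases norm_minus_commute)
  qed
  obtain \<sigma> where \<sigma>: "(real DIM('a) * (S / lo))-lipschitz_on UNIV \<sigma>" "\<And>i. i \<le> m \<Longrightarrow> \<sigma> (s i) = v i"
    by (rule lipschitz_interpolation[OF _ lip_nodes]) (use S_pos lo_pos hi_pos in auto)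
  \<comment> \<open>The index \<open>i\<close> below is the last one with \<open>s i \<le> t\<close>; the next vertex is at most one edge away.\<close>
  have idx: "\<exists>i\<le>m. s i \<le> t \<and> (\<forall>k\<le>m. i < k \<longrightarrow> t < s k) \<and> S * (t - s i) \<le> hi * e \<and> norm (\<sigma> t - v i) \<le> width * e"
    if t: "0 \<le> t" "t \<le> 1" for t
  proof -
    let ?I = "{i. i \<le> m \<and> s i \<le> t}"
    define i where "i = Max ?I"
    have I: "finite ?I" "0 \<in> ?I"
      using s_ends t by auto
    then have "i \<in> ?I"
      unfolding i_def by (intro Max_in) auto
    then have i: "i \<le> m" "s i \<le> t"
      by auto
    have after: "t < s k" if "k \<le> m" "i < k" for k
      using Max_ge[OF I(1), of k] that by (fold i_def) fastforce
    have gap: "S * (t - s i) \<le> hi * e"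
    proof (cases "i < m")
      case True
      then have "S * (t - s i) \<le> S * (s (Suc i) - s i)"
        using after[of "Suc i"] S_pos by (intro mult_left_mono) auto
      also have "\<dots> = l i"
        by (simp add: right_diff_distrib Ss T_def)
      finally show ?thesis
        using l_le[OF True] by linarith
    next
      case False
      then have "s i = 1"
        using i s_ends by simp
      then show ?thesis
        using t i lo_pos hi_pos e by simp
    qed
    have "norm (\<sigma> t - v i) \<le> real DIM('a) * (S / lo) * (t - s i)"
      using lipschitz_onD[OF \<sigma>(1), of t "s i"] \<sigma>(2)[OF i(1)] i by (simp add: dist_norm)
    also have "\<dots> = real DIM('a) / lo * (S * (t - s i))"
      by simp
    also have "\<dots> \<le> real DIM('a) / lo * (hi * e)"
      using gap lo_pos hi_pos by (intro mult_left_mono) auto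
    also have "\<dots> = width * e"
      by (simp add: width_def)
    finally show ?thesis
      using i after gap by blast
  qed
  show ?thesis
    unfolding tracks_def
  proof (intro exI[of _ \<sigma>] conjI)
    show "(real DIM('a) * (total_step vs / lo))-lipschitz_on UNIV \<sigma>"
      using \<sigma>(1) by (simp add: S_def)
    show "\<sigma> 0 = hd vs" "\<sigma> 1 = last vs"
      using \<sigma>(2)[of 0] \<sigma>(2)[of m] s_ends v_ends by auto
    show "\<forall>t\<in>{0..1}. \<exists>v\<in>set vs. norm (\<sigma> t - v) \<le> width * e"
    proof
      fix t :: real assume t: "t \<in> {0..1}"
      then obtain i where "i \<le> m" "norm (\<sigma> t - v i) \<le> width * e"
        using idx[of t] by auto
      then show "\<exists>v\<in>set vs. norm (\<sigma> t - v) \<le> width * e"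
        using len by (intro bexI[of _ "v i"]) (auto simp: v_def)
    qed
    show "\<forall>w\<in>set vs. \<exists>t\<in>{0..1}. \<sigma> t = w"
    proof
      fix w assume "w \<in> set vs"
      then obtain i where "i \<le> m" "w = v i"
        using len by (auto simp: in_set_conv_nth v_def less_Suc_eq_le)
      then show "\<exists>t\<in>{0..1}. \<sigma> t = w"
        using \<sigma>(2) s_range by (intro bexI[of _ "s i"]) auto
    qed
  next
    show "\<forall>s t x c \<delta>. 0 \<le> s \<and> s \<le> t \<and> t \<le> 1 \<and> x \<in> D \<and> 0 \<le> c \<and>
        (\<forall>u\<in>D. \<forall>v\<in>D. dist u x < \<delta> \<and> dist v x < \<delta> \<longrightarrow> gauge_at x (v - u) \<le> c * step u v) \<and>
        (\<forall>\<tau>\<in>{s..t}. dist (\<sigma> \<tau>) x < \<delta> - width * e) \<longrightarrow>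
        gauge_at x (\<sigma> t - \<sigma> s) \<le> c * (total_step vs * (t - s) + hi * e) + 2 * (hi * (width * e))"
    proof (intro allI impI, elim conjE)
      fix t0 t x c \<delta>
      assume t: "0 \<le> t0" "t0 \<le> t" "t \<le> 1" and x: "x \<in> D" and c: "0 \<le> c"
        and near_le: "\<forall>u\<in>D. \<forall>v\<in>D. dist u x < \<delta> \<and> dist v x < \<delta> \<longrightarrow> gauge_at x (v - u) \<le> c * step u v"
        and close: "\<forall>\<tau>\<in>{t0..t}. dist (\<sigma> \<tau>) x < \<delta> - width * e"
      have Ce: "0 \<le> width * e"
        using e lo_pos hi_pos by (simp add: width_def)
      obtain i where i: "i \<le> m" "s i \<le> t0" "\<And>k. \<lbrakk>k \<le> m; i < k\<rbrakk> \<Longrightarrow> t0 < s k"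
        "S * (t0 - s i) \<le> hi * e" "norm (\<sigma> t0 - v i) \<le> width * e"
        using idx[of t0] t by (meson order_trans)
      obtain j where j: "j \<le> m" "s j \<le> t" "\<And>k. \<lbrakk>k \<le> m; j < k\<rbrakk> \<Longrightarrow> t < s k"
        "norm (\<sigma> t - v j) \<le> width * e"
        using idx[of t] t by (meson order_trans)
      have ij: "i \<le> j"
        using j(3)[OF i(1)] i(2) t by force
      have near: "dist (v k) x < \<delta>" if "i \<le> k" "k \<le> j" for k
      proof (cases "k = i")
        case True
        have "dist (v i) x \<le> dist (\<sigma> t0) (v i) + dist (\<sigma> t0) x"
          by (rule dist_triangle3)
        then show ?thesis
          using True i(5) close[rule_format, of t0] t by (simp add: dist_norm)
      next
        case False
        then have "t0 \<le> s k" "s k \<le> t" "k \<le> m"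
          using that i(3)[of k] j s_mono[of k j] by auto
        then show ?thesis
          using close[rule_format, of "s k"] \<sigma>(2)[of k] Ce by simp
      qed
      have "gauge_at x (v j - v i) \<le> (\<Sum>k\<in>{i..<j}. gauge_at x (v (Suc k) - v k))"
        unfolding v_diff[OF ij] by (rule gauge_sum[OF x])
      also have "\<dots> \<le> (\<Sum>k\<in>{i..<j}. c * l k)"
        unfolding l_def using near j(1) by (intro sum_mono near_le[rule_format] vD) (auto intro: vD)
      also have "\<dots> = c * (S * (s j - s i))"
        using T_diff[OF ij] by (simp add: sum_distrib_left[symmetric] right_diff_distrib Ss)
      also have "\<dots> \<le> c * (S * (t - t0) + hi * e)"
      proof -
        have "S * s j \<le> S * t"
          using j(2) S_pos by simp
        then have "S * (s j - s i) \<le> S * (t - t0) + hi * e"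
          using i(4) by (simp add: right_diff_distrib)
        then show ?thesis
          using c by (rule mult_left_mono)
      qed
      finally have mid: "gauge_at x (v j - v i) \<le> c * (S * (t - t0) + hi * e)" .
      have outer: "gauge_at x w \<le> hi * (width * e)" if "norm w \<le> width * e" for w
      proof -
        have "gauge_at x w \<le> hi * norm w"
          by (rule gauge_le[OF x])
        also have "\<dots> \<le> hi * (width * e)"
          using that lo_pos hi_pos by (intro mult_left_mono) auto
        finally show ?thesis .
      qed
      have "gauge_at x (\<sigma> t - \<sigma> t0) = gauge_at x ((\<sigma> t - v j) + ((v j - v i) + (v i - \<sigma> t0)))"
        by simp
      also have "\<dots> \<le> gauge_at x (\<sigma> t - v j) + (gauge_at x (v j - v i) + gauge_at x (v i - \<sigma> t0))"
        using gauge_triangle[OF x, of "\<sigma> t - v j" "(v j - v i) + (v i - \<sigma> t0)"]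
          gauge_triangle[OF x, of "v j - v i" "v i - \<sigma> t0"] by linarith
      also have "\<dots> \<le> hi * (width * e) + (c * (S * (t - t0) + hi * e) + hi * (width * e))"
        using outer[of "v i - \<sigma> t0"] i(5)
        by (intro add_mono outer[OF j(4)] mid) (simp add: norm_minus_commute)
      finally show "gauge_at x (\<sigma> t - \<sigma> t0)
          \<le> c * (total_step vs * (t - t0) + hi * e) + 2 * (hi * (width * e))"
        unfolding S_def by linarith
    qed
  qed
qed

end

lemma has_vector_derivative_quotient_limit:
  fixes g :: "real \<Rightarrow> 'a::real_normed_vector"
  assumes "(g has_vector_derivative w) (at t)"
  shows "((\<lambda>h. (g (t + h) - g t) /\<^sub>R h) \<longlongrightarrow> w) (at 0)"
proof -
  have "((\<lambda>h. norm (g (t + h) - g t - h *\<^sub>R w) / norm h) \<longlongrightarrow> 0) (at 0)"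
    using assms unfolding has_vector_derivative_def has_derivative_at by blast
  then have "((\<lambda>h. norm ((g (t + h) - g t) /\<^sub>R h - w)) \<longlongrightarrow> 0) (at 0)"
  proof (rule Lim_transform_eventually)
    have "norm (g (t + h) - g t - h *\<^sub>R w) / norm h = norm ((g (t + h) - g t) /\<^sub>R h - w)" if "h \<noteq> 0" for h
    proof -
      have "(g (t + h) - g t) /\<^sub>R h - w = (g (t + h) - g t - h *\<^sub>R w) /\<^sub>R h"
        using that by (simp add: scaleR_diff_right)
      then show ?thesis
        by (simp add: divide_inverse mult.commute)
    qed
    then show "\<forall>\<^sub>F h in at 0. norm (g (t + h) - g t - h *\<^sub>R w) / norm h = norm ((g (t + h) - g t) /\<^sub>R h - w)"
      by (auto simp: eventually_at_filter)
  qed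
  then have "((\<lambda>h. (g (t + h) - g t) /\<^sub>R h - w) \<longlongrightarrow> 0) (at 0)"
    by (rule tendsto_norm_zero_cancel)
  then show ?thesis
    by (rule Lim_null[THEN iffD2])
qed

context geodesic_cost
begin

text \<open>The Lipschitz constants of the tracking curves are bounded by the total steps, so the
  Arzela-Ascoli theorem applies. The limit stays in the closed set \<open>D\<close> because the
  vertices do.\<close>

lemma tracks_uniform_limit:
  fixes \<sigma> :: "nat \<Rightarrow> real \<Rightarrow> 'a"
  assumes tr: "\<And>n. tracks (ws n) (e n) (\<sigma> n)" and ends: "\<And>n. hd (ws n) = a" "\<And>n. last (ws n) = b"
    and D: "\<And>n. set (ws n) \<subseteq> D" and K: "\<And>n. total_step (ws n) \<le> K" "0 \<le> K" and e: "e \<longlonglongrightarrow> 0"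
  obtains k g L where "strict_mono (k :: nat \<Rightarrow> nat)" "L-lipschitz_on {0..1} g" "g \<in> lipschitz_paths D a b"
    "\<And>\<epsilon>. 0 < \<epsilon> \<Longrightarrow> \<forall>\<^sub>F n in sequentially. \<forall>x\<in>{0..1}. norm (\<sigma> (k n) x - g x) < \<epsilon>"
proof -
  have \<sigma>_lip: "(real DIM('a) * (total_step (ws n) / lo))-lipschitz_on UNIV (\<sigma> n)"
    and \<sigma>0: "\<sigma> n 0 = a" and \<sigma>1: "\<sigma> n 1 = b"
    and \<sigma>_near: "\<And>t. t \<in> {0..1} \<Longrightarrow> \<exists>v\<in>set (ws n). norm (\<sigma> n t - v) \<le> width * e n" for n
    using tr[of n] ends[of n] unfolding tracks_def by simp_all
  define L where "L = real DIM('a) * (K / lo)"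
  have L0: "0 \<le> L"
    using lo_pos K by (simp add: L_def)
  have lip: "L-lipschitz_on UNIV (\<sigma> n)" for n
    using K lo_pos by (intro lipschitz_on_le[OF \<sigma>_lip]) (auto simp: L_def intro!: mult_left_mono divide_right_mono)
  have lipD: "norm (\<sigma> n x - \<sigma> n y) \<le> L * \<bar>x - y\<bar>" for n x y
    using lipschitz_onD[OF lip, of x y n] by (simp add: dist_norm)
  have bound: "norm (\<sigma> n t) \<le> norm a + L" if "t \<in> {0..1}" for n t
  proof -
    have "norm (\<sigma> n t) \<le> norm (\<sigma> n t - \<sigma> n 0) + norm (\<sigma> n 0)"
      using norm_triangle_ineq[of "\<sigma> n t - \<sigma> n 0" "\<sigma> n 0"] by simp
    moreover have "L * \<bar>t - 0\<bar> \<le> L * 1"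
      using that L0 by (intro mult_left_mono) auto
    ultimately show ?thesis
      using lipD[of n t 0] \<sigma>0[of n] by simp
  qed
  have equi: "\<exists>d>0. \<forall>n y. y \<in> {0..1} \<and> norm (x - y) < d \<longrightarrow> norm (\<sigma> n x - \<sigma> n y) < \<epsilon>"
    if "0 < \<epsilon>" for x \<epsilon> :: real
  proof (intro exI[of _ "\<epsilon> / (L + 1)"] conjI allI impI)
    show "0 < \<epsilon> / (L + 1)"
      using that L0 by simp
    fix n y assume y: "y \<in> {0..1} \<and> norm (x - y) < \<epsilon> / (L + 1)"
    then have "(L + 1) * \<bar>x - y\<bar> < \<epsilon>"
      using L0 by (simp add: pos_less_divide_eq mult.commute)
    moreover have "L * \<bar>x - y\<bar> \<le> (L + 1) * \<bar>x - y\<bar>"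
      by (intro mult_right_mono) auto
    ultimately show "norm (\<sigma> n x - \<sigma> n y) < \<epsilon>"
      using lipD[of n x y] by linarith
  qed
  obtain g k where k: "strict_mono (k :: nat \<Rightarrow> nat)"
    and unif: "\<And>\<epsilon>. 0 < \<epsilon> \<Longrightarrow> \<exists>N. \<forall>n x. n \<ge> N \<and> x \<in> {0..1} \<longrightarrow> norm (\<sigma> (k n) x - g x) < \<epsilon>"
    by (rule Arzela_Ascoli[of "{0..1::real}" \<sigma> "norm a + L"]) (use bound equi in auto)
  have unif_ev: "\<forall>\<^sub>F n in sequentially. \<forall>x\<in>{0..1}. norm (\<sigma> (k n) x - g x) < \<epsilon>" if "0 < \<epsilon>" for \<epsilon>
    using unif[OF that] unfolding eventually_sequentially by blast
  have conv: "(\<lambda>n. \<sigma> (k n) x) \<longlonglongrightarrow> g x" if "x \<in> {0..1}" for x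
  proof (rule tendstoI)
    fix \<epsilon> :: real assume "0 < \<epsilon>"
    from unif_ev[OF this] show "\<forall>\<^sub>F n in sequentially. dist (\<sigma> (k n) x) (g x) < \<epsilon>"
      by eventually_elim (use that in \<open>simp add: dist_norm\<close>)
  qed
  have g_lip: "L-lipschitz_on {0..1} g"
  proof (rule lipschitz_onI)
    fix x y :: real assume xy: "x \<in> {0..1}" "y \<in> {0..1}"
    have "(\<lambda>n. dist (\<sigma> (k n) x) (\<sigma> (k n) y)) \<longlonglongrightarrow> dist (g x) (g y)"
      by (intro tendsto_dist conv xy)
    then show "dist (g x) (g y) \<le> L * dist x y"
      by (rule tendsto_upperbound) (auto intro!: always_eventually lipschitz_onD[OF lip])
  qed (rule L0)
  have g_ends: "g 0 = a" "g 1 = b"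
    using conv[of 0] conv[of 1] \<sigma>0 \<sigma>1 by (auto simp: LIMSEQ_const_iff)
  have ek: "(\<lambda>n. width * e (k n)) \<longlonglongrightarrow> 0"
    using tendsto_mult_right_zero[OF LIMSEQ_subseq_LIMSEQ[OF e k], of width] by (simp add: o_def)
  have gD: "g t \<in> D" if t: "t \<in> {0..1}" for t
  proof -
    have "\<forall>n. \<exists>v. v \<in> set (ws (k n)) \<and> norm (\<sigma> (k n) t - v) \<le> width * e (k n)"
      using \<sigma>_near[OF t] by blast
    then have "\<exists>v. \<forall>n. v n \<in> set (ws (k n)) \<and> norm (\<sigma> (k n) t - v n) \<le> width * e (k n)"
      by (rule choice)
    then obtain v where v: "\<And>n. v n \<in> set (ws (k n))" "\<And>n. norm (\<sigma> (k n) t - v n) \<le> width * e (k n)"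
      by blast
    have "(\<lambda>n. \<sigma> (k n) t - v n) \<longlonglongrightarrow> 0"
      by (rule Lim_null_comparison[OF _ ek]) (use v(2) in simp)
    from tendsto_diff[OF conv[OF t] this] have "v \<longlonglongrightarrow> g t"
      by simp
    moreover have "v n \<in> D" for n
      using v(1)[of n] D[of "k n"] by blast
    ultimately show ?thesis
      using compact_imp_closed[OF compact_D] by (meson closed_sequentially)
  qed
  have "g \<in> lipschitz_paths D a b"
    using g_lip g_ends gD by (auto simp: lipschitz_paths_def path_image_def pathstart_def pathfinish_def)
  with k g_lip unif_ev show thesis
    using that by blast
qed

text \<open>Near \<open>g t\<close> the gauge at \<open>g t\<close> is at most \<open>1 +
  \<eta>\<close> times the step, so the tracking curves make displacements of gauge at most about
  \<open>(1 + \<eta>) * (M + \<eta>) * h\<close> in time \<open>h\<close>. This passes to the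
  uniform limit, where the errors \<open>O(e n)\<close> vanish, and then to the derivative;
  finally \<open>\<eta>\<close> tends to 0.\<close>

lemma tracks_limit_velocity:
  fixes \<sigma> :: "nat \<Rightarrow> real \<Rightarrow> 'a"
  assumes tr: "\<And>n. tracks (ws n) (e n) (\<sigma> n)" and e: "e \<longlonglongrightarrow> 0"
    and unif: "\<And>\<epsilon>. 0 < \<epsilon> \<Longrightarrow> \<forall>\<^sub>F n in sequentially. \<forall>x\<in>{0..1}. norm (\<sigma> n x - g x) < \<epsilon>"
    and total: "\<And>\<eta>. 0 < \<eta> \<Longrightarrow> \<forall>\<^sub>F n in sequentially. total_step (ws n) \<le> M + \<eta>"
    and g: "L-lipschitz_on {0..1} g" and t: "0 < t" "t < 1" and x: "g t \<in> D"
    and w: "(g has_vector_derivative w) (at t)"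
  shows "gauge_at (g t) w \<le> M"
proof -
  have L0: "0 \<le> L"
    by (rule lipschitz_on_nonneg[OF g])
  have gauge_cont: "continuous_on UNIV (gauge_at (g t))"
    by (rule lipschitz_on_continuous_on[OF gauge_lipschitz[OF x]])
  have we: "(\<lambda>n. width * e n) \<longlonglongrightarrow> 0"
    using tendsto_mult_right_zero[OF e, of width] by simp
  have incr: "\<exists>h0>0. \<forall>h. 0 < h \<and> h < h0 \<longrightarrow> gauge_at (g t) (g (t + h) - g t) \<le> (1 + \<eta>) * ((M + \<eta>) * h)"
    if \<eta>: "0 < \<eta>" for \<eta>
  proof -
    obtain \<delta> where \<delta>: "0 < \<delta>" and loc:
      "\<And>x u v. \<lbrakk>x \<in> D; u \<in> D; v \<in> D; dist u x < \<delta>; dist v x < \<delta>\<rbrakk> \<Longrightarrow> gauge_at x (v - u) \<le> (1 + \<eta>) * step u v"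
      using gauge_le_step[OF \<eta>] by blast
    define h0 where "h0 = min (1 - t) (\<delta> / (4 * (L + 1)))"
    have h0: "0 < h0"
      using t \<delta> L0 by (simp add: h0_def)
    show ?thesis
    proof (intro exI[of _ h0] conjI allI impI h0)
      fix h assume h: "0 < h \<and> h < h0"
      then have th: "t + h \<le> 1"
        by (simp add: h0_def)
      have "(L + 1) * h < \<delta> / 4"
        using h L0 by (simp add: h0_def field_simps)
      moreover have "L * h \<le> (L + 1) * h"
        using h by simp
      ultimately have Lh: "L * h < \<delta> / 4"
        by linarith
      have "\<forall>\<^sub>F n in sequentially. width * e n < \<delta> / 4"
        using order_tendstoD(2)[OF we, of "\<delta> / 4"] \<delta> by simp
      moreover have "\<forall>\<^sub>F n in sequentially. \<forall>x\<in>{0..1}. norm (\<sigma> n x - g x) < \<delta> / 4"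
        using unif[of "\<delta> / 4"] \<delta> by simp
      ultimately have ev: "\<forall>\<^sub>F n in sequentially. gauge_at (g t) (\<sigma> n (t + h) - \<sigma> n t)
          \<le> (1 + \<eta>) * ((M + \<eta>) * h + hi * e n) + 2 * (hi * (width * e n))"
        using total[OF \<eta>]
      proof eventually_elim
        case (elim n)
        have close: "\<forall>\<tau>\<in>{t..t + h}. dist (\<sigma> n \<tau>) (g t) < \<delta> - width * e n"
        proof
          fix \<tau> assume "\<tau> \<in> {t..t + h}"
          then have \<tau>: "t \<le> \<tau>" "\<tau> \<le> t + h"
            by auto
          have "dist (\<sigma> n \<tau>) (g t) \<le> dist (\<sigma> n \<tau>) (g \<tau>) + dist (g \<tau>) (g t)"
            by (rule dist_triangle)
          moreover have "dist (\<sigma> n \<tau>) (g \<tau>) < \<delta> / 4"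
            using elim(2) \<tau> t th by (simp add: dist_norm)
          moreover have "dist (g \<tau>) (g t) \<le> L * (\<tau> - t)"
            using lipschitz_onD[OF g, of \<tau> t] \<tau> t th by (simp add: dist_real_def)
          moreover have "L * (\<tau> - t) \<le> L * h"
            using \<tau> L0 by (intro mult_left_mono) auto
          moreover have "\<delta> / 4 + \<delta> / 4 + \<delta> / 4 < \<delta>"
            using \<delta> by simp
          ultimately show "dist (\<sigma> n \<tau>) (g t) < \<delta> - width * e n"
            using Lh elim(1) by linarith
        qed
        have "gauge_at (g t) (\<sigma> n (t + h) - \<sigma> n t)
            \<le> (1 + \<eta>) * (total_step (ws n) * (t + h - t) + hi * e n) + 2 * (hi * (width * e n))"
        proof -
          have "0 \<le> t \<and> t \<le> t + h \<and> t + h \<le> 1 \<and> g t \<in> D \<and> 0 \<le> 1 + \<eta> \<and>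
              (\<forall>u\<in>D. \<forall>v\<in>D. dist u (g t) < \<delta> \<and> dist v (g t) < \<delta> \<longrightarrow> gauge_at (g t) (v - u) \<le> (1 + \<eta>) * step u v) \<and>
              (\<forall>\<tau>\<in>{t..t + h}. dist (\<sigma> n \<tau>) (g t) < \<delta> - width * e n)"
            using t h th x \<eta> loc close by (intro conjI) auto
          then show ?thesis
            using tr[of n, unfolded tracks_def] by blast
        qed
        also have "\<dots> \<le> (1 + \<eta>) * ((M + \<eta>) * h + hi * e n) + 2 * (hi * (width * e n))"
          using elim(3) h \<eta> by (intro add_right_mono mult_left_mono) (auto intro: mult_right_mono)
        finally show ?case .
      qed
      have conv: "(\<lambda>n. \<sigma> n s) \<longlonglongrightarrow> g s" if "s \<in> {0..1}" for s
      proof (rule tendstoI)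
        fix \<epsilon> :: real assume "0 < \<epsilon>"
        from unif[OF this] show "\<forall>\<^sub>F n in sequentially. dist (\<sigma> n s) (g s) < \<epsilon>"
          by eventually_elim (use that in \<open>simp add: dist_norm\<close>)
      qed
      have "(\<lambda>n. \<sigma> n (t + h) - \<sigma> n t) \<longlonglongrightarrow> g (t + h) - g t"
        using t th h by (intro tendsto_diff conv) auto
      then have lim: "(\<lambda>n. gauge_at (g t) (\<sigma> n (t + h) - \<sigma> n t)) \<longlonglongrightarrow> gauge_at (g t) (g (t + h) - g t)"
        by (rule continuous_on_tendsto_compose[OF gauge_cont]) auto
      have "(\<lambda>n. (1 + \<eta>) * ((M + \<eta>) * h + hi * e n) + 2 * (hi * (width * e n)))
          \<longlonglongrightarrow> (1 + \<eta>) * ((M + \<eta>) * h + hi * 0) + 2 * (hi * 0)"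
        by (intro tendsto_intros e we)
      from tendsto_le[OF sequentially_bot this lim ev]
      show "gauge_at (g t) (g (t + h) - g t) \<le> (1 + \<eta>) * ((M + \<eta>) * h)"
        by simp
    qed
  qed
  have "((\<lambda>h. (g (t + h) - g t) /\<^sub>R h) \<longlongrightarrow> w) (at_right 0)"
    using has_vector_derivative_quotient_limit[OF w] by (rule filterlim_at_split[THEN iffD1, THEN conjunct2])
  then have lim: "((\<lambda>h. gauge_at (g t) ((g (t + h) - g t) /\<^sub>R h)) \<longlongrightarrow> gauge_at (g t) w) (at_right 0)"
    by (rule continuous_on_tendsto_compose[OF gauge_cont]) auto
  have le: "gauge_at (g t) w \<le> (1 + \<eta>) * (M + \<eta>)" if \<eta>: "0 < \<eta>" for \<eta>
    using lim
  proof (rule tendsto_upperbound)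
    obtain h0 where h0: "0 < h0"
      "\<And>h. 0 < h \<and> h < h0 \<Longrightarrow> gauge_at (g t) (g (t + h) - g t) \<le> (1 + \<eta>) * ((M + \<eta>) * h)"
      using incr[OF \<eta>] by blast
    have "gauge_at (g t) ((g (t + h) - g t) /\<^sub>R h) \<le> (1 + \<eta>) * (M + \<eta>)" if "0 < h" "h < h0" for h
    proof -
      have "gauge_at (g t) ((g (t + h) - g t) /\<^sub>R h) = inverse h * gauge_at (g t) (g (t + h) - g t)"
        using that by (intro gauge_scale[OF x]) simp
      also have "\<dots> \<le> inverse h * ((1 + \<eta>) * ((M + \<eta>) * h))"
        using h0(2)[of h] that by (intro mult_left_mono) auto
      also have "\<dots> = (1 + \<eta>) * (M + \<eta>)"
        using that by simp
      finally show ?thesis .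
    qed
    then show "\<forall>\<^sub>F h in at_right 0. gauge_at (g t) ((g (t + h) - g t) /\<^sub>R h) \<le> (1 + \<eta>) * (M + \<eta>)"
      unfolding eventually_at_right_field using h0(1) by blast
  qed simp
  have "((\<lambda>\<eta>. (1 + \<eta>) * (M + \<eta>)) \<longlongrightarrow> (1 + 0) * (M + 0)) (at_right 0)"
    by (intro tendsto_intros)
  then have "gauge_at (g t) w \<le> (1 + 0) * (M + 0)"
    by (rule tendsto_lowerbound) (use le in \<open>auto simp: eventually_at_right_field intro: exI[of _ 1]\<close>)
  then show ?thesis
    by simp
qed

text \<open>By homogeneity the integrand is the \<open>p\<close>-th power of the gauge of the velocity,
  so it is at most the infimum of the cost at almost every time.\<close>

lemma argmin_of_velocity_gauge:
  assumes ab: "a \<in> D" "b \<in> D" and g: "g \<in> lipschitz_paths D a b"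
    and vel: "\<And>t w. \<lbrakk>0 < t; t < 1; (g has_vector_derivative w) (at t)\<rbrakk> \<Longrightarrow> gauge_at (g t) w \<le> step a b"
  shows "g \<in> argmin_on (path_cost f) (lipschitz_paths D a b)"
proof -
  obtain L where L: "L-lipschitz_on {0..1} g"
    using g by (auto simp: lipschitz_paths_def)
  obtain N where N: "negligible N"
    "\<And>t. \<lbrakk>0 < t; t < 1; t \<notin> N\<rbrakk> \<Longrightarrow> (g has_vector_derivative velocity g t) (at t)"
    using lipschitz_path_differentiable_AE[OF L] by blast
  have le: "f (g t) (velocity g t) \<le> cost_dist f D a b" if t: "0 < t" "t < 1" "t \<notin> N" for t
  proof -
    have "gauge_at (g t) (velocity g t) powr p \<le> step a b powr p"
      using vel[OF t(1,2) N(2)[OF t]] p_ge_1 by (intro powr_mono2) auto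
    moreover have "g t \<in> D"
      using g t by (auto simp: lipschitz_paths_def path_image_def)
    ultimately show ?thesis
      by (simp add: gauge_powr step_powr ab)
  qed
  have "negligible (N \<union> {0, 1})"
    using N(1) by simp
  then have "AE t in lebesgue. t \<notin> N \<union> {0, 1}"
    unfolding negligible_iff_null_sets by (rule AE_not_in)
  then have "AE t in lebesgue. t \<in> {0..1} \<longrightarrow> f (g t) (velocity g t) \<le> cost_dist f D a b"
    by eventually_elim (use le in auto)
  then have "path_cost f g \<le> cost_dist f D a b"
    by (rule path_cost_le_of_velocity[OF _ cost_dist_nonneg[OF ab]])
  then show ?thesis
    unfolding argmin_on_def is_arg_min_def using g order_trans[OF _ cost_dist_le] by (auto simp: not_less)
qed

text \<open>A uniform limit of tracking curves is a minimizer by the two preceding lemmas. The vertices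
  of the chains are values of the tracking curves and, conversely, no value is farther than
  \<open>width * e n\<close> from a vertex.\<close>

theorem discrete_paths_compactness:
  fixes ws :: "nat \<Rightarrow> 'a list" and e :: "nat \<Rightarrow> real"
  assumes ws: "\<And>n. ws n \<in> discrete_paths (V n) (e n) a b" and V: "\<And>n. V n \<subseteq> D"
    and ab: "a \<in> D" "b \<in> D"
    and e: "e \<longlonglongrightarrow> 0" and B: "\<And>n. energy (ws n) \<le> B"
    and opt: "\<And>\<eta>. 0 < \<eta> \<Longrightarrow> \<forall>\<^sub>F n in sequentially. energy (ws n) \<le> cost_dist f D a b + \<eta>"
  obtains k \<gamma> where "strict_mono (k :: nat \<Rightarrow> nat)"
    "\<gamma> \<in> argmin_on (path_cost f) (lipschitz_paths D a b)"
    "(\<lambda>n. hausdorff_dist (set (ws (k n))) (path_image \<gamma>)) \<longlonglongrightarrow> 0"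
proof -
  have total_le: "total_step (ws n) \<le> c" if "energy (ws n) \<le> c powr p" "0 \<le> c" for n c
  proof -
    have "(total_step (ws n) powr p) powr (1 / p) \<le> (c powr p) powr (1 / p)"
      by (rule powr_mono2) (use order_trans[OF total_step_powr_le_energy[OF ws V] that(1)] p_ge_1 in auto)
    moreover have "0 \<le> total_step (ws n)"
      unfolding total_step_def adjacent_sum_def by (intro sum_nonneg) simp
    ultimately show ?thesis
      using that(2) by (simp add: powr_root)
  qed
  have "\<exists>\<sigma>. \<forall>n. tracks (ws n) (e n) (\<sigma> n)"
    by (rule choice, rule allI, rule tracks_exists[OF ws V])
  then obtain \<sigma> where \<sigma>: "\<And>n. tracks (ws n) (e n) (\<sigma> n)"
    by blast
  define K where "K = \<bar>B\<bar> powr (1 / p)"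
  have "energy (ws n) \<le> K powr p" for n
    using B[of n] by (simp add: K_def powr_root)
  then have K: "total_step (ws n) \<le> K" for n
    by (rule total_le) (simp add: K_def)
  have ends: "hd (ws n) = a" "last (ws n) = b" "set (ws n) \<subseteq> D" for n
    using ws[of n] V[of n] by (auto simp: discrete_paths_def)
  obtain k g L where k: "strict_mono (k :: nat \<Rightarrow> nat)" and g: "L-lipschitz_on {0..1} g" "g \<in> lipschitz_paths D a b"
    and unif: "\<And>\<epsilon>. 0 < \<epsilon> \<Longrightarrow> \<forall>\<^sub>F n in sequentially. \<forall>x\<in>{0..1}. norm (\<sigma> (k n) x - g x) < \<epsilon>"
    by (rule tracks_uniform_limit[OF \<sigma> ends K _ e]) (simp add: K_def, blast)
  have ek: "(\<lambda>n. e (k n)) \<longlonglongrightarrow> 0"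
    using LIMSEQ_subseq_LIMSEQ[OF e k] by (simp add: o_def)
  have total: "\<forall>\<^sub>F n in sequentially. total_step (ws (k n)) \<le> step a b + \<eta>" if \<eta>: "0 < \<eta>" for \<eta>
  proof -
    have "step a b powr p < (step a b + \<eta>) powr p"
      using \<eta> p_ge_1 by (intro powr_less_mono2) auto
    then have "0 < (step a b + \<eta>) powr p - step a b powr p"
      by simp
    from opt[OF this] have "\<forall>\<^sub>F n in sequentially. energy (ws n) \<le> (step a b + \<eta>) powr p"
      by (simp add: step_powr ab)
    then have "\<forall>\<^sub>F n in sequentially. energy (ws (k n)) \<le> (step a b + \<eta>) powr p"
      by (rule eventually_subseq[OF k])
    then show ?thesis
      by eventually_elim (use total_le \<eta> in simp)
  qed
  show thesis
  proof (rule that[OF k])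
    show "g \<in> argmin_on (path_cost f) (lipschitz_paths D a b)"
    proof (rule argmin_of_velocity_gauge[OF ab g(2)])
      fix t w assume t: "0 < t" "t < 1" and w: "(g has_vector_derivative w) (at t)"
      have "g t \<in> D"
        using g(2) t by (auto simp: lipschitz_paths_def path_image_def)
      then show "gauge_at (g t) w \<le> step a b"
        by (intro tracks_limit_velocity[where ws="\<lambda>n. ws (k n)" and e="\<lambda>n. e (k n)" and \<sigma>="\<lambda>n. \<sigma> (k n)" and L=L]
            \<sigma> ek unif total g(1) t w)
    qed
    show "(\<lambda>n. hausdorff_dist (set (ws (k n))) (path_image g)) \<longlonglongrightarrow> 0"
    proof (rule tendstoI)
      fix \<epsilon> :: real assume \<epsilon>: "0 < \<epsilon>"
      have "(\<lambda>n. width * e (k n)) \<longlonglongrightarrow> 0"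
        using tendsto_mult_right_zero[OF ek, of width] by simp
      then have "\<forall>\<^sub>F n in sequentially. width * e (k n) < \<epsilon> / 3"
        using \<epsilon> by (intro order_tendstoD(2)) auto
      moreover have "\<forall>\<^sub>F n in sequentially. \<forall>x\<in>{0..1}. norm (\<sigma> (k n) x - g x) < \<epsilon> / 3"
        using unif[of "\<epsilon> / 3"] \<epsilon> by simp
      ultimately show "\<forall>\<^sub>F n in sequentially. dist (hausdorff_dist (set (ws (k n))) (path_image g)) 0 < \<epsilon>"
      proof eventually_elim
        case (elim n)
        have "\<bar>hausdorff_dist (set (ws (k n))) (path_image g)\<bar> \<le> 2 * (\<epsilon> / 3)"
        proof (rule hausdorff_dist_bound)
          show "set (ws (k n)) \<noteq> {}"
            using ws[of "k n"] by (auto simp: discrete_paths_def)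
          show "path_image g \<noteq> {}"
            by simp
        next
          fix v assume "v \<in> set (ws (k n))"
          then obtain t where t: "t \<in> {0..1}" "\<sigma> (k n) t = v"
            using \<sigma>[of "k n"] unfolding tracks_def by blast
          then have "norm (v - g t) \<le> 2 * (\<epsilon> / 3)"
            using elim(2) \<epsilon> by fastforce
          then show "\<exists>y\<in>path_image g. norm (v - y) \<le> 2 * (\<epsilon> / 3)"
            using t by (auto simp: path_image_def)
        next
          fix y assume "y \<in> path_image g"
          then obtain t where t: "t \<in> {0..1}" "y = g t"
            by (auto simp: path_image_def)
          then obtain v where v: "v \<in> set (ws (k n))" "norm (\<sigma> (k n) t - v) \<le> width * e (k n)"
            using \<sigma>[of "k n"] unfolding tracks_def by blast
          have "norm (v - y) \<le> norm (\<sigma> (k n) t - v) + norm (\<sigma> (k n) t - g t)"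
            using dist_triangle3[of v y "\<sigma> (k n) t"] t by (simp add: dist_norm)
          moreover have "norm (\<sigma> (k n) t - g t) < \<epsilon> / 3"
            using elim(2) t by blast
          ultimately have "norm (v - y) \<le> 2 * (\<epsilon> / 3)"
            using v(2) elim(1) by linarith
          then show "\<exists>x\<in>set (ws (k n)). norm (x - y) \<le> 2 * (\<epsilon> / 3)"
            using v(1) by blast
        qed
        also have "2 * (\<epsilon> / 3) < \<epsilon>"
          using \<epsilon> by simp
        finally show ?case
          by (simp add: dist_real_def)
      qed
    qed
  qed
qed

end

section \<open>Chains of almost optimal cost in dense graphs\<close>

lemma adjacent_sum_simps [simp]:
  "adjacent_sum c [] = 0" "adjacent_sum c [x] = 0"
  "adjacent_sum c (x # y # zs) = c x y + adjacent_sum c (y # zs)"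
  by (simp_all add: adjacent_sum_def sum.lessThan_Suc_shift del: sum.lessThan_Suc)

lemma adjacent_sum_remdups_adj:
  assumes "\<And>x. x \<in> set xs \<Longrightarrow> c x x = 0"
  shows "adjacent_sum c (remdups_adj xs) = adjacent_sum c xs"
  using assms
proof (induction xs rule: remdups_adj.induct)
  case (3 x y xs)
  obtain zs where zs: "remdups_adj (y # xs) = y # zs"
    by (metis hd_remdups_adj list.collapse list.sel(1) list.distinct(1) remdups_adj_Nil_iff)
  show ?case
    using 3 zs by (cases "x = y") auto
qed simp_all

context geodesic_cost
begin

definition line_energy :: "'a list \<Rightarrow> real" where
  "line_energy vs = real (length vs - 1) powr (p - 1) * adjacent_sum (\<lambda>u v. path_cost f (linepath u v)) vs"

lemma linepath_cost_nonneg: "\<lbrakk>u \<in> D; v \<in> D\<rbrakk> \<Longrightarrow> 0 \<le> path_cost f (linepath u v)"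
  using order_trans[OF cost_dist_nonneg cost_dist_le_linepath] .

lemma linepath_cost_refl: "u \<in> D \<Longrightarrow> path_cost f (linepath u u) = 0"
  using linepath_cost_nonneg[of u u] linepath_cost_le_norm[of u u] p_ge_1 by simp

text \<open>Edges of a discrete path join distinct vertices. Deleting repeated vertices keeps the sum
  of the edge costs and does not increase the number of edges, and both factors of the energy are
  monotone in these.\<close>

lemma discrete_path_of_chain:
  assumes xs: "xs \<noteq> []" "set xs \<subseteq> V" "hd xs = a" "last xs = b" and V: "V \<subseteq> D" and ab: "a \<noteq> b"
    and edge: "\<And>i. i < length xs - 1 \<Longrightarrow> norm (xs ! i - xs ! Suc i) < e"
  shows "remdups_adj xs \<in> discrete_paths V e a b" and "line_energy (remdups_adj xs) \<le> line_energy xs"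
proof -
  let ?ys = "remdups_adj xs"
  have ne: "?ys \<noteq> []"
    using xs(1) by simp
  have ends: "hd ?ys = a" "last ?ys = b"
    using xs by simp_all
  have "length ?ys \<noteq> 1"
  proof
    assume "length ?ys = 1"
    then obtain z where "?ys = [z]"
      by (auto simp: length_Suc_conv)
    then show False
      using ends ab by simp
  qed
  then have len: "2 \<le> length ?ys"
    using ne by (cases ?ys rule: remdups_adj.cases) auto
  have "successively (\<lambda>u v. norm (u - v) < e) xs"
    using edge by (simp add: successively_conv_nth)
  then have "successively (\<lambda>u v. norm (u - v) < e) ?ys"
    by (rule successively_remdups_adjI)
  moreover have "distinct_adj ?ys"
    by simp
  ultimately have "0 < norm (?ys ! i - ?ys ! Suc i) \<and> norm (?ys ! i - ?ys ! Suc i) < e"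
    if "i < length ?ys - 1" for i
    using that by (simp add: successively_conv_nth distinct_adj_conv_nth)
  then show "?ys \<in> discrete_paths V e a b"
    using len ends xs(2) by (simp add: discrete_paths_def)
  have inD: "x \<in> D" if "x \<in> set xs" for x
    using that xs(2) V by blast
  have "0 \<le> path_cost f (linepath (xs ! i) (xs ! Suc i))" if "i < length xs - 1" for i
    using that by (intro linepath_cost_nonneg inD) auto
  then have "0 \<le> adjacent_sum (\<lambda>u v. path_cost f (linepath u v)) xs"
    unfolding adjacent_sum_def by (intro sum_nonneg) auto
  moreover have "real (length ?ys - 1) powr (p - 1) \<le> real (length xs - 1) powr (p - 1)"
    using p_ge_1 diff_le_mono[OF remdups_adj_length[of xs], of 1] by (intro powr_mono2) auto
  moreover have "adjacent_sum (\<lambda>u v. path_cost f (linepath u v)) ?ys = adjacent_sum (\<lambda>u v. path_cost f (linepath u v)) xs"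
    by (rule adjacent_sum_remdups_adj) (use inD in \<open>auto intro: linepath_cost_refl\<close>)
  ultimately show "line_energy ?ys \<le> line_energy xs"
    unfolding line_energy_def by (simp add: mult_right_mono)
qed

text \<open>Almost optimal chains exist in every graph with sufficiently short edges whose vertices are
  dense on a scale that is small relative to the edge length.\<close>

definition approximable :: "'a \<Rightarrow> 'a \<Rightarrow> real \<Rightarrow> bool" where
  "approximable a b \<eta> \<longleftrightarrow> (\<exists>\<kappa>>0. \<exists>e0>0. \<forall>e V. 0 < e \<and> e < e0 \<and> V \<subseteq> D \<and> a \<in> V \<and> b \<in> V \<and>
      (\<forall>y\<in>D. \<exists>x\<in>V. norm (x - y) \<le> \<kappa> * e) \<longrightarrow>
      (\<exists>vs\<in>discrete_paths V e a b. line_energy vs \<le> cost_dist f D a b + \<eta>))"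

text \<open>The geodesic from \<open>a\<close> to \<open>b\<close> is cut at \<open>m\<close>
  equidistant times, with \<open>m\<close> of order \<open>1 / e\<close>, and the cut points are
  moved to nearby vertices. By quasinormality the mean velocity of each piece of the geodesic has
  gauge at most about \<open>M\<close>, and the displacements, magnified by \<open>m\<close>,
  contribute \<open>O(m * \<kappa> * e) = O(\<kappa>)\<close>. Equal bounds for all edges make the
  factor \<open>m powr (p - 1)\<close> harmless.\<close>

lemma approximable_distinct_ends:
  assumes ab: "a \<in> D" "b \<in> D" "a \<noteq> b" and \<eta>: "0 < \<eta>"
  shows "approximable a b \<eta>"
proof -
  define \<gamma> where "\<gamma> = geo a b"
  obtain L where L: "L-lipschitz_on {0..1} \<gamma>"
    unfolding \<gamma>_def by (rule geo_lipschitz[OF ab(1,2)])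
  have L0: "0 \<le> L"
    by (rule lipschitz_on_nonneg[OF L])
  define M where "M = step a b"
  have M0: "0 \<le> M"
    by (simp add: M_def)
  \<comment> \<open>The number \<open>Q \<kappa>\<close> will bound the gauge of \<open>m\<close> times an edge;
    \<open>3 * L + 4\<close> bounds \<open>m * e\<close>.\<close>
  define Q where "Q \<kappa> = (1 + \<kappa>) * M + hi * (2 * \<kappa> * (3 * L + 4))" for \<kappa>
  have "((\<lambda>\<kappa>. (1 + \<kappa>) * Q \<kappa> powr p) \<longlongrightarrow> (1 + 0) * Q 0 powr p) (at_right 0)"
    unfolding Q_def
    by (intro tendsto_intros tendsto_powr')
      (use p_ge_1 M0 L0 hi_pos in \<open>auto simp: eventually_at_filter intro!: always_eventually\<close>)
  moreover have "(1 + 0) * Q 0 powr p < cost_dist f D a b + \<eta>"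
    using \<eta> ab by (simp add: Q_def M_def step_powr)
  ultimately have "\<forall>\<^sub>F \<kappa> in at_right 0. (1 + \<kappa>) * Q \<kappa> powr p < cost_dist f D a b + \<eta>"
    by (rule order_tendstoD)
  moreover have "\<forall>\<^sub>F \<kappa> in at_right (0::real). 6 * \<kappa> < 1"
    by (intro eventually_at_rightI[of 0 "1 / 6"]) auto
  moreover have "\<forall>\<^sub>F \<kappa> in at_right (0::real). 0 < \<kappa>"
    by (simp add: eventually_at_right_less)
  ultimately have "\<forall>\<^sub>F \<kappa> in at_right 0. (1 + \<kappa>) * Q \<kappa> powr p < cost_dist f D a b + \<eta> \<and> 6 * \<kappa> < 1 \<and> 0 < \<kappa>"
    by eventually_elim simp
  from eventually_happens'[OF trivial_limit_at_right_real this] obtain \<kappa> where \<kappa>: "0 < \<kappa>" "6 * \<kappa> < 1" "(1 + \<kappa>) * Q \<kappa> powr p < cost_dist f D a b + \<eta>"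
    by blast
  obtain r where r: "0 < r" and ratio: "\<And>x y v. \<lbrakk>x \<in> D; y \<in> D; dist x y < r\<rbrakk> \<Longrightarrow> f x v \<le> (1 + \<kappa>) * f y v"
    using f_uniform_ratio[OF \<kappa>(1)] by blast
  have Q0: "0 \<le> Q \<kappa>"
    using \<kappa> M0 L0 hi_pos by (simp add: Q_def)
  show ?thesis
    unfolding approximable_def
  proof (rule exI[of _ \<kappa>], intro conjI \<kappa>(1), rule exI[of _ "min 1 r"], intro conjI allI impI)
    show "0 < min 1 r"
      using r by simp
  next
    fix e V
    assume *: "0 < e \<and> e < min 1 r \<and> V \<subseteq> D \<and> a \<in> V \<and> b \<in> V \<and> (\<forall>y\<in>D. \<exists>x\<in>V. norm (x - y) \<le> \<kappa> * e)"
    then have e: "0 < e" "e < 1" "e < r" and V: "V \<subseteq> D" "a \<in> V" "b \<in> V"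
      and dense: "\<And>y. y \<in> D \<Longrightarrow> \<exists>x\<in>V. norm (x - y) \<le> \<kappa> * e"
      by auto
    \<comment> \<open>With this \<open>m\<close> a piece of the geodesic is at most \<open>e / 3\<close> long,
      and \<open>\<kappa> < 1 / 6\<close> leaves room for two displacements.\<close>
    define m where "m = nat \<lceil>3 * (L + 1) / e\<rceil>"
    have m_bounds: "3 * (L + 1) / e \<le> real m" "real m \<le> 3 * (L + 1) / e + 1"
    proof -
      have "0 \<le> 3 * (L + 1) / e"
        using L0 e by simp
      then show "3 * (L + 1) / e \<le> real m" "real m \<le> 3 * (L + 1) / e + 1"
        unfolding m_def by linarith+
    qed
    have me: "3 * (L + 1) \<le> real m * e" "real m * e \<le> 3 * L + 4"
    proof -
      show "3 * (L + 1) \<le> real m * e"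
        using m_bounds(1) e by (simp add: pos_divide_le_eq)
      have "real m * e \<le> (3 * (L + 1) / e + 1) * e"
        using m_bounds(2) e by (intro mult_right_mono) auto
      also have "\<dots> = 3 * L + 3 + e"
        using e by (simp add: field_simps)
      finally show "real m * e \<le> 3 * L + 4"
        using e by linarith
    qed
    have m: "0 < m"
    proof (rule ccontr)
      assume "\<not> 0 < m"
      then show False
        using me(1) L0 by simp
    qed
    define y where "y i = \<gamma> (real i / real m)" for i
    have yD: "y i \<in> D" if "i \<le> m" for i
      unfolding y_def \<gamma>_def using that m by (intro geo_in ab) auto
    have y_ends: "y 0 = a" "y m = b"
      using geo_ends[OF ab(1,2)] m by (auto simp: y_def \<gamma>_def)
    have "\<exists>x\<in>V. norm (x - y i) \<le> \<kappa> * e \<and> (i = 0 \<longrightarrow> x = a) \<and> (i = m \<longrightarrow> x = b)" if "i \<le> m" for i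
    proof -
      consider "i = 0" | "i = m" | "i \<noteq> 0" "i \<noteq> m"
        by blast
      then show ?thesis
      proof cases
        case 1
        then show ?thesis
          using V(2) y_ends e \<kappa> m by (intro bexI[of _ a]) auto
      next
        case 2
        then show ?thesis
          using V(3) y_ends e \<kappa> m by (intro bexI[of _ b]) auto
      next
        case 3
        then show ?thesis
          using dense[OF yD[OF that]] by blast
      qed
    qed
    then obtain w where w: "\<And>i. i \<le> m \<Longrightarrow> w i \<in> V" "\<And>i. i \<le> m \<Longrightarrow> norm (w i - y i) \<le> \<kappa> * e"
      and w_ends: "w 0 = a" "w m = b"
      by (metis le_refl zero_le)
    have wD: "w i \<in> D" if "i \<le> m" for i
      using w(1)[OF that] V(1) by blast
    have \<gamma>_near: "3 * norm (\<gamma> \<tau> - y i) \<le> e" if i: "i < m" and \<tau>: "real i / real m \<le> \<tau>" "\<tau> \<le> real (Suc i) / real m" for i \<tau>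
    proof -
      have "0 \<le> real i / real m" "real (Suc i) / real m \<le> 1"
        using i by auto
      moreover have "0 \<le> \<tau>"
        using calculation(1) \<tau>(1) by (rule order_trans)
      ultimately have "norm (\<gamma> \<tau> - y i) \<le> L * (\<tau> - real i / real m)"
        using lipschitz_onD[OF L, of \<tau> "real i / real m"] \<tau> by (simp add: y_def dist_norm)
      also have "\<dots> \<le> L * (1 / real m)"
      proof (rule mult_left_mono[OF _ L0])
        have "real (Suc i) / real m = real i / real m + 1 / real m"
          by (simp add: add_divide_distrib)
        then show "\<tau> - real i / real m \<le> 1 / real m"
          using \<tau>(2) by linarith
      qed
      finally have "real m * norm (\<gamma> \<tau> - y i) \<le> L"
        using m by (simp add: field_simps)
      then have "real m * (3 * norm (\<gamma> \<tau> - y i)) \<le> real m * e"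
        using me(1) by (simp add: algebra_simps)
      then show ?thesis
        using m by simp
    qed
    have \<kappa>e: "6 * (\<kappa> * e) < e"
      using \<kappa>(2) e by simp
    have w_edge: "norm (w (Suc i) - w i) < e" if i: "i < m" for i
    proof -
      have "3 * norm (y (Suc i) - y i) \<le> e"
        using \<gamma>_near[OF i, of "real (Suc i) / real m"] m by (simp add: y_def divide_right_mono)
      moreover have "norm (w (Suc i) - w i) \<le> norm (w (Suc i) - y (Suc i)) + norm (y (Suc i) - y i) + norm (w i - y i)"
        using norm_triangle_ineq[of "w (Suc i) - y (Suc i)" "y (Suc i) - y i"]
          norm_triangle_ineq4[of "w (Suc i) - y i" "w i - y i"] by simp
      moreover have "norm (w i - y i) \<le> \<kappa> * e" "norm (w (Suc i) - y (Suc i)) \<le> \<kappa> * e"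
        using i by (auto intro: w(2))
      ultimately show ?thesis
        using \<kappa>e e by linarith
    qed
    have piece: "path_cost f (linepath (w i) (w (Suc i))) \<le> (1 + \<kappa>) * (Q \<kappa> / real m) powr p" if i: "i < m" for i
    proof -
      have wi: "w i \<in> D" "w (Suc i) \<in> D"
        using i by (auto intro: wD)
      have "f (w i) ((\<gamma> (real (Suc i) / real m) - \<gamma> (real i / real m)) /\<^sub>R (real (Suc i) / real m - real i / real m))
          \<le> (1 + \<kappa>) * cost_dist f D a b"
      proof (rule mean_velocity_cost_le[OF L])
        show "AE t in lebesgue. t \<in> {0..1} \<longrightarrow> f (\<gamma> t) (velocity \<gamma> t) \<le> cost_dist f D a b"
          using geo_cost_constant[OF ab(1,2)] unfolding \<gamma>_def by eventually_elim auto
      next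
        fix \<tau> v assume \<tau>: "real i / real m < \<tau>" "\<tau> < real (Suc i) / real m"
        have "0 \<le> real i / real m" "real (Suc i) / real m \<le> 1"
          using i by auto
        then have "0 \<le> \<tau>" "\<tau> \<le> 1"
          using \<tau> by linarith+
        then have "\<gamma> \<tau> \<in> D"
          unfolding \<gamma>_def by (intro geo_in ab)
        moreover have "dist (w i) (\<gamma> \<tau>) < r"
        proof -
          have "dist (w i) (\<gamma> \<tau>) \<le> norm (w i - y i) + norm (\<gamma> \<tau> - y i)"
            using dist_triangle2[of "w i" "\<gamma> \<tau>" "y i"] by (simp add: dist_norm)
          moreover have "norm (w i - y i) \<le> \<kappa> * e" "3 * norm (\<gamma> \<tau> - y i) \<le> e"
            using i \<tau> by (auto intro!: w(2) \<gamma>_near)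
          ultimately show ?thesis
            using \<kappa>e e by linarith
        qed
        ultimately show "f (w i) v \<le> (1 + \<kappa>) * f (\<gamma> \<tau>) v"
          using ratio wi by blast
      qed (use i m wi \<kappa> in \<open>auto simp: divide_strict_right_mono\<close>)
      moreover have "(\<gamma> (real (Suc i) / real m) - \<gamma> (real i / real m)) /\<^sub>R (real (Suc i) / real m - real i / real m)
          = real m *\<^sub>R (y (Suc i) - y i)"
        by (simp add: y_def diff_divide_distrib[symmetric])
      ultimately have "f (w i) (real m *\<^sub>R (y (Suc i) - y i)) \<le> (1 + \<kappa>) * cost_dist f D a b"
        by simp
      then have "gauge_at (w i) (real m *\<^sub>R (y (Suc i) - y i)) \<le> ((1 + \<kappa>) * cost_dist f D a b) powr (1 / p)"
        unfolding gauge_at_def using f_nonneg[OF wi(1)] p_ge_1 by (intro powr_mono2) auto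
      also have "\<dots> = (1 + \<kappa>) powr (1 / p) * M"
        using \<kappa> cost_dist_nonneg[OF ab(1,2)] by (simp add: M_def step_def powr_mult)
      also have "\<dots> \<le> (1 + \<kappa>) powr 1 * M"
        using \<kappa> p_ge_1 M0 by (intro mult_right_mono powr_mono) auto
      finally have main: "gauge_at (w i) (real m *\<^sub>R (y (Suc i) - y i)) \<le> (1 + \<kappa>) * M"
        using \<kappa> by simp
      let ?d = "(w (Suc i) - y (Suc i)) - (w i - y i)"
      have "norm ?d \<le> 2 * (\<kappa> * e)"
        using norm_triangle_ineq4[of "w (Suc i) - y (Suc i)" "w i - y i"] w(2)[of i] w(2)[of "Suc i"] i by simp
      then have "real m * norm ?d \<le> real m * (2 * (\<kappa> * e))"
        by (intro mult_left_mono) auto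
      also have "\<dots> = 2 * \<kappa> * (real m * e)"
        by simp
      also have "\<dots> \<le> 2 * \<kappa> * (3 * L + 4)"
        using me(2) \<kappa> by (intro mult_left_mono) auto
      finally have "hi * (real m * norm ?d) \<le> hi * (2 * \<kappa> * (3 * L + 4))"
        using hi_pos by (intro mult_left_mono) auto
      moreover have "gauge_at (w i) (real m *\<^sub>R ?d) \<le> hi * (real m * norm ?d)"
        using gauge_le[OF wi(1), of "real m *\<^sub>R ?d"] by simp
      moreover have "gauge_at (w i) (real m *\<^sub>R (w (Suc i) - w i))
          \<le> gauge_at (w i) (real m *\<^sub>R (y (Suc i) - y i)) + gauge_at (w i) (real m *\<^sub>R ?d)"
      proof -
        have "real m *\<^sub>R (w (Suc i) - w i) = real m *\<^sub>R (y (Suc i) - y i) + real m *\<^sub>R ?d"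
          by (simp add: algebra_simps)
        then show ?thesis
          using gauge_triangle[OF wi(1), of "real m *\<^sub>R (y (Suc i) - y i)" "real m *\<^sub>R ?d"] by simp
      qed
      ultimately have "gauge_at (w i) (real m *\<^sub>R (w (Suc i) - w i)) \<le> Q \<kappa>"
        using main unfolding Q_def by linarith
      then have "real m * gauge_at (w i) (w (Suc i) - w i) \<le> Q \<kappa>"
        by (simp add: gauge_scale wi)
      then have "gauge_at (w i) (w (Suc i) - w i) \<le> Q \<kappa> / real m"
        using m by (simp add: pos_le_divide_eq mult.commute)
      then have "gauge_at (w i) (w (Suc i) - w i) powr p \<le> (Q \<kappa> / real m) powr p"
        using p_ge_1 by (intro powr_mono2) auto
      then have fw: "f (w i) (w (Suc i) - w i) \<le> (Q \<kappa> / real m) powr p"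
        by (simp add: gauge_powr wi)
      show ?thesis
      proof (rule linepath_cost_le[OF wi])
        fix x assume x: "x \<in> closed_segment (w i) (w (Suc i))"
        then have xD: "x \<in> D"
          using closed_segment_subset[OF wi convex_D] by blast
        have "dist x (w i) \<le> norm (w (Suc i) - w i)"
          using segment_bound1[OF x] by (simp add: dist_norm norm_minus_commute)
        then have "dist x (w i) < r"
          using w_edge[OF i] e by simp
        then have "f x (w (Suc i) - w i) \<le> (1 + \<kappa>) * f (w i) (w (Suc i) - w i)"
          by (rule ratio[OF xD wi(1)])
        also have "\<dots> \<le> (1 + \<kappa>) * (Q \<kappa> / real m) powr p"
          using fw \<kappa> by (intro mult_left_mono) auto
        finally show "f x (w (Suc i) - w i) \<le> (1 + \<kappa>) * (Q \<kappa> / real m) powr p" .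
      qed
    qed
    define xs where "xs = map w [0..<Suc m]"
    have len: "length xs - 1 = m"
      by (simp add: xs_def)
    have nth: "xs ! i = w i" if "i \<le> m" for i
      unfolding xs_def using that by (subst nth_map) (auto simp del: upt_Suc)
    have "line_energy xs \<le> real m powr (p - 1) * (\<Sum>i<m. (1 + \<kappa>) * (Q \<kappa> / real m) powr p)"
      unfolding line_energy_def adjacent_sum_def len using piece nth by (intro mult_left_mono sum_mono) auto
    also have "\<dots> = real m powr (p - 1) * real m * ((1 + \<kappa>) * (Q \<kappa> / real m) powr p)"
      by simp
    also have "real m powr (p - 1) * real m = real m powr p"
      using m by (simp add: powr_diff)
    also have "real m powr p * ((1 + \<kappa>) * (Q \<kappa> / real m) powr p) = (1 + \<kappa>) * Q \<kappa> powr p"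
      using m Q0 by (simp add: powr_divide)
    also have "\<dots> \<le> cost_dist f D a b + \<eta>"
      using \<kappa>(3) by simp
    finally have energy_xs: "line_energy xs \<le> cost_dist f D a b + \<eta>" .
    have "xs \<noteq> []"
      by (simp add: xs_def)
    moreover have "set xs \<subseteq> V"
      using w(1) by (auto simp: xs_def less_Suc_eq_le simp del: upt_Suc)
    moreover have "hd xs = a" "last xs = b"
      using w_ends nth[of 0] nth[of m] \<open>xs \<noteq> []\<close> len by (auto simp: hd_conv_nth last_conv_nth)
    moreover have "norm (xs ! i - xs ! Suc i) < e" if "i < length xs - 1" for i
    proof -
      have "i < m"
        using that unfolding len .
      then show ?thesis
        using w_edge[of i] nth[of i] nth[of "Suc i"] by (simp add: norm_minus_commute)
    qed
    ultimately have "remdups_adj xs \<in> discrete_paths V e a b" "line_energy (remdups_adj xs) \<le> line_energy xs"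
      using discrete_path_of_chain[OF _ _ _ _ V(1) ab(3)] by blast+
    then show "\<exists>vs\<in>discrete_paths V e a b. line_energy vs \<le> cost_dist f D a b + \<eta>"
      using energy_xs by (meson order_trans)
  qed
qed

text \<open>Here the geodesic is constant and leads to no edge at all. An excursion from
  \<open>a\<close> to a vertex at distance about \<open>e / 2\<close> and back is a discrete path
  whose cost tends to 0 with \<open>e\<close>.\<close>

lemma approximable_equal_ends:
  assumes a: "a \<in> D" and z: "z \<in> D" "z \<noteq> a" and \<eta>: "0 < \<eta>"
  shows "approximable a a \<eta>"
proof -
  define c where "c = 2 powr p * m2"
  have c: "0 < c"
    using m2_pos by (simp add: c_def)
  define d where "d = norm (z - a)"
  have d: "0 < d"
    using z by (simp add: d_def)
  show ?thesis
    unfolding approximable_def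
  proof (rule exI[of _ "1 / 8"], rule conjI, simp, rule exI[of _ "min (min 1 d) (\<eta> / c)"], intro conjI allI impI)
    show "0 < min (min 1 d) (\<eta> / c)"
      using c d \<eta> by simp
  next
    fix e V
    assume *: "0 < e \<and> e < min (min 1 d) (\<eta> / c) \<and> V \<subseteq> D \<and> a \<in> V \<and> a \<in> V \<and> (\<forall>y\<in>D. \<exists>x\<in>V. norm (x - y) \<le> 1 / 8 * e)"
    then have e: "0 < e" "e < 1" "e < d" "c * e < \<eta>" and V: "V \<subseteq> D" "a \<in> V"
      using c by (auto simp: field_simps)
    define t where "t = e / (2 * d)"
    have t: "0 \<le> t" "t \<le> 1" "t * d = e / 2"
      using e d by (auto simp: t_def field_simps)
    define y where "y = (1 - t) *\<^sub>R a + t *\<^sub>R z"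
    have "y \<in> D"
      unfolding y_def using t a z convex_D by (intro convexD) auto
    then obtain x where x: "x \<in> V" "norm (x - y) \<le> 1 / 8 * e"
      using * by blast
    have ya: "norm (y - a) = e / 2"
    proof -
      have "y - a = t *\<^sub>R (z - a)"
        by (simp add: y_def algebra_simps)
      then show ?thesis
        using t by (simp add: d_def)
    qed
    have up: "norm (x - a) \<le> norm (x - y) + norm (y - a)"
      using norm_triangle_ineq[of "x - y" "y - a"] by simp
    have lo: "norm (y - a) \<le> norm (x - y) + norm (x - a)"
      using norm_triangle_ineq4[of "x - a" "x - y"] by simp
    have "8 * norm (x - y) \<le> e" "2 * norm (y - a) = e"
      using x(2) ya by simp_all
    then have xa: "0 < norm (x - a)" "norm (x - a) < e"
      using up lo e(1) by linarith+
    have xD: "x \<in> D"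
      using x V by blast
    have "[a, x, a] \<in> discrete_paths V e a a"
      using xa x(1) V by (auto simp: discrete_paths_def norm_minus_commute nth_Cons' less_Suc_eq)
    moreover have "line_energy [a, x, a] \<le> cost_dist f D a a + \<eta>"
    proof -
      have le: "m2 * norm v powr p \<le> m2 * e" if "norm v < e" for v :: 'a
      proof -
        have "norm v powr p \<le> e powr p"
          using that p_ge_1 by (intro powr_mono2) auto
        also have "\<dots> \<le> e powr 1"
          using e p_ge_1 by (intro powr_mono') auto
        finally show ?thesis
          using m2_pos e by simp
      qed
      have "path_cost f (linepath a x) \<le> m2 * e" "path_cost f (linepath x a) \<le> m2 * e"
        using order_trans[OF linepath_cost_le_norm[OF a xD] le] order_trans[OF linepath_cost_le_norm[OF xD a] le] xa
        by (auto simp: norm_minus_commute)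
      then have "2 powr (p - 1) * (path_cost f (linepath a x) + path_cost f (linepath x a))
          \<le> 2 powr (p - 1) * (m2 * e + m2 * e)"
        by (intro mult_left_mono add_mono) auto
      then have "line_energy [a, x, a] \<le> 2 powr (p - 1) * (m2 * e + m2 * e)"
        by (simp add: line_energy_def)
      also have "\<dots> = c * e"
        by (simp add: c_def powr_diff)
      also have "\<dots> \<le> cost_dist f D a a + \<eta>"
        using e(4) cost_dist_nonneg[OF a a] by linarith
      finally show ?thesis .
    qed
    ultimately show "\<exists>vs\<in>discrete_paths V e a a. line_energy vs \<le> cost_dist f D a a + \<eta>"
      by blast
  qed
qed

end

section \<open>Density of the random sample\<close>

text \<open>A ball contained in \<open>U\<close> is contracted towards \<open>y\<close> by the factor
  \<open>r / R\<close>, with \<open>R\<close> a bound for the diameter. The image stays in the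
  convex set and within distance \<open>r\<close> of \<open>y\<close>, and its volume is a
  multiple of \<open>r ^ DIM('a)\<close>, also for \<open>y\<close> on the boundary.\<close>

lemma convex_body_volume_lower_bound:
  fixes U :: "'a::euclidean_space set"
  assumes U: "open U" "U \<noteq> {}" "bounded U" "convex U"
  obtains c where "0 < c"
    "\<And>y r. \<lbrakk>y \<in> closure U; 0 < r; r \<le> 1\<rbrakk> \<Longrightarrow> c * r ^ DIM('a) \<le> measure lborel (closure U \<inter> cball y r)"
proof -
  let ?D = "closure U"
  have D: "convex ?D" "bounded ?D" "compact ?D"
    using U by (auto simp: convex_closure bounded_closure compact_closure)
  obtain z where "z \<in> U"
    using U(2) by blast
  then obtain r0 where r0: "0 < r0" "cball z r0 \<subseteq> U"
    using U(1) open_contains_cball by blast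
  have ball: "cball z r0 \<subseteq> ?D"
    using r0(2) closure_subset by blast
  obtain R0 where R0: "\<And>x. x \<in> ?D \<Longrightarrow> norm x \<le> R0"
    using D(2) by (auto simp: bounded_iff)
  define R where "R = 2 * \<bar>R0\<bar> + 1"
  have R: "1 \<le> R" "\<And>x y. \<lbrakk>x \<in> ?D; y \<in> ?D\<rbrakk> \<Longrightarrow> norm (x - y) \<le> R"
  proof -
    show "norm (x - y) \<le> R" if "x \<in> ?D" "y \<in> ?D" for x y
      using norm_triangle_ineq4[of x y] R0[OF that(1)] R0[OF that(2)] by (simp add: R_def)
  qed (simp add: R_def)
  define c where "c = unit_ball_vol (real DIM('a)) * (r0 / R) ^ DIM('a)"
  show thesis
  proof (rule that)
    show "0 < c"
      using r0 R by (simp add: c_def)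
  next
    fix y r assume y: "y \<in> ?D" and r: "(0::real) < r" "r \<le> 1"
    define s where "s = r / R"
    have s: "0 < s" "s \<le> 1" "s * R = r"
      using r R(1) by (auto simp: s_def field_simps)
    have sub: "cball (y + s *\<^sub>R (z - y)) (s * r0) \<subseteq> ?D \<inter> cball y r"
    proof
      fix w assume w: "w \<in> cball (y + s *\<^sub>R (z - y)) (s * r0)"
      define x where "x = y + (w - y) /\<^sub>R s"
      have wx: "w = (1 - s) *\<^sub>R y + s *\<^sub>R x"
        using s by (simp add: x_def algebra_simps)
      have "s *\<^sub>R (x - z) = w - (y + s *\<^sub>R (z - y))"
        using s by (simp add: x_def algebra_simps)
      then have "s * norm (x - z) = norm (w - (y + s *\<^sub>R (z - y)))"
        using s by (metis abs_of_pos norm_scaleR)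
      also have "\<dots> \<le> s * r0"
        using w by (simp add: dist_norm norm_minus_commute)
      finally have "x \<in> cball z r0"
        using s by (simp add: dist_norm norm_minus_commute)
      then have x: "x \<in> ?D"
        using ball by blast
      have "w \<in> ?D"
        unfolding wx using s by (intro convexD[OF D(1) y x]) auto
      moreover have "w - y = s *\<^sub>R (x - y)"
        by (simp add: wx algebra_simps)
      then have "norm (w - y) \<le> s * R"
        using mult_left_mono[OF R(2)[OF x y], of s] s by simp
      ultimately show "w \<in> ?D \<inter> cball y r"
        using s(3) by (simp add: dist_norm norm_minus_commute)
    qed
    have "c * r ^ DIM('a) = unit_ball_vol (real DIM('a)) * (s * r0) ^ DIM('a)"
      by (simp add: c_def s_def power_mult_distrib power_divide)
    also have "\<dots> = measure lborel (cball (y + s *\<^sub>R (z - y)) (s * r0))"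
      using s r0 content_cball[of "s * r0" "y + s *\<^sub>R (z - y)"] by simp
    also have "\<dots> \<le> measure lborel (?D \<inter> cball y r)"
      using sub D(3) by (intro measure_mono_fmeasurable) (auto intro!: fmeasurable_compact compact_Int_closed)
    finally show "c * r ^ DIM('a) \<le> measure lborel (?D \<inter> cball y r)" .
  qed
qed

text \<open>A maximal set of points with mutual distances greater than \<open>r\<close> is an
  \<open>r\<close>-net, and the balls of radius \<open>r / 3\<close> around its points are
  disjoint, so their volumes bound its cardinality.\<close>

lemma finite_net_card_bound:
  fixes D :: "'a::euclidean_space set"
  assumes D: "compact D" and c: "0 < c"
    and vol: "\<And>y r. \<lbrakk>y \<in> D; 0 < r; r \<le> 1\<rbrakk> \<Longrightarrow> c * r ^ DIM('a) \<le> measure lborel (D \<inter> cball y r)"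
  shows "\<exists>K\<ge>0. \<forall>r. 0 < r \<and> r \<le> 1 \<longrightarrow>
    (\<exists>Y\<subseteq>D. finite Y \<and> real (card Y) * r ^ DIM('a) \<le> K \<and> (\<forall>x\<in>D. \<exists>y\<in>Y. dist x y \<le> r))"
proof -
  define K where "K = measure lborel D * 3 ^ DIM('a) / c"
  have Dm: "D \<in> fmeasurable lborel"
    using D by (rule fmeasurable_compact)
  have "\<exists>Y\<subseteq>D. finite Y \<and> real (card Y) * r ^ DIM('a) \<le> K \<and> (\<forall>x\<in>D. \<exists>y\<in>Y. dist x y \<le> r)"
    if r: "0 < r" "r \<le> 1" for r
  proof -
    define P where "P Y \<longleftrightarrow> finite Y \<and> Y \<subseteq> D \<and> (\<forall>x\<in>Y. \<forall>y\<in>Y. x \<noteq> y \<longrightarrow> r < dist x y)" for Y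
    have card: "real (card Y) * r ^ DIM('a) \<le> K" if "P Y" for Y
    proof -
      have Y: "finite Y" "Y \<subseteq> D" and sep: "\<And>x y. \<lbrakk>x \<in> Y; y \<in> Y; x \<noteq> y\<rbrakk> \<Longrightarrow> r < dist x y"
        using that by (auto simp: P_def)
      have m: "D \<inter> cball y (r / 3) \<in> fmeasurable lborel" for y
        using D by (intro fmeasurable_compact compact_Int_closed) auto
      have disj: "disjoint_family_on (\<lambda>y. D \<inter> cball y (r / 3)) Y"
        unfolding disjoint_family_on_def
      proof (intro ballI impI)
        fix x y assume xy: "x \<in> Y" "y \<in> Y" "x \<noteq> y"
        show "(D \<inter> cball x (r / 3)) \<inter> (D \<inter> cball y (r / 3)) = {}"
        proof (rule ccontr)
          assume "\<not> ?thesis"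
          then obtain w where "dist x w \<le> r / 3" "dist y w \<le> r / 3"
            by auto
          moreover have "dist x y \<le> dist x w + dist y w"
            by (rule dist_triangle2)
          ultimately have "3 * dist x y \<le> 2 * r"
            by simp
          then show False
            using sep[OF xy] r by simp
        qed
      qed
      have "real (card Y) * (c * (r / 3) ^ DIM('a)) = (\<Sum>y\<in>Y. c * (r / 3) ^ DIM('a))"
        by simp
      also have "\<dots> \<le> (\<Sum>y\<in>Y. measure lborel (D \<inter> cball y (r / 3)))"
        using Y r by (intro sum_mono vol) auto
      also have "\<dots> = measure lborel (\<Union>y\<in>Y. D \<inter> cball y (r / 3))"
        using m by (intro measure_finite_Union[symmetric] Y disj) (auto simp: fmeasurable_def less_top)
      also have "\<dots> \<le> measure lborel D"
      proof (rule measure_mono_fmeasurable[OF _ _ Dm])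
        show "(\<Union>y\<in>Y. D \<inter> cball y (r / 3)) \<in> sets lborel"
          by (intro sets.finite_UN Y(1) fmeasurableD[OF m])
      qed auto
      finally show ?thesis
        using c by (simp add: K_def power_divide field_simps)
    qed
    have "P {}"
      by (simp add: P_def)
    moreover have "\<forall>Y. P Y \<longrightarrow> card Y < Suc (nat \<lfloor>K / r ^ DIM('a)\<rfloor>)"
    proof (intro allI impI)
      fix Y assume "P Y"
      then have "real (card Y) \<le> K / r ^ DIM('a)"
        using card r by (simp add: pos_le_divide_eq)
      then show "card Y < Suc (nat \<lfloor>K / r ^ DIM('a)\<rfloor>)"
        by linarith
    qed
    ultimately obtain Y where Y: "P Y" "\<And>Y'. P Y' \<Longrightarrow> card Y' \<le> card Y"
      using ex_has_greatest_nat[of P "{}" card] by blast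
    have "\<exists>y\<in>Y. dist x y \<le> r" if x: "x \<in> D" for x
    proof (rule ccontr)
      assume far: "\<not> ?thesis"
      then have "x \<notin> Y"
        using r by auto
      moreover have "P (insert x Y)"
        using Y(1) x far by (auto simp: P_def dist_commute not_le)
      ultimately show False
        using Y(2)[of "insert x Y"] Y(1) by (simp add: P_def)
    qed
    then show ?thesis
      using Y(1) card[OF Y(1)] by (intro exI[of _ Y]) (auto simp: P_def)
  qed
  moreover have "0 \<le> K"
    using c by (simp add: K_def)
  ultimately show ?thesis
    by blast
qed

lemma (in prob_space) density_hit_prob:
  assumes X: "distributed M (restrict_space lborel D) X (\<lambda>x. ennreal (\<rho> x))"
    and \<rho>: "\<And>x. x \<in> D \<Longrightarrow> c0 \<le> \<rho> x" and c0: "0 \<le> c0" and D: "D \<in> sets borel" and A: "A \<in> sets borel"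
    and fin: "emeasure lborel (D \<inter> A) < \<infinity>"
  shows "c0 * measure lborel (D \<inter> A) \<le> prob (X -` A \<inter> space M)"
proof -
  have DA: "D \<inter> A \<in> sets (restrict_space lborel D)"
    using D A by (simp add: sets_restrict_space_iff)
  have [measurable]: "X \<in> measurable M (restrict_space lborel D)"
    using X by (rule distributed_measurable)
  have "X \<omega> \<in> D" if "\<omega> \<in> space M" for \<omega>
    using measurable_space[OF distributed_measurable[OF X] that] by (simp add: space_restrict_space)
  then have eq: "X -` A \<inter> space M = X -` (D \<inter> A) \<inter> space M"
    by auto
  have "ennreal (c0 * measure lborel (D \<inter> A)) = ennreal c0 * emeasure lborel (D \<inter> A)"
    using fin c0 by (simp add: emeasure_eq_ennreal_measure ennreal_mult less_top)
  also have "\<dots> = ennreal c0 * emeasure (restrict_space lborel D) (D \<inter> A)"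
    using D by (simp add: emeasure_restrict_space)
  also have "\<dots> = (\<integral>\<^sup>+x. ennreal c0 * indicator (D \<inter> A) x \<partial>restrict_space lborel D)"
    using DA by (simp add: nn_integral_cmult_indicator)
  also have "\<dots> \<le> (\<integral>\<^sup>+x. ennreal (\<rho> x) * indicator (D \<inter> A) x \<partial>restrict_space lborel D)"
    using \<rho> by (intro nn_integral_mono) (auto simp: space_restrict_space indicator_def intro!: ennreal_leI)
  also have "\<dots> = emeasure M (X -` (D \<inter> A) \<inter> space M)"
    by (rule distributed_emeasure[OF X DA, symmetric])
  also have "\<dots> = ennreal (prob (X -` A \<inter> space M))"
    by (simp add: eq emeasure_eq_measure)
  finally show ?thesis
    by (simp add: ennreal_le_iff)
qed

text \<open>By independence the probability is a product of \<open>n\<close> factors, each of the form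
  \<open>1 - q \<le> exp (- q)\<close> with \<open>q\<close> at least \<open>c0\<close> times the
  volume.\<close>

lemma (in prob_space) all_miss_prob:
  assumes indep: "indep_vars (\<lambda>_. restrict_space lborel D) X {1..}"
    and law: "\<And>i. 1 \<le> i \<Longrightarrow> distributed M (restrict_space lborel D) (X i) (\<lambda>x. ennreal (\<rho> x))"
    and \<rho>: "\<And>x. x \<in> D \<Longrightarrow> c0 \<le> \<rho> x" and c0: "0 \<le> c0" and D: "D \<in> sets borel" and A: "A \<in> sets borel"
    and fin: "emeasure lborel (D \<inter> A) < \<infinity>" and n: "1 \<le> (n::nat)"
  defines "B \<equiv> (\<Inter>i\<in>{1..n}. X i -` (D - A) \<inter> space M)"
  shows "B \<in> events" and "prob B \<le> exp (- (real n * (c0 * measure lborel (D \<inter> A))))"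
proof -
  have DA: "D - A \<in> sets (restrict_space lborel D)"
    using D A by (simp add: sets_restrict_space_iff)
  have meas: "X i \<in> measurable M (restrict_space lborel D)" if "1 \<le> i" for i
    using law[OF that] by (rule distributed_measurable)
  have ev: "X i -` (D - A) \<inter> space M \<in> events" if "1 \<le> i" for i
    using measurable_sets[OF meas[OF that] DA] .
  then show "B \<in> events"
    unfolding B_def using n by (intro sets.finite_INT) auto
  have each: "prob (X i -` (D - A) \<inter> space M) \<le> 1 - c0 * measure lborel (D \<inter> A)" if i: "1 \<le> i" for i
  proof -
    have "X i \<omega> \<in> D" if "\<omega> \<in> space M" for \<omega>
      using measurable_space[OF meas[OF i] that] by (simp add: space_restrict_space)
    then have eq: "X i -` (D - A) \<inter> space M = space M - X i -` A \<inter> space M"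
      "X i -` A \<inter> space M = X i -` (D \<inter> A) \<inter> space M"
      by auto
    have "D \<inter> A \<in> sets (restrict_space lborel D)"
      using D A by (simp add: sets_restrict_space_iff)
    then have "X i -` A \<inter> space M \<in> events"
      unfolding eq(2) using measurable_sets[OF meas[OF i]] by blast
    then have "prob (X i -` (D - A) \<inter> space M) = 1 - prob (X i -` A \<inter> space M)"
      unfolding eq(1) by (rule prob_compl)
    then show ?thesis
      using density_hit_prob[OF law[OF i] \<rho> c0 D A fin] by simp
  qed
  have "prob B = (\<Prod>i\<in>{1..n}. prob (X i -` (D - A) \<inter> space M))"
    unfolding B_def by (rule indep_varsD[OF indep]) (use n DA in auto)
  also have "\<dots> \<le> (\<Prod>i\<in>{1..n}. exp (- (c0 * measure lborel (D \<inter> A))))"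
  proof (rule prod_mono)
    fix i assume "i \<in> {1..n}"
    then have "prob (X i -` (D - A) \<inter> space M) \<le> 1 - c0 * measure lborel (D \<inter> A)"
      by (intro each) auto
    also have "\<dots> \<le> exp (- (c0 * measure lborel (D \<inter> A)))"
      using exp_ge_add_one_self[of "- (c0 * measure lborel (D \<inter> A))"] by simp
    finally show "0 \<le> prob (X i -` (D - A) \<inter> space M) \<and>
        prob (X i -` (D - A) \<inter> space M) \<le> exp (- (c0 * measure lborel (D \<inter> A)))"
      by simp
  qed
  also have "\<dots> = exp (- (real n * (c0 * measure lborel (D \<inter> A))))"
    by (simp add: exp_of_nat_mult[symmetric])
  finally show "prob B \<le> exp (- (real n * (c0 * measure lborel (D \<inter> A))))" .
qed

text \<open>If some point of \<open>D\<close> is farther than \<open>\<kappa> * \<epsilon> n = 2 * r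
  n\<close> from the sample, then the sample misses a ball of radius \<open>r n\<close> around a
  point of an \<open>r n\<close>-net. The probabilities of these events are summable in
  \<open>n\<close>, and the Borel-Cantelli lemma applies.\<close>

lemma (in prob_space) sample_eventually_dense:
  fixes D U :: "'b::euclidean_space set"
  assumes U: "open U" "U \<noteq> {}" "bounded U" "convex U" "D = closure U"
    and indep: "indep_vars (\<lambda>_. restrict_space lborel D) X {1..}"
    and law: "\<And>i. 1 \<le> i \<Longrightarrow> distributed M (restrict_space lborel D) (X i) (\<lambda>x. ennreal (\<rho> x))"
    and \<rho>: "\<And>x. x \<in> D \<Longrightarrow> c0 \<le> \<rho> x" and c0: "0 < c0"
    and eps_pos: "\<And>n. 0 < \<epsilon> n" and eps_lim: "\<epsilon> \<longlonglongrightarrow> 0"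
    and rate: "limsup (\<lambda>n. ereal (ln (real n) powr (1 / real DIM('b))
                      / real n powr (1 / real DIM('b)) * (1 / \<epsilon> n))) = 0"
    and \<kappa>: "0 < \<kappa>"
  shows "AE \<omega> in M. \<forall>\<^sub>F n in sequentially. \<forall>y\<in>D. \<exists>i\<in>{1..n}. norm (X i \<omega> - y) \<le> \<kappa> * \<epsilon> n"
proof -
  let ?d = "DIM('b)"
  have D: "compact D" "D \<in> sets borel"
    using U by (auto simp: compact_closure)
  obtain c where c: "0 < c"
    and vol: "\<And>y r. \<lbrakk>y \<in> D; 0 < r; r \<le> 1\<rbrakk> \<Longrightarrow> c * r ^ ?d \<le> measure lborel (D \<inter> cball y r)"
    using convex_body_volume_lower_bound[OF U(1-4)] unfolding U(5)[symmetric] by metis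
  have "\<exists>K\<ge>0. \<forall>r. 0 < r \<and> r \<le> 1 \<longrightarrow>
      (\<exists>Y\<subseteq>D. finite Y \<and> real (card Y) * r ^ ?d \<le> K \<and> (\<forall>x\<in>D. \<exists>y\<in>Y. dist x y \<le> r))"
    by (rule finite_net_card_bound[OF D(1) c]) (rule vol)
  then obtain K where K: "0 \<le> K"
    and net: "\<And>r. \<lbrakk>0 < r; r \<le> 1\<rbrakk> \<Longrightarrow>
      \<exists>Y\<subseteq>D. finite Y \<and> real (card Y) * r ^ ?d \<le> K \<and> (\<forall>x\<in>D. \<exists>y\<in>Y. dist x y \<le> r)"
    by blast
  define r where "r n = \<kappa> * \<epsilon> n / 2" for n
  have r_pos: "0 < r n" for n
    using \<kappa> eps_pos by (simp add: r_def)
  define q where "q = c0 * c"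
  have q: "0 < q"
    using c0 c by (simp add: q_def)
  have "r \<longlonglongrightarrow> \<kappa> * 0 / 2"
    unfolding r_def by (intro tendsto_intros eps_lim) simp
  then have r_small: "\<forall>\<^sub>F n in sequentially. r n \<le> 1"
    using order_tendstoD(2)[of r 0 sequentially 1] by (auto elim: eventually_mono)
  \<comment> \<open>With the threshold \<open>e\<close> chosen below, \<open>rate\<close> becomes this bound, by which each ball of radius \<open>r n\<close>
    is missed with probability at most \<open>n\<close> to the power \<open>-3\<close> and \<open>O(n)\<close> such balls cover \<open>D\<close>.\<close>
  have hits: "\<forall>\<^sub>F n in sequentially. 3 * ln (real n) \<le> real n * (q * r n ^ ?d)"
  proof -
    define e where "e = (q / 3) powr (1 / real ?d) * (\<kappa> / 2)"
    have e: "0 < e"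
      using q \<kappa> by (simp add: e_def)
    have root: "(x powr (1 / real ?d)) ^ ?d = x" if "0 < x" for x :: real
      using that by (simp add: powr_realpow[symmetric] powr_powr)
    have "\<forall>\<^sub>F n in sequentially. ereal (ln (real n) powr (1 / real ?d) / real n powr (1 / real ?d) * (1 / \<epsilon> n)) < ereal e"
      by (rule Limsup_lessD) (use rate e in simp)
    moreover have "\<forall>\<^sub>F n in sequentially. 3 \<le> n"
      by (rule eventually_ge_at_top)
    ultimately show ?thesis
    proof eventually_elim
      case (elim n)
      have n: "0 < real n" "0 < ln (real n)"
        using elim(2) by auto
      have "ln (real n) powr (1 / real ?d) < e * \<epsilon> n * real n powr (1 / real ?d)"
        using elim(1) n eps_pos[of n] by (simp add: field_simps)
      also have "e * \<epsilon> n = (q / 3) powr (1 / real ?d) * r n"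
        by (simp add: e_def r_def)
      finally have "(ln (real n) powr (1 / real ?d)) ^ ?d
          \<le> ((q / 3) powr (1 / real ?d) * r n * real n powr (1 / real ?d)) ^ ?d"
        by (intro power_mono) auto
      then have "ln (real n) \<le> q / 3 * r n ^ ?d * real n"
        using n q by (simp add: power_mult_distrib root)
      then show ?case
        by (simp add: field_simps)
    qed
  qed
  have "\<forall>n. \<exists>Y. r n \<le> 1 \<longrightarrow> Y \<subseteq> D \<and> finite Y \<and> real (card Y) * r n ^ ?d \<le> K \<and> (\<forall>x\<in>D. \<exists>y\<in>Y. dist x y \<le> r n)"
    using net[OF r_pos] by meson
  then obtain Y where Y: "\<And>n. r n \<le> 1 \<Longrightarrow> Y n \<subseteq> D \<and> finite (Y n) \<and>
      real (card (Y n)) * r n ^ ?d \<le> K \<and> (\<forall>x\<in>D. \<exists>y\<in>Y n. dist x y \<le> r n)"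
    by metis
  define B where "B n y = (\<Inter>i\<in>{1..n}. X i -` (D - cball y (r n)) \<inter> space M)" for n y
  define bad where "bad n = (if r n \<le> 1 \<and> 1 \<le> n then \<Union>y\<in>Y n. B n y else {})" for n
  have fin: "emeasure lborel (D \<inter> cball y s) < \<infinity>" for y s
    using fmeasurable_compact[OF compact_Int_closed[OF D(1) closed_cball]] by (auto simp: fmeasurable_def)
  have B_ev: "B n y \<in> events"
    and B_prob: "prob (B n y) \<le> exp (- (real n * (c0 * measure lborel (D \<inter> cball y (r n)))))"
    if n: "1 \<le> n" for n y
  proof -
    note miss = all_miss_prob[OF indep _ _ less_imp_le[OF c0] D(2) _ fin n, where \<rho>=\<rho>]
    show "B n y \<in> events"
      unfolding B_def by (rule miss(1)) (use law \<rho> in auto)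
    show "prob (B n y) \<le> exp (- (real n * (c0 * measure lborel (D \<inter> cball y (r n)))))"
      unfolding B_def by (rule miss(2)) (use law \<rho> in auto)
  qed
  have bad_ev: "bad n \<in> events" for n
    unfolding bad_def using Y B_ev by (auto intro!: sets.finite_UN)
  have bad_prob: "\<forall>\<^sub>F n in sequentially. prob (bad n) \<le> K * q / 3 * inverse (real n ^ 2)"
    using r_small hits eventually_ge_at_top[of 3]
  proof eventually_elim
    case (elim n)
    have n: "1 \<le> n" "0 < real n" "1 \<le> ln (real n)"
    proof -
      have "exp (1::real) \<le> 3"
        by (rule exp_le)
      then have "exp 1 \<le> real n"
        using elim(3) by simp
      then show "1 \<le> ln (real n)"
        using elim(3) by (simp add: ln_ge_iff)
    qed (use elim(3) in auto)
    note Yn = Y[OF elim(1)]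
    have "prob (B n y) \<le> exp (- (3 * ln (real n)))" if y: "y \<in> Y n" for y
    proof -
      have "prob (B n y) \<le> exp (- (real n * (c0 * measure lborel (D \<inter> cball y (r n)))))"
        by (rule B_prob[OF n(1)])
      also have "\<dots> \<le> exp (- (3 * ln (real n)))"
      proof -
        have "c * r n ^ ?d \<le> measure lborel (D \<inter> cball y (r n))"
          using y Yn elim(1) r_pos by (intro vol) auto
        then have "real n * (c0 * (c * r n ^ ?d)) \<le> real n * (c0 * measure lborel (D \<inter> cball y (r n)))"
          using c0 by (intro mult_left_mono) auto
        then show ?thesis
          using elim(2) by (simp add: q_def mult.assoc)
      qed
      finally show ?thesis .
    qed
    then have sum_le: "(\<Sum>y\<in>Y n. prob (B n y)) \<le> real (card (Y n)) * exp (- (3 * ln (real n)))"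
      using sum_bounded_above[of "Y n" "\<lambda>y. prob (B n y)" "exp (- (3 * ln (real n)))"] by simp
    have bad_le: "prob (bad n) \<le> (\<Sum>y\<in>Y n. prob (B n y))"
      using Yn B_ev[OF n(1)] n(1) elim(1) unfolding bad_def
      by (auto intro!: finite_measure_subadditive_finite)
    have exp_eq: "exp (- (3 * ln (real n))) = inverse (real n ^ 3)"
    proof -
      have "exp (3 * ln (real n)) = exp (ln (real n)) ^ 3"
        using exp_of_nat_mult[of 3 "ln (real n)"] by simp
      then show ?thesis
        using n by (simp add: exp_minus)
    qed
    have "real (card (Y n)) \<le> K * q / 3 * real n"
    proof -
      have "3 \<le> real n * (q * r n ^ ?d)"
        using elim(2) n(3) by linarith
      then have "real (card (Y n)) * 3 \<le> real (card (Y n)) * (real n * (q * r n ^ ?d))"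
        by (intro mult_left_mono) auto
      also have "\<dots> = (real (card (Y n)) * r n ^ ?d) * (real n * q)"
        by simp
      also have "\<dots> \<le> K * (real n * q)"
        using Yn q by (intro mult_right_mono) auto
      finally show ?thesis
        by (simp add: mult.commute mult.left_commute)
    qed
    then have card_le: "real (card (Y n)) * inverse (real n ^ 3) \<le> K * q / 3 * real n * inverse (real n ^ 3)"
      by (intro mult_right_mono) auto
    have cube: "K * q / 3 * real n * inverse (real n ^ 3) = K * q / 3 * inverse (real n ^ 2)"
      using n by (simp add: power2_eq_square power3_eq_cube field_simps)
    show ?case
      using order_trans[OF bad_le sum_le] card_le unfolding exp_eq cube by (rule order_trans)
  qed
  have "summable (\<lambda>n. K * q / 3 * inverse (real n ^ 2))"
    by (intro summable_mult inverse_power_summable) simp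
  then have "summable (\<lambda>n. prob (bad n))"
    by (rule summable_comparison_test_ev[rotated]) (use bad_prob in \<open>auto elim: eventually_mono\<close>)
  then have "AE \<omega> in M. \<forall>\<^sub>F n in sequentially. \<omega> \<in> space M - bad n"
    using bad_ev by (intro borel_cantelli_AE1) (auto simp: less_top[symmetric])
  then show ?thesis
  proof (rule AE_mp, intro AE_I2 impI)
    fix \<omega> assume \<omega>: "\<omega> \<in> space M" and ev: "\<forall>\<^sub>F n in sequentially. \<omega> \<in> space M - bad n"
    show "\<forall>\<^sub>F n in sequentially. \<forall>y\<in>D. \<exists>i\<in>{1..n}. norm (X i \<omega> - y) \<le> \<kappa> * \<epsilon> n"
      using ev r_small eventually_ge_at_top[of 1]
    proof eventually_elim
      case (elim n)
      show ?case
      proof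
        fix y assume "y \<in> D"
        then obtain y' where y': "y' \<in> Y n" "dist y y' \<le> r n"
          using Y[OF elim(2)] by blast
        then have "\<omega> \<notin> B n y'"
          using elim by (auto simp: bad_def)
        have "\<exists>i\<in>{1..n}. \<not> X i \<omega> \<in> D - cball y' (r n)"
        proof (rule ccontr)
          assume "\<not> ?thesis"
          then have "\<omega> \<in> B n y'"
            unfolding B_def by (intro INT_I) (use \<omega> in auto)
          with \<open>\<omega> \<notin> B n y'\<close> show False ..
        qed
        then obtain i where i: "i \<in> {1..n}" "\<not> X i \<omega> \<in> D - cball y' (r n)"
          by blast
        have "X i \<omega> \<in> D"
          using measurable_space[OF distributed_measurable[OF law] \<omega>, of i] i by (simp add: space_restrict_space)
        then have "dist y' (X i \<omega>) \<le> r n"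
          using i by simp
        then have "norm (X i \<omega> - y) \<le> r n + r n"
          using dist_triangle[of y "X i \<omega>" y'] y'(2) by (simp add: dist_norm norm_minus_commute)
        then show "\<exists>i\<in>{1..n}. norm (X i \<omega> - y) \<le> \<kappa> * \<epsilon> n"
          using i(1) by (intro bexI[of _ i]) (simp add: r_def)
      qed
    qed
  qed
qed

section \<open>Convergence of discrete minimizers\<close>

lemma LIMSEQ_zero_subsequence_principle:
  fixes u :: "nat \<Rightarrow> real"
  assumes "\<And>r :: nat \<Rightarrow> nat. strict_mono r \<Longrightarrow> \<exists>s :: nat \<Rightarrow> nat. (\<lambda>k. u (r (s k))) \<longlonglongrightarrow> 0"
  shows "u \<longlonglongrightarrow> 0"
proof (rule ccontr)
  assume "\<not> u \<longlonglongrightarrow> 0"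
  then obtain e where e: "0 < e" "\<not> (\<forall>\<^sub>F n in sequentially. dist (u n) 0 < e)"
    unfolding tendsto_iff by blast
  define S where "S = {n. \<not> dist (u n) 0 < e}"
  have "infinite S"
    using e(2) by (simp add: S_def eventually_cofinite[symmetric] cofinite_eq_sequentially)
  then have "strict_mono (enumerate S)" and S: "enumerate S k \<in> S" for k
    by (auto simp: strict_mono_enumerate enumerate_in_set)
  then obtain s where "(\<lambda>k. u (enumerate S (s k))) \<longlonglongrightarrow> 0"
    using assms by blast
  then have "\<forall>\<^sub>F k in sequentially. dist (u (enumerate S (s k))) 0 < e"
    using e(1) by (rule tendstoD)
  moreover have "\<not> dist (u (enumerate S (s k))) 0 < e" for k
    using S[of "s k"] by (simp add: S_def)
  ultimately show False
    by (simp add: eventually_False)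
qed

lemma path_image_reparametrization:
  assumes "reparametrization_of \<eta> \<gamma>"
  shows "path_image \<eta> = path_image \<gamma>"
proof -
  obtain s C where s: "C-lipschitz_on {0..1::real} s" "s ` {0..1} \<subseteq> {0..1::real}" "s 0 = 0" "s 1 = 1"
    and eq: "\<And>t. t \<in> {0..1} \<Longrightarrow> \<eta> t = \<gamma> (s t)"
    using assms unfolding reparametrization_of_def by blast
  have "connected (s ` {0..1})"
    by (intro connected_continuous_image lipschitz_on_continuous_on[OF s(1)]) simp
  moreover have "0 \<in> s ` {0..1}" "1 \<in> s ` {0..1}"
    using s(3,4) by force+
  ultimately have "{0..1} \<subseteq> s ` {0..1}"
    by (rule connected_contains_Icc)
  then have "s ` {0..1} = {0..1}"
    using s(2) by blast
  then have "path_image \<gamma> = \<gamma> ` s ` {0..1}"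
    by (simp add: path_image_def)
  also have "\<dots> = path_image \<eta>"
    unfolding path_image_def image_image using eq by (intro image_cong) auto
  finally show ?thesis
    by simp
qed

context geodesic_cost
begin

lemma discrete_path_pieces:
  assumes "vs \<in> discrete_paths V e a b" "V \<subseteq> D"
  shows "0 < length vs - 1" "\<And>i. i < length vs - 1 \<Longrightarrow> vs ! i \<in> D \<and> vs ! Suc i \<in> D"
proof -
  show "0 < length vs - 1"
    using assms(1) by (auto simp: discrete_paths_def)
  have "set vs \<subseteq> D"
    using assms by (auto simp: discrete_paths_def)
  moreover have "vs ! i \<in> set vs \<and> vs ! Suc i \<in> set vs" if "i < length vs - 1" for i
    using that by simp
  ultimately show "\<And>i. i < length vs - 1 \<Longrightarrow> vs ! i \<in> D \<and> vs ! Suc i \<in> D"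
    by blast
qed

lemma path_cost_concat_geo:
  assumes "vs \<in> discrete_paths V e a b" "V \<subseteq> D"
  shows "path_cost f (concat_path geo vs) = energy vs"
proof -
  note pieces = discrete_path_pieces[OF assms]
  have "path_cost f (concat_path geo vs)
      = real (length vs - 1) powr (p - 1) * adjacent_sum (\<lambda>u v. path_cost f (geo u v)) vs"
  proof (rule path_cost_concat_path[OF pieces(1)])
    fix i assume "i < length vs - 1"
    then have D: "vs ! i \<in> D" "vs ! Suc i \<in> D"
      using pieces(2) by auto
    show "geo (vs ! i) (vs ! Suc i) \<in> lipschitz_paths D (vs ! i) (vs ! Suc i)"
      using geo[OF D] by blast
    then show "((\<lambda>t. f (geo (vs ! i) (vs ! Suc i) t) (velocity (geo (vs ! i) (vs ! Suc i)) t))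
        has_integral path_cost f (geo (vs ! i) (vs ! Suc i))) {0..1}"
      using geo[OF D] by (intro quasinormal_constant(2)) auto
  qed
  also have "\<dots> = energy vs"
    unfolding energy_def adjacent_sum_def using pieces(2) geo by (intro arg_cong2[where f="(*)"] sum.cong) auto
  finally show ?thesis .
qed

lemma path_cost_concat_linepath:
  assumes "vs \<in> discrete_paths V e a b" "V \<subseteq> D"
  shows "path_cost f (concat_path linepath vs) = line_energy vs"
  unfolding line_energy_def
  using discrete_path_pieces[OF assms]
  by (intro path_cost_concat_path linepath_lipschitz_path linepath_cost_has_integral) auto

lemma energy_le_line_energy:
  assumes "vs \<in> discrete_paths V e a b" "V \<subseteq> D"
  shows "energy vs \<le> line_energy vs"
  unfolding energy_def line_energy_def adjacent_sum_def
  using discrete_path_pieces[OF assms]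
  by (intro mult_left_mono sum_mono cost_dist_le_linepath) auto

text \<open>In both problems the energy is at most the minimal value, and the cost of the polygonal
  path through \<open>ws\<close> is at least that value: concatenated geodesics cost no more than
  segments.\<close>

lemma argmin_energy_le:
  assumes V: "V \<subseteq> D" and ws: "ws \<in> discrete_paths V e a b" and vs: "vs \<in> discrete_paths V e a b"
    and min: "concat_path geo vs \<in> argmin_on (path_cost f) (concat_path geo ` discrete_paths V e a b) \<or>
      concat_path linepath vs \<in> argmin_on (path_cost f) (concat_path linepath ` discrete_paths V e a b)"
  shows "energy vs \<le> line_energy ws"
  using min
proof
  assume "concat_path geo vs \<in> argmin_on (path_cost f) (concat_path geo ` discrete_paths V e a b)"
  then have "path_cost f (concat_path geo vs) \<le> path_cost f (concat_path geo ws)"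
    using ws by (auto simp: argmin_on_def is_arg_min_def not_less)
  then have "energy vs \<le> energy ws"
    by (simp add: path_cost_concat_geo[OF vs V] path_cost_concat_geo[OF ws V])
  also have "\<dots> \<le> line_energy ws"
    by (rule energy_le_line_energy[OF ws V])
  finally show ?thesis .
next
  assume "concat_path linepath vs \<in> argmin_on (path_cost f) (concat_path linepath ` discrete_paths V e a b)"
  then have "path_cost f (concat_path linepath vs) \<le> path_cost f (concat_path linepath ws)"
    using ws by (auto simp: argmin_on_def is_arg_min_def not_less)
  then have "line_energy vs \<le> line_energy ws"
    by (simp add: path_cost_concat_linepath[OF vs V] path_cost_concat_linepath[OF ws V])
  with energy_le_line_energy[OF vs V] show ?thesis
    by linarith
qed

lemma recovery_eventually:
  fixes V :: "nat \<Rightarrow> 'a set" and \<epsilon> :: "nat \<Rightarrow> real"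
  assumes ab: "a \<in> D" "b \<in> D" and z: "z \<in> D" "z \<noteq> a"
    and V: "\<And>n. V n \<subseteq> D" "\<And>n. a \<in> V n" "\<And>n. b \<in> V n"
    and eps: "\<And>n. 0 < \<epsilon> n" "\<epsilon> \<longlonglongrightarrow> 0"
    and dense: "\<And>\<kappa>. 0 < \<kappa> \<Longrightarrow> \<forall>\<^sub>F n in sequentially. \<forall>y\<in>D. \<exists>x\<in>V n. norm (x - y) \<le> \<kappa> * \<epsilon> n"
    and \<eta>: "0 < \<eta>"
  shows "\<forall>\<^sub>F n in sequentially. \<exists>vs\<in>discrete_paths (V n) (\<epsilon> n) a b. line_energy vs \<le> cost_dist f D a b + \<eta>"
proof -
  have "approximable a b \<eta>"
    using approximable_distinct_ends[OF ab _ \<eta>] approximable_equal_ends[OF ab(1) z \<eta>]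
    by (cases "a = b") auto
  then obtain \<kappa> e0 where \<kappa>: "0 < \<kappa>" and e0: "0 < e0"
    and rec: "\<forall>e V. 0 < e \<and> e < e0 \<and> V \<subseteq> D \<and> a \<in> V \<and> b \<in> V \<and>
      (\<forall>y\<in>D. \<exists>x\<in>V. norm (x - y) \<le> \<kappa> * e) \<longrightarrow>
      (\<exists>vs\<in>discrete_paths V e a b. line_energy vs \<le> cost_dist f D a b + \<eta>)"
    unfolding approximable_def by (elim exE conjE)
  have "\<forall>\<^sub>F n in sequentially. \<epsilon> n < e0"
    using order_tendstoD(2)[OF eps(2) e0] .
  with dense[OF \<kappa>] show ?thesis
  proof eventually_elim
    case (elim n)
    then show ?case
      using rec[rule_format, of "\<epsilon> n" "V n"] eps(1) V by blast
  qed
qed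

lemma minimizer_subsequence:
  fixes V :: "nat \<Rightarrow> 'a set" and \<epsilon> :: "nat \<Rightarrow> real" and vs :: "nat \<Rightarrow> 'a list"
  assumes ab: "a \<in> D" "b \<in> D" and V: "\<And>n. V n \<subseteq> D" and eps: "\<epsilon> \<longlonglongrightarrow> 0"
    and vs: "\<forall>\<^sub>F n in sequentially. vs n \<in> discrete_paths (V n) (\<epsilon> n) a b"
    and opt: "\<And>\<eta>. 0 < \<eta> \<Longrightarrow> \<forall>\<^sub>F n in sequentially. energy (vs n) \<le> cost_dist f D a b + \<eta>"
    and r: "strict_mono (r :: nat \<Rightarrow> nat)"
  shows "\<exists>(s :: nat \<Rightarrow> nat) \<gamma>. strict_mono s \<and>
          \<gamma> \<in> argmin_on (path_cost f) (lipschitz_paths D a b) \<and>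
          (\<lambda>k. hausdorff_dist (set (vs (r (s k)))) (path_image \<gamma>)) \<longlonglongrightarrow> 0"
proof -
  have "\<forall>\<^sub>F n in sequentially. vs n \<in> discrete_paths (V n) (\<epsilon> n) a b \<and> energy (vs n) \<le> cost_dist f D a b + 1"
    using vs opt[of 1] by (simp add: eventually_conj)
  then obtain N where N: "\<And>n. N \<le> n \<Longrightarrow> vs n \<in> discrete_paths (V n) (\<epsilon> n) a b"
    "\<And>n. N \<le> n \<Longrightarrow> energy (vs n) \<le> cost_dist f D a b + 1"
    unfolding eventually_sequentially by blast
  define q where "q k = r (k + N)" for k
  have q: "strict_mono q"
    using r by (auto simp: q_def strict_mono_def)
  have qN: "N \<le> q k" for k
    using seq_suble[OF r, of "k + N"] by (simp add: q_def)
  obtain k \<gamma> where k: "strict_mono (k :: nat \<Rightarrow> nat)" "\<gamma> \<in> argmin_on (path_cost f) (lipschitz_paths D a b)"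
    "(\<lambda>n. hausdorff_dist (set (vs (q (k n)))) (path_image \<gamma>)) \<longlonglongrightarrow> 0"
  proof (rule discrete_paths_compactness[where ws="\<lambda>n. vs (q n)" and V="\<lambda>n. V (q n)" and e="\<lambda>n. \<epsilon> (q n)"])
    show "vs (q n) \<in> discrete_paths (V (q n)) (\<epsilon> (q n)) a b" for n
      by (rule N(1)[OF qN])
    show "(\<lambda>n. \<epsilon> (q n)) \<longlonglongrightarrow> 0"
      using LIMSEQ_subseq_LIMSEQ[OF eps q] by (simp add: o_def)
    show "energy (vs (q n)) \<le> cost_dist f D a b + 1" for n
      by (rule N(2)[OF qN])
    show "\<forall>\<^sub>F n in sequentially. energy (vs (q n)) \<le> cost_dist f D a b + \<eta>" if "0 < \<eta>" for \<eta>
      by (rule eventually_subseq[OF q opt[OF that]])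
  qed (use ab V in auto)
  show ?thesis
  proof (intro exI conjI)
    show "strict_mono (\<lambda>n. k n + N)"
      using k(1) by (simp add: strict_mono_def)
    show "(\<lambda>n. hausdorff_dist (set (vs (r (k n + N)))) (path_image \<gamma>)) \<longlonglongrightarrow> 0"
      using k(3) by (simp add: q_def)
  qed (rule k(2))
qed

end

theorem corollary2p3:
  fixes D U :: "'a::euclidean_space set"
    and f :: "'a \<Rightarrow> 'a \<Rightarrow> real"
    and p m1 m2 c0 :: real
    and a b :: 'a
    and M :: "'w measure"
    and X :: "nat \<Rightarrow> 'w \<Rightarrow> 'a"
    and \<rho> :: "'a \<Rightarrow> real"
    and \<epsilon> :: "nat \<Rightarrow> real"
    and geo :: "'a \<Rightarrow> 'a \<Rightarrow> real \<Rightarrow> 'a"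
  assumes domain: "open U" "U \<noteq> {}" "bounded U" "convex U" "D = closure U"
    and p: "1 \<le> p"
    and nonneg: "\<And>x v. x \<in> D \<Longrightarrow> 0 \<le> f x v"
    and A0: "continuous_on (D \<times> UNIV) (\<lambda>(x, v). f x v)"
      "C1_on (D \<times> (- {0})) (\<lambda>(x, v). f x v)"
    and A1: "\<And>x. x \<in> D \<Longrightarrow> convex_on UNIV (f x)"
    and A2: "\<And>x v c. x \<in> D \<Longrightarrow> 0 < c \<Longrightarrow> f x (c *\<^sub>R v) = c powr p * f x v"
    and A3: "0 < m1" "0 < m2"
      "\<And>x v. x \<in> D \<Longrightarrow> m1 * norm v powr p \<le> f x v \<and> f x v \<le> m2 * norm v powr p"
    and ends: "a \<in> D" "b \<in> D"
    and prob: "prob_space M"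
    and indep: "prob_space.indep_vars M (\<lambda>_. restrict_space lborel D) X {1..}"
    and law: "\<And>i. 1 \<le> i \<Longrightarrow> distributed M (restrict_space lborel D) (X i) (\<lambda>x. ennreal (\<rho> x))"
    and density_bounds: "0 < c0" "\<And>x. x \<in> D \<Longrightarrow> c0 \<le> \<rho> x \<and> \<rho> x \<le> inverse c0"
    and eps_pos: "\<And>n. 0 < \<epsilon> n"
    and eps_lim: "\<epsilon> \<longlonglongrightarrow> 0"
    and eps_rate: "limsup (\<lambda>n. ereal (ln (real n) powr (1 / real DIM('a))
                      / real n powr (1 / real DIM('a)) * (1 / \<epsilon> n))) = 0"
    and geo: "\<And>u v. u \<in> D \<Longrightarrow> v \<in> D \<Longrightarrow>
        geo u v \<in> lipschitz_paths D u v \<and> quasinormal f (geo u v) \<and>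
        path_cost f (geo u v) = cost_dist f D u v"
    and cases: "(2 \<le> DIM('a) \<and> p = 1) \<or> 1 < p"
  shows "AE \<omega> in M. \<forall>vs :: nat \<Rightarrow> 'a list.
    (\<forall>\<^sub>F n in sequentially. vs n \<in> random_paths X \<epsilon> a b n \<omega>) \<and>
    ((\<forall>\<^sub>F n in sequentially. concat_path geo (vs n) \<in>
        argmin_on (path_cost f) (concat_path geo ` random_paths X \<epsilon> a b n \<omega>)) \<or>
     (\<forall>\<^sub>F n in sequentially. concat_path linepath (vs n) \<in>
        argmin_on (path_cost f) (concat_path linepath ` random_paths X \<epsilon> a b n \<omega>))) \<longrightarrow>
    (\<forall>r :: nat \<Rightarrow> nat. strict_mono r \<longrightarrow>
       (\<exists>(s :: nat \<Rightarrow> nat) \<gamma>. strict_mono s \<and>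
          \<gamma> \<in> argmin_on (path_cost f) (lipschitz_paths D a b) \<and>
          (\<lambda>k. hausdorff_dist (set (vs (r (s k)))) (path_image \<gamma>)) \<longlonglongrightarrow> 0)) \<and>
    (\<forall>\<gamma>. \<gamma> \<in> argmin_on (path_cost f) (lipschitz_paths D a b) \<and>
       (\<forall>\<eta>\<in>argmin_on (path_cost f) (lipschitz_paths D a b). reparametrization_of \<eta> \<gamma>) \<longrightarrow>
       (\<lambda>n. hausdorff_dist (set (vs n)) (path_image \<gamma>)) \<longlonglongrightarrow> 0)"
proof -
  interpret prob_space M
    by (rule prob)
  interpret geodesic_cost D f p m1 m2 geo
  proof
    show "compact D" "convex D"
      using domain by (simp_all add: compact_closure convex_closure)
  qed (use p A0(1) A1 A2 A3 geo in auto)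
  obtain z where z: "z \<in> D" "z \<noteq> a"
  proof -
    have "U \<noteq> {a}"
      using domain(1) not_open_singleton by blast
    then obtain z where "z \<in> U" "z \<noteq> a"
      using domain(2) by blast
    then show thesis
      using that closure_subset[of U] domain(5) by blast
  qed
  have "AE \<omega> in M. \<forall>\<^sub>F n in sequentially. \<forall>y\<in>D. \<exists>i\<in>{1..n}. norm (X i \<omega> - y) \<le> 1 / real (Suc k) * \<epsilon> n" for k
    by (rule sample_eventually_dense[OF domain indep _ _ density_bounds(1) eps_pos eps_lim eps_rate,
          where \<rho>=\<rho>]) (use law density_bounds(2) in auto)
  then have "AE \<omega> in M. \<forall>k. \<forall>\<^sub>F n in sequentially. \<forall>y\<in>D. \<exists>i\<in>{1..n}. norm (X i \<omega> - y) \<le> 1 / real (Suc k) * \<epsilon> n"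
    by (subst AE_all_countable) blast
  then show ?thesis
    using AE_space
  proof eventually_elim
    case (elim \<omega>)
    define V where "V n = graph_vertices X a b n \<omega>" for n
    have XD: "X i \<omega> \<in> D" if "1 \<le> i" for i
      using measurable_space[OF distributed_measurable[OF law[OF that]] elim(2)]
      by (simp add: space_restrict_space)
    have V: "V n \<subseteq> D" "a \<in> V n" "b \<in> V n" for n
      using XD ends by (auto simp: V_def graph_vertices_def)
    have paths: "random_paths X \<epsilon> a b n \<omega> = discrete_paths (V n) (\<epsilon> n) a b" for n
      by (simp add: random_paths_def V_def)
    have dense: "\<forall>\<^sub>F n in sequentially. \<forall>y\<in>D. \<exists>x\<in>V n. norm (x - y) \<le> \<kappa> * \<epsilon> n" if \<kappa>: "0 < \<kappa>" for \<kappa>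
    proof -
      obtain k where k: "1 / real (Suc k) < \<kappa>"
        using reals_Archimedean[OF \<kappa>] by (auto simp: inverse_eq_divide)
      have "\<forall>\<^sub>F n in sequentially. \<forall>y\<in>D. \<exists>i\<in>{1..n}. norm (X i \<omega> - y) \<le> 1 / real (Suc k) * \<epsilon> n"
        using elim(1) by blast
      then show ?thesis
      proof eventually_elim
        case (elim n)
        show ?case
        proof
          fix y assume "y \<in> D"
          then obtain i where i: "i \<in> {1..n}" "norm (X i \<omega> - y) \<le> 1 / real (Suc k) * \<epsilon> n"
            using elim by blast
          have "1 / real (Suc k) * \<epsilon> n \<le> \<kappa> * \<epsilon> n"
            using k eps_pos[of n] by (intro mult_right_mono) auto
          then have "norm (X i \<omega> - y) \<le> \<kappa> * \<epsilon> n"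
            using i(2) by linarith
          moreover have "X i \<omega> \<in> V n"
            using i(1) by (auto simp: V_def graph_vertices_def)
          ultimately show "\<exists>x\<in>V n. norm (x - y) \<le> \<kappa> * \<epsilon> n"
            by blast
        qed
      qed
    qed
    have recovery: "\<forall>\<^sub>F n in sequentially.
        \<exists>ws\<in>discrete_paths (V n) (\<epsilon> n) a b. line_energy ws \<le> cost_dist f D a b + \<eta>" if "0 < \<eta>" for \<eta>
      by (rule recovery_eventually[OF ends z V eps_pos eps_lim _ that]) (rule dense)
    show ?case
    proof (intro allI impI, elim conjE)
      fix vs :: "nat \<Rightarrow> 'a list"
      assume vs: "\<forall>\<^sub>F n in sequentially. vs n \<in> random_paths X \<epsilon> a b n \<omega>"
        and min: "(\<forall>\<^sub>F n in sequentially. concat_path geo (vs n) \<in>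
            argmin_on (path_cost f) (concat_path geo ` random_paths X \<epsilon> a b n \<omega>)) \<or>
          (\<forall>\<^sub>F n in sequentially. concat_path linepath (vs n) \<in>
            argmin_on (path_cost f) (concat_path linepath ` random_paths X \<epsilon> a b n \<omega>))"
      have min': "\<forall>\<^sub>F n in sequentially.
          concat_path geo (vs n) \<in> argmin_on (path_cost f) (concat_path geo ` discrete_paths (V n) (\<epsilon> n) a b) \<or>
          concat_path linepath (vs n) \<in> argmin_on (path_cost f) (concat_path linepath ` discrete_paths (V n) (\<epsilon> n) a b)"
        using min unfolding paths by (auto elim: eventually_mono)
      have opt: "\<forall>\<^sub>F n in sequentially. energy (vs n) \<le> cost_dist f D a b + \<eta>" if \<eta>: "0 < \<eta>" for \<eta>
        using recovery[OF \<eta>] vs[unfolded paths] min'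
      proof eventually_elim
        case (elim n)
        then obtain ws where ws: "ws \<in> discrete_paths (V n) (\<epsilon> n) a b" "line_energy ws \<le> cost_dist f D a b + \<eta>"
          by blast
        from argmin_energy_le[OF V(1) ws(1) elim(2,3)] ws(2) show ?case
          by linarith
      qed
      have sub: "\<exists>(s :: nat \<Rightarrow> nat) \<gamma>. strict_mono s \<and>
          \<gamma> \<in> argmin_on (path_cost f) (lipschitz_paths D a b) \<and>
          (\<lambda>k. hausdorff_dist (set (vs (r (s k)))) (path_image \<gamma>)) \<longlonglongrightarrow> 0"
        if r: "strict_mono r" for r :: "nat \<Rightarrow> nat"
        by (rule minimizer_subsequence[OF ends V(1) eps_lim vs[unfolded paths] _ r]) (rule opt)
      have limit: "(\<lambda>n. hausdorff_dist (set (vs n)) (path_image \<gamma>)) \<longlonglongrightarrow> 0"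
        if unique: "\<forall>\<eta>\<in>argmin_on (path_cost f) (lipschitz_paths D a b). reparametrization_of \<eta> \<gamma>" for \<gamma>
      proof (rule LIMSEQ_zero_subsequence_principle)
        fix r :: "nat \<Rightarrow> nat" assume "strict_mono r"
        from sub[OF this] obtain s \<eta> where "\<eta> \<in> argmin_on (path_cost f) (lipschitz_paths D a b)"
          and lim: "(\<lambda>k. hausdorff_dist (set (vs (r (s k)))) (path_image \<eta>)) \<longlonglongrightarrow> 0"
          by blast
        then have "path_image \<eta> = path_image \<gamma>"
          using unique by (intro path_image_reparametrization) blast
        with lim show "\<exists>s. (\<lambda>k. hausdorff_dist (set (vs (r (s k)))) (path_image \<gamma>)) \<longlonglongrightarrow> 0"
          by auto
      qed
      show "(\<forall>r :: nat \<Rightarrow> nat. strict_mono r \<longrightarrow>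
         (\<exists>(s :: nat \<Rightarrow> nat) \<gamma>. strict_mono s \<and>
            \<gamma> \<in> argmin_on (path_cost f) (lipschitz_paths D a b) \<and>
            (\<lambda>k. hausdorff_dist (set (vs (r (s k)))) (path_image \<gamma>)) \<longlonglongrightarrow> 0)) \<and>
        (\<forall>\<gamma>. \<gamma> \<in> argmin_on (path_cost f) (lipschitz_paths D a b) \<and>
           (\<forall>\<eta>\<in>argmin_on (path_cost f) (lipschitz_paths D a b). reparametrization_of \<eta> \<gamma>) \<longrightarrow>
           (\<lambda>n. hausdorff_dist (set (vs n)) (path_image \<gamma>)) \<longlonglongrightarrow> 0)"
        using sub limit by blast
    qed
  qed
qed

end
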